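(* Work in $\mathbf{CZF}$. Full NID follows from the presentation axiom $\mathbf{PA}$ and the axiom of relativised dependent choice for W-types.
   Context: For $f:B\to A$ write $B_a=f^{-1}(a)$; the W-type $W_f$ is the initial algebra for the functor $X\mapsto\{(a,t):a\in A,t:B_a\to X\}$, whose elements are of the form $\sup_a t$ with $a\in A$, $t:B_a\to W_f$. A set is a base if every surjection onto it from a set has a section; $\mathbf{PA}$ says every set is a surjective image of a base; $f:B\to A$ is a base map if $A$ and all fibres $B_a$ are bases. The axiom of relativised dependent choice for W-types: for every base map $f:B\to A$ the W-type $W_f$ exists, and for every class $X$ and every family of (class) relations $R_a\subseteq X^{B_a}\times X$ ($a\in A$), given uniformly in $a$, that are total (for every $s:B_a\to X$ there is $x\in X$ with $(s,x)\in R_a$), there is a function $h:W_f\to X$ with $(h\circ t,h(\sup_a t))\in R_a$ for every $\sup_a t\in W_f$. Full NID: for every set $X$ and every set $\mathcal R$ of rules on $X$ (pairs $(a,b)$ of subsets of $X$), the class of $Y\subseteq X$ closed under all rules ($a\subseteq Y$ implies $b\cap Y$ inhabited) is set-generated, i.e. there is a set $G$ of such closed sets such that for every closed $Y$ and $y\in Y$ some $\beta\in G$ satisfies $y\in\beta\subseteq Y$. *)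

theory Defs
  imports Main
begin

section \<open>Intuitionistic first-order logic with equality in the language of set theory\<close>

text \<open>
  Formulas use de Bruijn indices. The only terms are variables, so substitution is renaming.
\<close>

datatype fm =
    Mem nat nat
  | Eq nat nat
  | Bot
  | And fm fm
  | Or fm fm
  | Imp fm fm
  | All fm
  | Ex fm

primrec rename :: "(nat \<Rightarrow> nat) \<Rightarrow> fm \<Rightarrow> fm" where
  "rename r (Mem i j) = Mem (r i) (r j)"
| "rename r (Eq i j) = Eq (r i) (r j)"
| "rename r Bot = Bot"
| "rename r (And p q) = And (rename r p) (rename r q)"
| "rename r (Or p q) = Or (rename r p) (rename r q)"
| "rename r (Imp p q) = Imp (rename r p) (rename r q)"
| "rename r (All p) = All (rename (case_nat 0 (Suc \<circ> r)) p)"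
| "rename r (Ex p) = Ex (rename (case_nat 0 (Suc \<circ> r)) p)"

abbreviation shift :: "fm \<Rightarrow> fm" where
  "shift \<equiv> rename Suc"

text \<open>\<open>subst i p\<close> replaces index 0 of \<open>p\<close> by the variable \<open>i\<close> and lowers the other indices.\<close>

definition subst :: "nat \<Rightarrow> fm \<Rightarrow> fm" where
  "subst i = rename (case_nat i (\<lambda>n. n))"

text \<open>
  Natural deduction. The set \<open>T\<close> holds the non-logical axioms, the set \<open>\<Gamma>\<close> the open assumptions.
  The eigenvariable condition of \<open>AllI\<close> and \<open>ExE\<close> (the shifting of \<open>\<Gamma>\<close>) does not
  concern \<open>T\<close>: the free variables of an axiom are parameters, and an axiom stands for its
  universal closure.
\<close>

inductive prv :: "fm set \<Rightarrow> fm set \<Rightarrow> fm \<Rightarrow> bool" for T :: "fm set" where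
  Ax: "p \<in> T \<Longrightarrow> prv T \<Gamma> p"
| Hyp: "p \<in> \<Gamma> \<Longrightarrow> prv T \<Gamma> p"
| BotE: "prv T \<Gamma> Bot \<Longrightarrow> prv T \<Gamma> p"
| AndI: "prv T \<Gamma> p \<Longrightarrow> prv T \<Gamma> q \<Longrightarrow> prv T \<Gamma> (And p q)"
| AndE1: "prv T \<Gamma> (And p q) \<Longrightarrow> prv T \<Gamma> p"
| AndE2: "prv T \<Gamma> (And p q) \<Longrightarrow> prv T \<Gamma> q"
| OrI1: "prv T \<Gamma> p \<Longrightarrow> prv T \<Gamma> (Or p q)"
| OrI2: "prv T \<Gamma> q \<Longrightarrow> prv T \<Gamma> (Or p q)"
| OrE: "prv T \<Gamma> (Or p q) \<Longrightarrow> prv T (insert p \<Gamma>) r \<Longrightarrow> prv T (insert q \<Gamma>) r \<Longrightarrow> prv T \<Gamma> r"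
| ImpI: "prv T (insert p \<Gamma>) q \<Longrightarrow> prv T \<Gamma> (Imp p q)"
| ImpE: "prv T \<Gamma> (Imp p q) \<Longrightarrow> prv T \<Gamma> p \<Longrightarrow> prv T \<Gamma> q"
| AllI: "prv T (shift ` \<Gamma>) p \<Longrightarrow> prv T \<Gamma> (All p)"
| AllE: "prv T \<Gamma> (All p) \<Longrightarrow> prv T \<Gamma> (subst i p)"
| ExI: "prv T \<Gamma> (subst i p) \<Longrightarrow> prv T \<Gamma> (Ex p)"
| ExE: "prv T \<Gamma> (Ex p) \<Longrightarrow> prv T (insert p (shift ` \<Gamma>)) (shift q) \<Longrightarrow> prv T \<Gamma> q"
| EqRefl: "prv T \<Gamma> (Eq i i)"
| EqSubst: "prv T \<Gamma> (Eq i j) \<Longrightarrow> prv T \<Gamma> (subst i p) \<Longrightarrow> prv T \<Gamma> (subst j p)"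

definition derives :: "fm set \<Rightarrow> fm \<Rightarrow> bool" (infix "\<turnstile>" 50) where
  "T \<turnstile> p \<longleftrightarrow> prv T {} p"

text \<open>
  Bounded formulas. The bound \<open>Suc i\<close> is the variable \<open>i\<close> of the surrounding context, hence
  distinct from the bound variable.
\<close>

inductive bounded :: "fm \<Rightarrow> bool" where
  "bounded (Mem i j)"
| "bounded (Eq i j)"
| "bounded Bot"
| "bounded p \<Longrightarrow> bounded q \<Longrightarrow> bounded (And p q)"
| "bounded p \<Longrightarrow> bounded q \<Longrightarrow> bounded (Or p q)"
| "bounded p \<Longrightarrow> bounded q \<Longrightarrow> bounded (Imp p q)"
| "bounded p \<Longrightarrow> bounded (All (Imp (Mem 0 (Suc i)) p))"
| "bounded p \<Longrightarrow> bounded (Ex (And (Mem 0 (Suc i)) p))"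


section \<open>Named variables\<close>

text \<open>
  To write concrete formulas with readable variables, a formula is given as a function of the
  number \<open>d\<close> of quantifiers it stands under. A variable is the level of its binder, counted from
  the outside; below \<open>d\<close> binders the variable of level \<open>x\<close> has the index \<open>d - Suc x\<close>.
  Applying the function to \<open>0\<close> yields the formula itself.
\<close>

type_synonym var = nat
type_synonym form = "nat \<Rightarrow> fm"

definition mem :: "var \<Rightarrow> var \<Rightarrow> form" (infix "\<^bold>\<in>" 50) where
  "(x \<^bold>\<in> y) = (\<lambda>d. Mem (d - Suc x) (d - Suc y))"

definition eq :: "var \<Rightarrow> var \<Rightarrow> form" (infix "\<^bold>=" 50) where
  "(x \<^bold>= y) = (\<lambda>d. Eq (d - Suc x) (d - Suc y))"

definition bot :: form ("\<^bold>\<bottom>") where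
  "\<^bold>\<bottom> = (\<lambda>d. Bot)"

definition conj :: "form \<Rightarrow> form \<Rightarrow> form" (infixr "\<^bold>\<and>" 35) where
  "(p \<^bold>\<and> q) = (\<lambda>d. And (p d) (q d))"

definition disj :: "form \<Rightarrow> form \<Rightarrow> form" (infixr "\<^bold>\<or>" 30) where
  "(p \<^bold>\<or> q) = (\<lambda>d. Or (p d) (q d))"

definition imp :: "form \<Rightarrow> form \<Rightarrow> form" (infixr "\<^bold>\<longrightarrow>" 25) where
  "(p \<^bold>\<longrightarrow> q) = (\<lambda>d. Imp (p d) (q d))"

definition iff :: "form \<Rightarrow> form \<Rightarrow> form" (infixr "\<^bold>\<longleftrightarrow>" 25) where
  "(p \<^bold>\<longleftrightarrow> q) = ((p \<^bold>\<longrightarrow> q) \<^bold>\<and> (q \<^bold>\<longrightarrow> p))"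

definition all :: "(var \<Rightarrow> form) \<Rightarrow> form" (binder "\<^bold>\<forall>" 10) where
  "all F = (\<lambda>d. All (F d (Suc d)))"

definition ex :: "(var \<Rightarrow> form) \<Rightarrow> form" (binder "\<^bold>\<exists>" 10) where
  "ex F = (\<lambda>d. Ex (F d (Suc d)))"

text \<open>
  \<open>inst p [x\<^sub>0, \<dots>, x\<^sub>n]\<close> is an arbitrary formula \<open>p\<close> at the given arguments: the indices
  \<open>0, \<dots>, n\<close> of \<open>p\<close> become these variables; the remaining ones are parameters, which the
  quantifiers around \<open>inst\<close> do not capture.
\<close>

definition inst :: "fm \<Rightarrow> var list \<Rightarrow> form" where
  "inst p xs = (\<lambda>d. rename
     (\<lambda>i. if i < length xs then d - Suc (xs ! i) else d + (i - length xs)) p)"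


section \<open>The axioms of CZF\<close>

definition Extensionality :: form where
  "Extensionality = (\<^bold>\<forall>a. \<^bold>\<forall>b. (\<^bold>\<forall>x. x \<^bold>\<in> a \<^bold>\<longleftrightarrow> x \<^bold>\<in> b) \<^bold>\<longrightarrow> a \<^bold>= b)"

definition Pairing :: form where
  "Pairing = (\<^bold>\<forall>a. \<^bold>\<forall>b. \<^bold>\<exists>c. \<^bold>\<forall>x. x \<^bold>\<in> c \<^bold>\<longleftrightarrow> x \<^bold>= a \<^bold>\<or> x \<^bold>= b)"

definition Union :: form where
  "Union = (\<^bold>\<forall>a. \<^bold>\<exists>c. \<^bold>\<forall>x. x \<^bold>\<in> c \<^bold>\<longleftrightarrow> (\<^bold>\<exists>y. y \<^bold>\<in> a \<^bold>\<and> x \<^bold>\<in> y))"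

definition is_empty :: "var \<Rightarrow> form" where
  "is_empty u = (\<^bold>\<forall>x. x \<^bold>\<in> u \<^bold>\<longrightarrow> \<^bold>\<bottom>)"

definition is_succ :: "var \<Rightarrow> var \<Rightarrow> form" where
  "is_succ u v = (\<^bold>\<forall>x. x \<^bold>\<in> u \<^bold>\<longleftrightarrow> x \<^bold>\<in> v \<^bold>\<or> x \<^bold>= v)"

definition Strong_Infinity :: form where
  "Strong_Infinity = (\<^bold>\<exists>w. \<^bold>\<forall>u. u \<^bold>\<in> w \<^bold>\<longleftrightarrow> is_empty u \<^bold>\<or> (\<^bold>\<exists>v. v \<^bold>\<in> w \<^bold>\<and> is_succ u v))"

definition Set_Induction :: "fm \<Rightarrow> form" where
  "Set_Induction p =
    ((\<^bold>\<forall>a. (\<^bold>\<forall>x. x \<^bold>\<in> a \<^bold>\<longrightarrow> inst p [x]) \<^bold>\<longrightarrow> inst p [a]) \<^bold>\<longrightarrow> (\<^bold>\<forall>a. inst p [a]))"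

definition Separation :: "fm \<Rightarrow> form" where
  "Separation p = (\<^bold>\<forall>a. \<^bold>\<exists>c. \<^bold>\<forall>x. x \<^bold>\<in> c \<^bold>\<longleftrightarrow> x \<^bold>\<in> a \<^bold>\<and> inst p [x])"

definition Strong_Collection :: "fm \<Rightarrow> form" where
  "Strong_Collection p =
    (\<^bold>\<forall>a. (\<^bold>\<forall>x. x \<^bold>\<in> a \<^bold>\<longrightarrow> (\<^bold>\<exists>y. inst p [x, y])) \<^bold>\<longrightarrow>
      (\<^bold>\<exists>b. (\<^bold>\<forall>x. x \<^bold>\<in> a \<^bold>\<longrightarrow> (\<^bold>\<exists>y. y \<^bold>\<in> b \<^bold>\<and> inst p [x, y])) \<^bold>\<and>
           (\<^bold>\<forall>y. y \<^bold>\<in> b \<^bold>\<longrightarrow> (\<^bold>\<exists>x. x \<^bold>\<in> a \<^bold>\<and> inst p [x, y]))))"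

definition Subset_Collection :: "fm \<Rightarrow> form" where
  "Subset_Collection p =
    (\<^bold>\<forall>a. \<^bold>\<forall>b. \<^bold>\<exists>c. \<^bold>\<forall>u.
      (\<^bold>\<forall>x. x \<^bold>\<in> a \<^bold>\<longrightarrow> (\<^bold>\<exists>y. y \<^bold>\<in> b \<^bold>\<and> inst p [x, y, u])) \<^bold>\<longrightarrow>
      (\<^bold>\<exists>e. e \<^bold>\<in> c \<^bold>\<and>
        (\<^bold>\<forall>x. x \<^bold>\<in> a \<^bold>\<longrightarrow> (\<^bold>\<exists>y. y \<^bold>\<in> e \<^bold>\<and> inst p [x, y, u])) \<^bold>\<and>
        (\<^bold>\<forall>y. y \<^bold>\<in> e \<^bold>\<longrightarrow> (\<^bold>\<exists>x. x \<^bold>\<in> a \<^bold>\<and> inst p [x, y, u]))))"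

definition CZF :: "fm set" where
  "CZF =
    {Extensionality 0, Pairing 0, Union 0, Strong_Infinity 0}
    \<union> {Set_Induction p 0 |p. True}
    \<union> {Separation p 0 |p. bounded p}
    \<union> {Strong_Collection p 0 |p. True}
    \<union> {Subset_Collection p 0 |p. True}"


section \<open>Relations and functions\<close>

definition is_subset :: "var \<Rightarrow> var \<Rightarrow> form" (infix "\<^bold>\<subseteq>" 50) where
  "(a \<^bold>\<subseteq> b) = (\<^bold>\<forall>x. x \<^bold>\<in> a \<^bold>\<longrightarrow> x \<^bold>\<in> b)"

definition is_upair :: "var \<Rightarrow> var \<Rightarrow> var \<Rightarrow> form" where
  "is_upair u x y = (\<^bold>\<forall>z. z \<^bold>\<in> u \<^bold>\<longleftrightarrow> z \<^bold>= x \<^bold>\<or> z \<^bold>= y)"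

text \<open>Kuratowski pairs: \<open>p = {{x, x}, {x, y}}\<close>.\<close>

definition is_pair :: "var \<Rightarrow> var \<Rightarrow> var \<Rightarrow> form" where
  "is_pair p x y = (\<^bold>\<forall>u. u \<^bold>\<in> p \<^bold>\<longleftrightarrow> is_upair u x x \<^bold>\<or> is_upair u x y)"

definition related :: "var \<Rightarrow> var \<Rightarrow> var \<Rightarrow> form" where
  "related r x y = (\<^bold>\<exists>p. p \<^bold>\<in> r \<^bold>\<and> is_pair p x y)"

text \<open>The set \<open>f\<close> is a function from the set \<open>a\<close> to the class \<open>C\<close>.\<close>

definition is_fun_class :: "var \<Rightarrow> var \<Rightarrow> (var \<Rightarrow> form) \<Rightarrow> form" where
  "is_fun_class f a C =
    ((\<^bold>\<forall>p. p \<^bold>\<in> f \<^bold>\<longrightarrow> (\<^bold>\<exists>x. \<^bold>\<exists>y. x \<^bold>\<in> a \<^bold>\<and> C y \<^bold>\<and> is_pair p x y)) \<^bold>\<and>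
     (\<^bold>\<forall>x. x \<^bold>\<in> a \<^bold>\<longrightarrow> (\<^bold>\<exists>y. related f x y \<^bold>\<and> (\<^bold>\<forall>z. related f x z \<^bold>\<longrightarrow> z \<^bold>= y))))"

definition is_fun :: "var \<Rightarrow> var \<Rightarrow> var \<Rightarrow> form" where
  "is_fun f a b = is_fun_class f a (\<lambda>y. y \<^bold>\<in> b)"

definition is_surj :: "var \<Rightarrow> var \<Rightarrow> var \<Rightarrow> form" where
  "is_surj f a b = (is_fun f a b \<^bold>\<and> (\<^bold>\<forall>y. y \<^bold>\<in> b \<^bold>\<longrightarrow> (\<^bold>\<exists>x. x \<^bold>\<in> a \<^bold>\<and> related f x y)))"

text \<open>\<open>u = h \<circ> t\<close>\<close>

definition is_comp :: "var \<Rightarrow> var \<Rightarrow> var \<Rightarrow> form" where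
  "is_comp u h t =
    (\<^bold>\<forall>p. p \<^bold>\<in> u \<^bold>\<longleftrightarrow> (\<^bold>\<exists>x. \<^bold>\<exists>y. \<^bold>\<exists>z. related t x y \<^bold>\<and> related h y z \<^bold>\<and> is_pair p x z))"

text \<open>\<open>k\<close> is the fibre of the function \<open>f\<close> over \<open>a\<close>.\<close>

definition is_fibre :: "var \<Rightarrow> var \<Rightarrow> var \<Rightarrow> form" where
  "is_fibre k f a = (\<^bold>\<forall>b. b \<^bold>\<in> k \<^bold>\<longleftrightarrow> related f b a)"


section \<open>The presentation axiom\<close>

definition is_base :: "var \<Rightarrow> form" where
  "is_base b =
    (\<^bold>\<forall>c. \<^bold>\<forall>g. is_surj g c b \<^bold>\<longrightarrow>
      (\<^bold>\<exists>s. is_fun s b c \<^bold>\<and> (\<^bold>\<forall>x. \<^bold>\<forall>y. related s x y \<^bold>\<longrightarrow> related g y x)))"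

definition PA :: form where
  "PA = (\<^bold>\<forall>x. \<^bold>\<exists>b. is_base b \<^bold>\<and> (\<^bold>\<exists>g. is_surj g b x))"

definition is_base_map :: "var \<Rightarrow> var \<Rightarrow> var \<Rightarrow> form" where
  "is_base_map f B A =
    (is_fun f B A \<^bold>\<and> is_base A \<^bold>\<and> (\<^bold>\<forall>a. a \<^bold>\<in> A \<^bold>\<longrightarrow> (\<^bold>\<forall>k. is_fibre k f a \<^bold>\<longrightarrow> is_base k)))"


section \<open>W-types\<close>

text \<open>\<open>P = {(a, t). a \<in> A, t : B\<^sub>a \<rightarrow> X}\<close>, where \<open>f : B \<rightarrow> A\<close>.\<close>

definition is_poly :: "var \<Rightarrow> var \<Rightarrow> var \<Rightarrow> var \<Rightarrow> form" where
  "is_poly P f A X =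
    (\<^bold>\<forall>p. p \<^bold>\<in> P \<^bold>\<longleftrightarrow>
      (\<^bold>\<exists>a. \<^bold>\<exists>k. \<^bold>\<exists>t. a \<^bold>\<in> A \<^bold>\<and> is_fibre k f a \<^bold>\<and> is_fun t k X \<^bold>\<and> is_pair p a t))"

definition is_algebra :: "var \<Rightarrow> var \<Rightarrow> var \<Rightarrow> var \<Rightarrow> form" where
  "is_algebra f A X m = (\<^bold>\<exists>P. is_poly P f A X \<^bold>\<and> is_fun m P X)"

text \<open>\<open>m (a, t) = x\<close>\<close>

definition alg_val :: "var \<Rightarrow> var \<Rightarrow> var \<Rightarrow> var \<Rightarrow> form" where
  "alg_val m a t x = (\<^bold>\<exists>p. is_pair p a t \<^bold>\<and> related m p x)"

text \<open>
  \<open>h : W \<rightarrow> X\<close> and \<open>h (s (a, t)) = m (a, h \<circ> t)\<close> for all \<open>(a, t)\<close> in the domain of the algebra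
  \<open>s\<close> on \<open>W\<close>.
\<close>

definition is_alg_hom :: "var \<Rightarrow> var \<Rightarrow> var \<Rightarrow> var \<Rightarrow> var \<Rightarrow> form" where
  "is_alg_hom h W s X m =
    (is_fun h W X \<^bold>\<and>
     (\<^bold>\<forall>a. \<^bold>\<forall>t. \<^bold>\<forall>w. alg_val s a t w \<^bold>\<longrightarrow>
       (\<^bold>\<exists>u. \<^bold>\<exists>x. is_comp u h t \<^bold>\<and> related h w x \<^bold>\<and> alg_val m a u x)))"

definition is_W_type :: "var \<Rightarrow> var \<Rightarrow> var \<Rightarrow> var \<Rightarrow> form" where
  "is_W_type f A W s =
    (is_algebra f A W s \<^bold>\<and>
     (\<^bold>\<forall>X. \<^bold>\<forall>m. is_algebra f A X m \<^bold>\<longrightarrow>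
       (\<^bold>\<exists>h. is_alg_hom h W s X m \<^bold>\<and> (\<^bold>\<forall>g. is_alg_hom g W s X m \<^bold>\<longrightarrow> g \<^bold>= h))))"


section \<open>Relativised dependent choice for W-types\<close>

definition W_types_exist :: form where
  "W_types_exist =
    (\<^bold>\<forall>B. \<^bold>\<forall>A. \<^bold>\<forall>f. is_base_map f B A \<^bold>\<longrightarrow> (\<^bold>\<exists>W. \<^bold>\<exists>s. is_W_type f A W s))"

text \<open>
  The class \<open>C = {x. p(x)}\<close> and the relations \<open>R\<^sub>a = {(t, x). q(a, t, x)}\<close> are given by formulas
  with parameters. The first hypothesis on \<open>q\<close> says \<open>R\<^sub>a \<subseteq> C\<^bsup>B\<^sub>a\<^esup> \<times> C\<close>, the second that
  each \<open>R\<^sub>a\<close> is total. In the conclusion, \<open>alg_val s a t w\<close> reads \<open>w = sup\<^sub>a t\<close>.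
\<close>

definition W_dependent_choice :: "fm \<Rightarrow> fm \<Rightarrow> form" where
  "W_dependent_choice p q =
    (\<^bold>\<forall>B. \<^bold>\<forall>A. \<^bold>\<forall>f. \<^bold>\<forall>W. \<^bold>\<forall>s.
      is_base_map f B A \<^bold>\<longrightarrow>
      is_W_type f A W s \<^bold>\<longrightarrow>
      (\<^bold>\<forall>a. \<^bold>\<forall>k. a \<^bold>\<in> A \<^bold>\<longrightarrow> is_fibre k f a \<^bold>\<longrightarrow>
        (\<^bold>\<forall>t. \<^bold>\<forall>x. inst q [a, t, x] \<^bold>\<longrightarrow> is_fun_class t k (\<lambda>y. inst p [y]) \<^bold>\<and> inst p [x])) \<^bold>\<longrightarrow>
      (\<^bold>\<forall>a. \<^bold>\<forall>k. a \<^bold>\<in> A \<^bold>\<longrightarrow> is_fibre k f a \<^bold>\<longrightarrow>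
        (\<^bold>\<forall>t. is_fun_class t k (\<lambda>y. inst p [y]) \<^bold>\<longrightarrow> (\<^bold>\<exists>x. inst p [x] \<^bold>\<and> inst q [a, t, x]))) \<^bold>\<longrightarrow>
      (\<^bold>\<exists>h. is_fun_class h W (\<lambda>y. inst p [y]) \<^bold>\<and>
        (\<^bold>\<forall>a. \<^bold>\<forall>t. \<^bold>\<forall>w. alg_val s a t w \<^bold>\<longrightarrow>
          (\<^bold>\<exists>u. \<^bold>\<exists>x. is_comp u h t \<^bold>\<and> related h w x \<^bold>\<and> inst q [a, u, x]))))"

definition RDC_W :: "fm set" where
  "RDC_W = {W_types_exist 0} \<union> {W_dependent_choice p q 0 |p q. True}"


section \<open>Non-deterministic inductive definitions\<close>

definition is_rule_set :: "var \<Rightarrow> var \<Rightarrow> form" where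
  "is_rule_set R X =
    (\<^bold>\<forall>p. p \<^bold>\<in> R \<^bold>\<longrightarrow> (\<^bold>\<exists>a. \<^bold>\<exists>b. a \<^bold>\<subseteq> X \<^bold>\<and> b \<^bold>\<subseteq> X \<^bold>\<and> is_pair p a b))"

definition is_closed :: "var \<Rightarrow> var \<Rightarrow> form" where
  "is_closed Y R =
    (\<^bold>\<forall>a. \<^bold>\<forall>b. related R a b \<^bold>\<longrightarrow> a \<^bold>\<subseteq> Y \<^bold>\<longrightarrow> (\<^bold>\<exists>x. x \<^bold>\<in> b \<^bold>\<and> x \<^bold>\<in> Y))"

definition Full_NID :: form where
  "Full_NID =
    (\<^bold>\<forall>X. \<^bold>\<forall>R. is_rule_set R X \<^bold>\<longrightarrow>
      (\<^bold>\<exists>G. (\<^bold>\<forall>\<beta>. \<beta> \<^bold>\<in> G \<^bold>\<longrightarrow> \<beta> \<^bold>\<subseteq> X \<^bold>\<and> is_closed \<beta> R) \<^bold>\<and>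
        (\<^bold>\<forall>Y. Y \<^bold>\<subseteq> X \<^bold>\<and> is_closed Y R \<^bold>\<longrightarrow>
          (\<^bold>\<forall>y. y \<^bold>\<in> Y \<^bold>\<longrightarrow> (\<^bold>\<exists>\<beta>. \<beta> \<^bold>\<in> G \<^bold>\<and> y \<^bold>\<in> \<beta> \<^bold>\<and> \<beta> \<^bold>\<subseteq> Y)))))"

end

theory Submission
  imports Defs "HOL-Library.Countable"
begin

text \<open>
  By completeness for Kripke models it suffices that \<open>Full_NID\<close> is forced at every world \<open>w\<close> of
  every model of the axioms. At a single world conjunction, disjunction and existential
  quantification are classical; only implication and universal quantification refer to later worlds.

  The argument in CZF. By adding the rule \<open>(\<emptyset>, {y})\<close> and collecting over all \<open>y \<in> X\<close>, it is enough to
  find a set of closed sets such that every closed \<open>Y\<close> includes one of them. Let the base \<open>A\<close> cover the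
  set of rules \<open>(a\<^sub>i, b\<^sub>i)\<close>, choose bases \<open>B\<^sub>i\<close> covering the premises \<open>a\<^sub>i\<close>, and let \<open>W\<close> be the
  W-type of \<open>B \<rightarrow> A\<close>. Given a closed \<open>Y\<close>, dependent choice should label \<open>W\<close> by points of \<open>Y\<close>, but a
  conclusion of rule \<open>i\<close> is available only if the labels of the subtrees exhaust \<open>a\<^sub>i\<close>, which is
  undecidable. So the labels are subsets \<open>x \<subseteq> Y\<close>: the label of \<open>sup\<^sub>i t\<close> has to meet \<open>b\<^sub>i\<close> if
  \<open>a\<^sub>i\<close> is covered by the labels along \<open>t\<close>. The union of all labels is then closed, because every
  cover of \<open>a\<^sub>i\<close> by labels lifts to some \<open>t : B\<^sub>i \<rightarrow> W\<close>, as \<open>B\<^sub>i\<close> is a base.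

  For these unions to range over a set, the labels have to come from a set \<open>S\<close> given before \<open>Y\<close>.
  Subset collection yields a set of sufficiently many labels for one step, and a first application of
  dependent choice to \<open>W\<close> iterates this. Since the \<open>B\<^sub>i\<close> are bases, every family \<open>B\<^sub>i \<rightarrow> S\<close> arises
  from a family \<open>B\<^sub>i \<rightarrow> W\<close>, so no induction on \<open>W\<close> is needed. Finally subset collection applied to
  \<open>W\<close> and \<open>S\<close> bounds the ranges of the labellings \<open>W \<rightarrow> S\<close>.
\<close>

subsection \<open>Renaming\<close>

text \<open>Working in Kripke models replaces derivations in the calculus by ordinary HOL reasoning
  that only keeps track of worlds. The price: an axiom scheme applies to a semantic predicate only
  if a formula with parameters defines it, so the notions occur both as formulas and as unfolded
  meanings, and separation even needs bounded formulas. Models interpret equality by a congruence,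
  so uniqueness is always up to \<open>E\<close>. Why one step needs only a set of labels: that the
  premise is covered is a truth value, represented by a subset of a singleton, and the label is the
  image of this subset under a relation into the conclusion. Subset collection bounds such images
  independently of \<open>Y\<close>. Moreover covering depends only on the range of the family of
  labels, and subset collection bounds these ranges too. The two uses of dependent choice differ in
  what they attach to a tree: the first a set of labels, adequate for all ways of choosing one label
  from each set at the subtrees, as \<open>Y\<close> is not yet known; the second a single label
  included in the given \<open>Y\<close>. Tags on the base covers are needed because the fibres of
  one map have to be disjoint.\<close>

abbreviation lift :: "(nat \<Rightarrow> nat) \<Rightarrow> nat \<Rightarrow> nat" where
  "lift r \<equiv> case_nat 0 (Suc \<circ> r)"

primrec fv :: "fm \<Rightarrow> nat set" where
  "fv (Mem i j) = {i, j}"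
| "fv (Eq i j) = {i, j}"
| "fv Bot = {}"
| "fv (And p q) = fv p \<union> fv q"
| "fv (Or p q) = fv p \<union> fv q"
| "fv (Imp p q) = fv p \<union> fv q"
| "fv (All p) = {i. Suc i \<in> fv p}"
| "fv (Ex p) = {i. Suc i \<in> fv p}"

lemma finite_fv: "finite (fv p)"
proof (induction p)
  case (All p)
  with finite_vimageI[OF All, of Suc] show ?case by (simp add: vimage_def)
next
  case (Ex p)
  with finite_vimageI[OF Ex, of Suc] show ?case by (simp add: vimage_def)
qed auto

lemma rename_cong: "(\<And>i. i \<in> fv p \<Longrightarrow> r i = s i) \<Longrightarrow> rename r p = rename s p"
proof (induction p arbitrary: r s)
  case (All p)
  have "rename (lift r) p = rename (lift s) p"
    by (rule All.IH) (auto split: nat.splits intro: All.prems)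
  then show ?case by simp
next
  case (Ex p)
  have "rename (lift r) p = rename (lift s) p"
    by (rule Ex.IH) (auto split: nat.splits intro: Ex.prems)
  then show ?case by simp
next
  case (And p q)
  from And.IH[of r s] And.prems show ?case by simp
next
  case (Or p q)
  from Or.IH[of r s] Or.prems show ?case by simp
next
  case (Imp p q)
  from Imp.IH[of r s] Imp.prems show ?case by simp
qed simp_all

lemma rename_rename: "rename r (rename s p) = rename (r \<circ> s) p"
proof (induction p arbitrary: r s)
  case (All p)
  have "lift r \<circ> lift s = lift (r \<circ> s)" by (auto split: nat.splits)
  with All show ?case by (simp del: comp_apply)
next
  case (Ex p)
  have "lift r \<circ> lift s = lift (r \<circ> s)" by (auto split: nat.splits)
  with Ex show ?case by (simp del: comp_apply)
qed auto

lemma rename_ident: "rename (\<lambda>i. i) p = p"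
proof (induction p)
  case (All p)
  have "lift (\<lambda>i. i) = (\<lambda>i. i)" by (auto split: nat.splits)
  with All show ?case by simp
next
  case (Ex p)
  have "lift (\<lambda>i. i) = (\<lambda>i. i)" by (auto split: nat.splits)
  with Ex show ?case by simp
qed auto

lemma Suc_in_lift_image: "Suc i \<in> lift r ` A \<longleftrightarrow> i \<in> r ` {j. Suc j \<in> A}"
proof
  assume "Suc i \<in> lift r ` A"
  then obtain j where "j \<in> A" "Suc i = lift r j" by auto
  then show "i \<in> r ` {j. Suc j \<in> A}" by (cases j) auto
next
  assume "i \<in> r ` {j. Suc j \<in> A}"
  then obtain j where "Suc j \<in> A" "i = r j" by auto
  then show "Suc i \<in> lift r ` A" by (intro image_eqI[of _ _ "Suc j"]) auto
qed

lemma fv_rename: "fv (rename r p) = r ` fv p"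
proof (induction p arbitrary: r)
  case (All p)
  then show ?case by (simp add: Suc_in_lift_image) 
next
  case (Ex p)
  then show ?case by (simp add: Suc_in_lift_image)
qed auto

lemma rename_subst: "rename r (subst i p) = subst (r i) (rename (lift r) p)"
  unfolding subst_def rename_rename by (rule rename_cong) (auto split: nat.splits)

lemma rename_lift_shift: "rename (lift r) (shift p) = shift (rename r p)"
  unfolding rename_rename by (rule rename_cong) (auto split: nat.splits)

lemma subst_rename_lift: "subst c (rename (lift e) p) = rename (case_nat c e) p"
  unfolding subst_def rename_rename by (rule rename_cong) (auto split: nat.splits)

lemma fv_subst: "fv (subst c p) \<subseteq> insert c (fv (Ex p))"
  unfolding subst_def fv_rename by (auto split: nat.splits)

subsection \<open>Structural properties of derivations\<close>

lemma prv_weaken: "prv T \<Gamma> p \<Longrightarrow> \<Gamma> \<subseteq> \<Delta> \<Longrightarrow> prv T \<Delta> p"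
proof (induction arbitrary: \<Delta> rule: prv.induct)
  case (Ax p \<Gamma>)
  show ?case by (rule prv.Ax[OF Ax.hyps])
next
  case (Hyp p \<Gamma>)
  show ?case by (rule prv.Hyp[OF subsetD[OF Hyp.prems Hyp.hyps]])
next
  case (BotE \<Gamma> p)
  show ?case by (rule prv.BotE[OF BotE.IH[OF BotE.prems]])
next
  case (AndI \<Gamma> p q)
  show ?case by (rule prv.AndI[OF AndI.IH(1)[OF AndI.prems] AndI.IH(2)[OF AndI.prems]])
next
  case (AndE1 \<Gamma> p q)
  show ?case by (rule prv.AndE1[OF AndE1.IH[OF AndE1.prems]])
next
  case (AndE2 \<Gamma> p q)
  show ?case by (rule prv.AndE2[OF AndE2.IH[OF AndE2.prems]])
next
  case (OrI1 \<Gamma> p q)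
  show ?case by (rule prv.OrI1[OF OrI1.IH[OF OrI1.prems]])
next
  case (OrI2 \<Gamma> q p)
  show ?case by (rule prv.OrI2[OF OrI2.IH[OF OrI2.prems]])
next
  case (OrE \<Gamma> p q r)
  note * = insert_mono[OF OrE.prems]
  show ?case by (rule prv.OrE[OF OrE.IH(1)[OF OrE.prems] OrE.IH(2)[OF *] OrE.IH(3)[OF *]])
next
  case (ImpI p \<Gamma> q)
  show ?case by (rule prv.ImpI[OF ImpI.IH[OF insert_mono[OF ImpI.prems]]])
next
  case (ImpE \<Gamma> p q)
  show ?case by (rule prv.ImpE[OF ImpE.IH(1)[OF ImpE.prems] ImpE.IH(2)[OF ImpE.prems]])
next
  case (AllI \<Gamma> p)
  show ?case by (rule prv.AllI[OF AllI.IH[OF image_mono[OF AllI.prems]]])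
next
  case (AllE \<Gamma> p i)
  show ?case by (rule prv.AllE[OF AllE.IH[OF AllE.prems]])
next
  case (ExI \<Gamma> i p)
  show ?case by (rule prv.ExI[OF ExI.IH[OF ExI.prems]])
next
  case (ExE \<Gamma> p q)
  note * = insert_mono[OF image_mono[OF ExE.prems]]
  show ?case by (rule prv.ExE[OF ExE.IH(1)[OF ExE.prems] ExE.IH(2)[OF *]])
next
  case (EqRefl \<Gamma> i)
  show ?case by (rule prv.EqRefl)
next
  case (EqSubst \<Gamma> i j p)
  show ?case by (rule prv.EqSubst[OF EqSubst.IH(1)[OF EqSubst.prems] EqSubst.IH(2)[OF
    EqSubst.prems]])
qed

text \<open>Needed at the limit of the Lindenbaum construction, where a derivation must already live
  at a finite stage.\<close>

lemma prv_finite: "prv T \<Gamma> p \<Longrightarrow> \<exists>\<Delta>. finite \<Delta> \<and> \<Delta> \<subseteq> \<Gamma> \<and> prv T \<Delta> p"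
proof (induction rule: prv.induct)
  case (Ax p \<Gamma>)
  then show ?case by (auto intro!: exI[of _ "{}"] prv.Ax)
next
  case (Hyp p \<Gamma>)
  then show ?case by (auto intro!: exI[of _ "{p}"] prv.Hyp)
next
  case (AndI \<Gamma> p q)
  then obtain A B where "finite A" "A \<subseteq> \<Gamma>" "prv T A p" "finite B" "B \<subseteq> \<Gamma>" "prv T B q" by auto
  then show ?case
    using prv.AndI[OF prv_weaken[OF _ Un_upper1] prv_weaken[OF _ Un_upper2], of T A p B q]
    by (intro exI[of _ "A \<union> B"] conjI) auto
next
  case (OrE \<Gamma> p q r)
  then obtain A B C where *: "finite A" "A \<subseteq> \<Gamma>" "prv T A (Or p q)"
    "finite B" "B \<subseteq> insert p \<Gamma>" "prv T B r" "finite C" "C \<subseteq> insert q \<Gamma>" "prv T C r" by auto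
  show ?case
  proof (intro exI[of _ "A \<union> (B - {p}) \<union> (C - {q})"] conjI)
    show "prv T (A \<union> (B - {p}) \<union> (C - {q})) r"
      by (rule prv.OrE[of _ _ p q]) (rule *(3,6,9)[THEN prv_weaken], blast)+
  qed (use * in auto)
next
  case (ImpI p \<Gamma> q)
  then obtain A where *: "finite A" "A \<subseteq> insert p \<Gamma>" "prv T A q" by auto
  show ?case
  proof (intro exI[of _ "A - {p}"] conjI)
    show "prv T (A - {p}) (Imp p q)"
      by (rule prv.ImpI) (rule *(3)[THEN prv_weaken], blast)
  qed (use * in auto)
next
  case (ImpE \<Gamma> p q)
  then obtain A B where "finite A" "A \<subseteq> \<Gamma>" "prv T A (Imp p q)" "finite B" "B \<subseteq> \<Gamma>" "prv T B p"
    by auto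
  then show ?case
    using prv.ImpE[OF prv_weaken[OF _ Un_upper1] prv_weaken[OF _ Un_upper2], of T A p q B]
    by (intro exI[of _ "A \<union> B"] conjI) auto
next
  case (AllI \<Gamma> p)
  then obtain A where "finite A" "A \<subseteq> shift ` \<Gamma>" "prv T A p" by auto
  \<comment> \<open>A finite part of the shifted assumptions is the shift of a finite part of the
    original ones.\<close>
  moreover from this obtain B where "B \<subseteq> \<Gamma>" "finite B" "A = shift ` B"
    by (meson finite_subset_image)
  ultimately show ?case by (auto intro: prv.AllI)
next
  case (ExE \<Gamma> p q)
  then obtain A B where *: "finite A" "A \<subseteq> \<Gamma>" "prv T A (Ex p)"
    "finite B" "B \<subseteq> insert p (shift ` \<Gamma>)" "prv T B (shift q)" by blast
  have "finite (B - {p})" "B - {p} \<subseteq> shift ` \<Gamma>" using *(4,5) by auto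
  then obtain C where C: "C \<subseteq> \<Gamma>" "finite C" "B - {p} = shift ` C"
    by (meson finite_subset_image)
  then have "B \<subseteq> insert p (shift ` (A \<union> C))" by auto
  with *(6) have "prv T (insert p (shift ` (A \<union> C))) (shift q)" by (rule prv_weaken)
  then have "prv T (A \<union> C) q"
    using prv.ExE[OF prv_weaken[OF *(3) Un_upper1]] by blast
  then show ?case using * C by (intro exI[of _ "A \<union> C"]) auto
next
  case (EqSubst \<Gamma> i j p)
  then obtain A B where "finite A" "A \<subseteq> \<Gamma>" "prv T A (Eq i j)" "finite B" "B \<subseteq> \<Gamma>"
    "prv T B (subst i p)" by auto
  then show ?case
    using prv.EqSubst[OF prv_weaken[OF _ Un_upper1] prv_weaken[OF _ Un_upper2], of T A i j B p]
    by (intro exI[of _ "A \<union> B"] conjI) auto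
next
  case (BotE \<Gamma> p)
  from BotE.IH show ?case by (elim ex_forward) (elim conjE, intro conjI, assumption, assumption,
    erule prv.BotE)
next
  case (AndE1 \<Gamma> p q)
  from AndE1.IH show ?case by (elim ex_forward) (elim conjE, intro conjI, assumption, assumption,
    erule prv.AndE1)
next
  case (AndE2 \<Gamma> p q)
  from AndE2.IH show ?case by (elim ex_forward) (elim conjE, intro conjI, assumption, assumption,
    erule prv.AndE2)
next
  case (AllE \<Gamma> p i)
  from AllE.IH show ?case by (elim ex_forward) (elim conjE, intro conjI, assumption, assumption,
    erule prv.AllE)
next
  case (ExI \<Gamma> i p)
  from ExI.IH show ?case by (elim ex_forward) (elim conjE, intro conjI, assumption, assumption,
    erule prv.ExI)
next
  case (OrI1 \<Gamma> p q)
  from OrI1.IH show ?case by (elim ex_forward) (elim conjE, intro conjI, assumption, assumption,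
    erule prv.OrI1)
next
  case (OrI2 \<Gamma> q p)
  from OrI2.IH show ?case by (elim ex_forward) (elim conjE, intro conjI, assumption, assumption,
    erule prv.OrI2)
next
  case (EqRefl \<Gamma> i)
  then show ?case by (auto intro: prv.EqRefl)
qed

text \<open>\<open>AllE\<close> treats one quantifier and lowers the remaining variables, so after
  \<open>n\<close> eliminations the first \<open>n\<close> variables have been replaced at will and
  each other one has dropped by \<open>n\<close>. The drop is harmless in the application, where
  \<open>n\<close> bounds all free variables of \<open>p\<close>.\<close>

lemma prv_Alls_inst:
  "prv T \<Gamma> ((All ^^ n) p) \<Longrightarrow> prv T \<Gamma> (rename (\<lambda>k. if k < n then r k else k - n) p)"
proof (induction n arbitrary: p r)
  case 0
  then show ?case by (simp add: rename_ident)
next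
  case (Suc n)
  let ?\<rho> = "\<lambda>k. if k < n then r (Suc k) else k - n"
  from Suc.prems have "prv T \<Gamma> ((All ^^ n) (All p))" by (simp add: funpow_swap1)
  from Suc.IH[OF this, of "r \<circ> Suc"] have "prv T \<Gamma> (All (rename (lift ?\<rho>) p))"
    by (simp add: comp_def cong: if_cong)
  then have "prv T \<Gamma> (subst (r 0) (rename (lift ?\<rho>) p))" by (rule prv.AllE)
  also have "subst (r 0) (rename (lift ?\<rho>) p) = rename (\<lambda>k. if k < Suc n then r k else k - Suc n) p"
    unfolding subst_rename_lift by (rule rename_cong) (auto split: nat.splits)
  finally show ?case .
qed

text \<open>Axioms are implicitly universally closed, so their free variables can be instantiated.\<close>

lemma prv_axiom_rename:
  assumes "p \<in> T"
  shows "prv T \<Gamma> (rename r p)"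
proof -
  obtain n where n: "\<forall>k\<in>fv p. k < n"
    using finite_fv[of p] unfolding finite_nat_set_iff_bounded by blast
  \<comment> \<open>With no open assumptions \<open>AllI\<close> has nothing to shift, so an axiom
    can be closed under any number of quantifiers; the assumptions return by weakening.\<close>
  have "prv T {} ((All ^^ m) p)" for m
  proof (induction m)
    case 0
    show ?case using assms by (simp add: prv.Ax)
  next
    case (Suc m)
    then show ?case using prv.AllI[of T "{}"] by simp
  qed
  from prv_Alls_inst[OF this[of n]]
  have "prv T {} (rename (\<lambda>k. if k < n then r k else k - n) p)" .
  moreover have "rename (\<lambda>k. if k < n then r k else k - n) p = rename r p"
    using n by (intro rename_cong) auto
  ultimately show ?thesis using prv_weaken[of T "{}" "rename r p" \<Gamma>] by simp
qed

text \<open>Axioms survive because of their implicit closure, the eigenvariable rules because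
  \<open>lift r\<close> commutes with \<open>shift\<close>.\<close>

lemma prv_rename: "prv T \<Gamma> p \<Longrightarrow> prv T (rename r ` \<Gamma>) (rename r p)"
proof (induction arbitrary: r rule: prv.induct)
  case (Ax p \<Gamma>)
  then show ?case by (rule prv_axiom_rename)
next
  case (AllI \<Gamma> p)
  have "rename (lift r) ` shift ` \<Gamma> = shift ` rename r ` \<Gamma>"
    by (simp add: image_image rename_lift_shift)
  with AllI.IH[of "lift r"] show ?case by (simp add: prv.AllI)
next
  case (AllE \<Gamma> p i)
  from AllE.IH[of r] show ?case unfolding rename_subst rename.simps by (rule prv.AllE)
next
  case (ExI \<Gamma> i p)
  from ExI.IH[of r] show ?case unfolding rename_subst rename.simps by (rule prv.ExI)
next
  case (ExE \<Gamma> p q)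
  have "rename (lift r) ` shift ` \<Gamma> = shift ` rename r ` \<Gamma>"
    by (simp add: image_image rename_lift_shift)
  with ExE.IH(2)[of "lift r"]
  have "prv T (insert (rename (lift r) p) (shift ` rename r ` \<Gamma>)) (shift (rename r q))"
    by (simp add: rename_lift_shift)
  from prv.ExE[OF _ this] ExE.IH(1)[of r] show ?case by simp
next
  case (EqSubst \<Gamma> i j p)
  from EqSubst.IH[of r] show ?case unfolding rename_subst rename.simps by (rule prv.EqSubst)
next
  case (BotE \<Gamma> p)
  from BotE.IH[of r] show ?case unfolding rename.simps by (rule prv.BotE)
next
  case (AndE1 \<Gamma> p q)
  from AndE1.IH[of r] show ?case unfolding rename.simps by (rule prv.AndE1)
next
  case (AndE2 \<Gamma> p q)
  from AndE2.IH[of r] show ?case unfolding rename.simps by (rule prv.AndE2)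
next
  case (ImpE \<Gamma> p q)
  from ImpE.IH[of r] show ?case unfolding rename.simps by (rule prv.ImpE)
next
  case (OrE \<Gamma> p q r)
  from OrE.IH[of r] show ?case unfolding rename.simps image_insert by (rule prv.OrE)
next
  case (ImpI p \<Gamma> q)
  from ImpI.IH[of r] show ?case unfolding rename.simps image_insert by (rule prv.ImpI)
qed (auto intro: prv.Hyp prv.AndI prv.OrI1 prv.OrI2 prv.EqRefl)

lemma prv_cut: "prv T \<Gamma> p \<Longrightarrow> prv T (insert p \<Gamma>) q \<Longrightarrow> prv T \<Gamma> q"
  by (rule prv.ImpE[OF prv.ImpI])

text \<open>Undoes \<open>subst c\<close> if \<open>c\<close> is not free in the quantified formula:
  the eigenvariable moves to index 0 and everything else makes room. Renaming a whole derivation by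
  it turns an argument about a named fresh variable into the shifted form that \<open>AllI\<close>
  and \<open>ExE\<close> require.\<close>

definition fresh :: "nat \<Rightarrow> nat \<Rightarrow> nat" where
  "fresh c i = (if i = c then 0 else Suc i)"

lemma rename_fresh: "c \<notin> fv p \<Longrightarrow> rename (fresh c) p = shift p"
  by (rule rename_cong) (auto simp: fresh_def)

lemma rename_fresh_subst:
  assumes "c \<notin> fv (All p)"
  shows "rename (fresh c) (subst c p) = p"
proof -
  have "rename (fresh c) (subst c p) = rename (\<lambda>i. i) p"
    unfolding subst_def rename_rename
    using assms by (intro rename_cong) (auto split: nat.splits simp: fresh_def)
  then show ?thesis by (simp add: rename_ident)
qed

lemma rename_fresh_image:
  "(\<And>q. q \<in> \<Gamma> \<Longrightarrow> c \<notin> fv q) \<Longrightarrow> rename (fresh c) ` \<Gamma> = shift ` \<Gamma>"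
  by (rule image_cong) (auto simp: rename_fresh)

lemma prv_AllI_fresh:
  assumes "prv T \<Gamma> (subst c p)" "c \<notin> fv (All p)" "\<And>q. q \<in> \<Gamma> \<Longrightarrow> c \<notin> fv q"
  shows "prv T \<Gamma> (All p)"
  using prv_rename[OF assms(1), of "fresh c"] assms(2,3)
  by (simp add: rename_fresh_subst rename_fresh_image prv.AllI)

lemma prv_ExE_fresh:
  assumes "prv T (insert (subst c p) \<Gamma>) q" "prv T \<Gamma> (Ex p)"
    "c \<notin> fv (Ex p)" "c \<notin> fv q" "\<And>q. q \<in> \<Gamma> \<Longrightarrow> c \<notin> fv q"
  shows "prv T \<Gamma> q"
proof -
  have "prv T (insert p (shift ` \<Gamma>)) (shift q)"
    using prv_rename[OF assms(1), of "fresh c"] assms(3-5)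
    by (simp add: rename_fresh_subst rename_fresh_image rename_fresh)
  with assms(2) show ?thesis by (rule prv.ExE)
qed

subsection \<open>Kripke models\<close>

locale kripke =
  fixes le :: "'w \<Rightarrow> 'w \<Rightarrow> bool" (infix "\<preceq>" 50)
    and D :: "'w \<Rightarrow> 'd \<Rightarrow> bool"
    and M :: "'w \<Rightarrow> 'd \<Rightarrow> 'd \<Rightarrow> bool"
    and E :: "'w \<Rightarrow> 'd \<Rightarrow> 'd \<Rightarrow> bool"
  assumes le_refl [iff]: "w \<preceq> w"
    and le_trans [trans]: "w \<preceq> v \<Longrightarrow> v \<preceq> u \<Longrightarrow> w \<preceq> u"
    and D_up: "D w x \<Longrightarrow> w \<preceq> v \<Longrightarrow> D v x"
    and M_up: "M w x y \<Longrightarrow> w \<preceq> v \<Longrightarrow> M v x y"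
    and E_up: "E w x y \<Longrightarrow> w \<preceq> v \<Longrightarrow> E v x y"
    and M_D1: "M w x y \<Longrightarrow> D w x" and M_D2: "M w x y \<Longrightarrow> D w y"
    and E_D1: "E w x y \<Longrightarrow> D w x"
    and E_refl: "D w x \<Longrightarrow> E w x x"
    and E_sym: "E w x y \<Longrightarrow> E w y x"
    and E_trans: "E w x y \<Longrightarrow> E w y z \<Longrightarrow> E w x z"
    and M_cong: "M w x y \<Longrightarrow> E w x x' \<Longrightarrow> E w y y' \<Longrightarrow> M w x' y'"
begin

primrec forces :: "'w \<Rightarrow> (nat \<Rightarrow> 'd) \<Rightarrow> fm \<Rightarrow> bool" where
  "forces w e (Mem i j) = M w (e i) (e j)"
| "forces w e (Eq i j) = E w (e i) (e j)"
| "forces w e Bot = False"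
| "forces w e (And p q) = (forces w e p \<and> forces w e q)"
| "forces w e (Or p q) = (forces w e p \<or> forces w e q)"
| "forces w e (Imp p q) = (\<forall>v. w \<preceq> v \<longrightarrow> forces v e p \<longrightarrow> forces v e q)"
| "forces w e (All p) = (\<forall>v x. w \<preceq> v \<longrightarrow> D v x \<longrightarrow> forces v (case_nat x e) p)"
| "forces w e (Ex p) = (\<exists>x. D w x \<and> forces w (case_nat x e) p)"

end

locale kripke_model = kripke +
  fixes T :: "fm set"
  assumes axiom: "p \<in> T \<Longrightarrow> (\<And>i. D w (e i)) \<Longrightarrow> forces w e p"

subsection \<open>Completeness\<close>

instance fm :: countable
  by countable_datatype

text \<open>The pairing function cuts the variables into infinitely many infinite blocks, and a
  world of level \<open>n\<close> speaks about the blocks up to \<open>n\<close>. So there is always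
  an infinite supply of names for new elements of later worlds.\<close>

definition vars :: "nat \<Rightarrow> nat set" where
  "vars n = {x. fst (prod_decode x) \<le> n}"

lemma vars_mono: "m \<le> n \<Longrightarrow> vars m \<subseteq> vars n"
  by (auto simp: vars_def)

lemma obtain_fresh:
  assumes "finite A"
  obtains c where "c \<in> vars (Suc n)" "c \<notin> vars n" "c \<notin> A"
proof -
  have "inj (\<lambda>i. prod_encode (Suc n, i))"
    by (auto intro!: injI)
  then have "infinite (range (\<lambda>i. prod_encode (Suc n, i)))"
    by (simp add: finite_image_iff)
  then have "\<not> range (\<lambda>i. prod_encode (Suc n, i)) \<subseteq> A" using assms finite_subset by blast
  then obtain i where "prod_encode (Suc n, i) \<notin> A" by auto
  then show thesis by (intro that) (auto simp: vars_def)
qed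

text \<open>Saturated theories over the variables of level \<open>n\<close>: deductively closed,
  consistent, prime, and with a witness for every existential member. Primeness and witnesses are
  what the forcing clauses of \<open>Or\<close> and \<open>Ex\<close> need.\<close>

definition world :: "fm set \<Rightarrow> nat \<times> fm set \<Rightarrow> bool" where
  "world T = (\<lambda>(n, \<Gamma>).
    (\<forall>p\<in>\<Gamma>. fv p \<subseteq> vars n) \<and>
    (\<forall>p. fv p \<subseteq> vars n \<longrightarrow> prv T \<Gamma> p \<longrightarrow> p \<in> \<Gamma>) \<and>
    Bot \<notin> \<Gamma> \<and>
    (\<forall>p q. Or p q \<in> \<Gamma> \<longrightarrow> p \<in> \<Gamma> \<or> q \<in> \<Gamma>) \<and>
    (\<forall>p. Ex p \<in> \<Gamma> \<longrightarrow> (\<exists>c\<in>vars n. subst c p \<in> \<Gamma>)))"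

fun witness :: "nat \<Rightarrow> fm \<Rightarrow> fm set" where
  "witness c (Ex p) = {subst c p}"
| "witness c _ = {}"

text \<open>Lindenbaum's construction: the formulas that keep \<open>g\<close> underivable are added one by one,
  an existential formula together with an instance at a fresh variable.\<close>

lemma world_extension:
  assumes \<Gamma>: "\<And>p. p \<in> \<Gamma> \<Longrightarrow> fv p \<subseteq> vars n" and g: "fv g \<subseteq> vars (Suc n)" "\<not> prv T \<Gamma> g"
  obtains \<Delta> where "world T (Suc n, \<Delta>)" "\<Gamma> \<subseteq> \<Delta>" "g \<notin> \<Delta>"
proof -
  define good where "good = (\<lambda>A. finite A \<and> (\<forall>p\<in>A. fv p \<subseteq> vars (Suc n)) \<and> \<not> prv T (\<Gamma> \<union> A) g)"
  \<comment> \<open>A relation instead of a function leaves the fresh witness unspecified;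
    \<open>SOME\<close> fixes it when the stages are formed.\<close>
  define step where "step = (\<lambda>q A B.
      good B \<and> A \<subseteq> B \<and>
      (if fv q \<subseteq> vars (Suc n) \<and> \<not> prv T (insert q (\<Gamma> \<union> A)) g
       then q \<in> B \<and> (\<exists>c\<in>vars (Suc n). witness c q \<subseteq> B) else True))"
  have step: "\<exists>B. step q A B" if A: "good A" for q A
  proof (cases "fv q \<subseteq> vars (Suc n) \<and> \<not> prv T (insert q (\<Gamma> \<union> A)) g")
    case True
    have "finite (fv g \<union> fv q \<union> \<Union>(fv ` A))"
      using A by (auto simp: good_def finite_fv)
    \<comment> \<open>\<open>c\<close> avoids \<Gamma> because it is outside \<open>vars n\<close>,
      and avoids the finitely many other formulas involved by the last condition, so it may serve as
      an eigenvariable in \<open>prv_ExE_fresh\<close>.\<close>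
    then obtain c where c: "c \<in> vars (Suc n)" "c \<notin> vars n" "c \<notin> fv g \<union> fv q \<union> \<Union>(fv ` A)"
      by (rule obtain_fresh)
    let ?B = "insert q (witness c q \<union> A)"
    have "\<not> prv T (\<Gamma> \<union> ?B) g"
    proof (cases "\<exists>p. q = Ex p")
      case ex: True
      then obtain p where p: "q = Ex p" by auto
      have "prv T (insert q (\<Gamma> \<union> A)) g" if *: "prv T (insert (subst c p) (insert q (\<Gamma> \<union> A))) g"
        by (rule prv_ExE_fresh[OF *]) (use c p \<Gamma> in \<open>auto intro: prv.Hyp\<close>)
      with True p show ?thesis by (auto simp: insert_commute)
    next
      case False
      then have "witness c q = {}" by (cases q) auto
      with True show ?thesis by simp
    qed
    moreover have "\<forall>p\<in>witness c q. fv p \<subseteq> vars (Suc n)"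
      using True c fv_subst by (cases q) (auto; fastforce)+
    moreover have "finite (witness c q)" by (cases q) auto
    ultimately have "step q A ?B"
      using A True c by (auto simp: step_def good_def)
    then show ?thesis by blast
  next
    case False
    with A show ?thesis by (auto simp: step_def)
  qed
  \<comment> \<open>Countability of formulas enters here: stage \<open>k\<close> treats the formula
    with code \<open>k\<close>, so every formula is treated at some stage.\<close>
  define S where "S = rec_nat {} (\<lambda>k A. SOME B. step (from_nat k) A B)"
  have S0: "S 0 = {}" by (simp add: S_def)
  have good0: "good (S 0)" using g by (simp add: S0 good_def)
  have SSuc: "step (from_nat k) (S k) (S (Suc k))" if "good (S k)" for k
    using someI_ex[OF step[OF that]] by (simp add: S_def)
  have good: "good (S k)" for k
    by (induction k) (use good0 SSuc in \<open>auto simp: step_def\<close>)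
  note SSuc = SSuc[OF good]
  have S_Suc: "S k \<subseteq> S (Suc k)" for k using SSuc[of k] by (simp add: step_def)
  have S_mono: "S i \<subseteq> S j" if "i \<le> j" for i j
    using S_Suc that by (rule lift_Suc_mono_le)
  \<comment> \<open>Defining \<Delta> by derivability makes its deductive closure easy; that this
    adds nothing to the stages is shown as \<open>\<Delta>_eq\<close>.\<close>
  define \<Delta> where "\<Delta> = {p. fv p \<subseteq> vars (Suc n) \<and> prv T (\<Gamma> \<union> (\<Union>k. S k)) p}"
  have unprv: "\<not> prv T (\<Gamma> \<union> (\<Union>k. S k)) g"
  proof
    assume "prv T (\<Gamma> \<union> (\<Union>k. S k)) g"
    from prv_finite[OF this]
    obtain F where F: "finite F" "F \<subseteq> \<Gamma> \<union> (\<Union>k. S k)" "prv T F g"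
      by blast
    have "\<exists>k. F \<subseteq> \<Gamma> \<union> S k"
      using F(1,2)
    proof (induction F)
      case (insert x F)
      then obtain k where k: "F \<subseteq> \<Gamma> \<union> S k" by auto
      from insert.prems obtain j where "x \<in> \<Gamma> \<union> S j" by auto
      then have "insert x F \<subseteq> \<Gamma> \<union> S (max j k)"
        using k S_mono[of j "max j k"] S_mono[of k "max j k"] by auto
      then show ?case ..
    qed auto
    then obtain k where "F \<subseteq> \<Gamma> \<union> S k" ..
    from prv_weaken[OF F(3) this] good[of k] show False by (simp add: good_def)
  qed
  have S_le: "S k \<subseteq> (\<Union>k. S k)" for k by auto
  have add: "q \<in> (\<Union>k. S k) \<and> (\<exists>c\<in>vars (Suc n). witness c q \<subseteq> (\<Union>k. S k))"
    if q: "fv q \<subseteq> vars (Suc n)" "\<not> prv T (insert q (\<Gamma> \<union> (\<Union>k. S k))) g" for q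
  proof -
    obtain k where k: "from_nat k = q" by (metis from_nat_to_nat)
    have "insert q (\<Gamma> \<union> S k) \<subseteq> insert q (\<Gamma> \<union> (\<Union>k. S k))" by auto
    with q(2) have "\<not> prv T (insert q (\<Gamma> \<union> S k)) g" using prv_weaken by blast
    with SSuc[of k] q(1) k have "q \<in> S (Suc k)" "\<exists>c\<in>vars (Suc n). witness c q \<subseteq> S (Suc k)"
      by (auto simp: step_def)
    then show ?thesis using S_le[of "Suc k"] by blast
  qed
  have cut: "\<not> prv T (insert q (\<Gamma> \<union> (\<Union>k. S k))) g" if "q \<in> \<Delta>" for q
    using that unprv prv_cut[of T _ q g] unfolding \<Delta>_def by blast
  have \<Delta>_sub: "\<Gamma> \<union> (\<Union>k. S k) \<subseteq> \<Delta>"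
    using \<Gamma> vars_mono[of n "Suc n"] good by (fastforce simp: \<Delta>_def good_def intro: prv.Hyp)
  have \<Delta>_eq: "\<Delta> \<subseteq> (\<Union>k. S k)"
    using add cut by (auto simp: \<Delta>_def)
  have \<Delta>_closed: "p \<in> \<Delta>" if "fv p \<subseteq> vars (Suc n)" "prv T \<Delta> p" for p
    using that(1) prv_weaken[OF that(2), of "\<Gamma> \<union> (\<Union>k. S k)"] \<Delta>_eq by (auto simp: \<Delta>_def)
  show thesis
  proof (rule that)
    show "\<Gamma> \<subseteq> \<Delta>" using \<Delta>_sub by auto
    show "g \<notin> \<Delta>" using unprv by (simp add: \<Delta>_def)
    have "Bot \<notin> \<Delta>" using unprv by (auto simp: \<Delta>_def intro: prv.BotE)
    moreover have "p \<in> \<Delta> \<or> q \<in> \<Delta>" if *: "Or p q \<in> \<Delta>" for p q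
    proof (rule ccontr)
      assume "\<not> ?thesis"
      moreover have "fv p \<subseteq> vars (Suc n)" "fv q \<subseteq> vars (Suc n)" using * by (auto simp: \<Delta>_def)
      ultimately have "prv T (insert p (\<Gamma> \<union> (\<Union>k. S k))) g" "prv T (insert q (\<Gamma> \<union> (\<Union>k. S k))) g"
        using add \<Delta>_sub by blast+
      then show False using * unprv by (auto simp: \<Delta>_def intro: prv.OrE)
    qed
    moreover have "\<exists>c\<in>vars (Suc n). subst c p \<in> \<Delta>" if "Ex p \<in> \<Delta>" for p
    proof -
      have "fv (Ex p) \<subseteq> vars (Suc n)" using that by (simp add: \<Delta>_def)
      from add[OF this cut[OF that]] obtain c where "c \<in> vars (Suc n)" "subst c p \<in> (\<Union>k. S k)"
        by auto
      with \<Delta>_sub show ?thesis by blast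
    qed
    ultimately show "world T (Suc n, \<Delta>)"
      using \<Delta>_closed by (auto simp: world_def) (auto simp: \<Delta>_def)
  qed
qed

section \<open>The canonical model\<close>

locale canonical =
  fixes T :: "fm set" and w0 :: "nat \<times> fm set"
  assumes w0: "world T w0"
begin

text \<open>Elements of the type that are not worlds are identified with \<open>w0\<close>.\<close>

definition nm :: "nat \<times> fm set \<Rightarrow> nat \<times> fm set" where
  "nm w = (if world T w then w else w0)"

definition le :: "nat \<times> fm set \<Rightarrow> nat \<times> fm set \<Rightarrow> bool" where
  "le w v \<longleftrightarrow> fst (nm w) \<le> fst (nm v) \<and> snd (nm w) \<subseteq> snd (nm v)"

definition holds :: "nat \<times> fm set \<Rightarrow> fm \<Rightarrow> bool" where
  "holds w p \<longleftrightarrow> p \<in> snd (nm w)"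

definition dom :: "nat \<times> fm set \<Rightarrow> nat \<Rightarrow> bool" where
  "dom w x \<longleftrightarrow> x \<in> vars (fst (nm w))"

lemma world_nm: "world T (nm w)"
  by (simp add: nm_def w0)

lemma nm_world: "world T w \<Longrightarrow> nm w = w"
  by (simp add: nm_def)

lemma holds_fv: "holds w p \<Longrightarrow> i \<in> fv p \<Longrightarrow> dom w i"
  using world_nm[of w] by (auto simp: world_def holds_def dom_def split: prod.splits)

lemma holds_prv': "prv T {p. holds w p} p \<Longrightarrow> fv p \<subseteq> {i. dom w i} \<Longrightarrow> holds w p"
  using world_nm[of w] by (auto simp: world_def holds_def dom_def split: prod.splits)

lemma holds_prv: "prv T {p. holds w p} p \<Longrightarrow> (\<And>i. i \<in> fv p \<Longrightarrow> dom w i) \<Longrightarrow> holds w p"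
  by (rule holds_prv') auto

lemma holds_up: "holds w p \<Longrightarrow> le w v \<Longrightarrow> holds v p"
  by (auto simp: holds_def le_def)

lemma dom_up: "dom w p \<Longrightarrow> le w v \<Longrightarrow> dom v p"
  unfolding dom_def le_def using vars_mono by blast

lemma not_holds_Bot: "\<not> holds w Bot"
  using world_nm[of w] by (auto simp: world_def holds_def split: prod.splits)

lemma holds_Or: "holds w (Or p q) \<Longrightarrow> holds w p \<or> holds w q"
  using world_nm[of w] by (auto simp: world_def holds_def split: prod.splits)

lemma holds_Ex: "holds w (Ex p) \<Longrightarrow> \<exists>c. dom w c \<and> holds w (subst c p)"
  using world_nm[of w] by (auto simp: world_def holds_def dom_def split: prod.splits)

text \<open>Moving up one level brings in new variables, which is why the new domain is named in the
  conclusion: a universal formula is refuted at a variable that exists only there.\<close>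

lemma extension:
  assumes "\<not> prv T (insert p {p. holds w p}) q"
    "\<And>i. i \<in> fv p \<Longrightarrow> dom w i" "fv q \<subseteq> vars (Suc (fst (nm w)))"
  obtains v where "le w v" "holds v p" "\<not> holds v q" "vars (Suc (fst (nm w))) = {i. dom v i}"
proof -
  have "fv r \<subseteq> vars (fst (nm w))" if "r \<in> insert p {p. holds w p}" for r
    using that assms(2) by (auto simp: dom_def dest: holds_fv)
  from world_extension[OF this assms(3,1)] obtain \<Delta>
    where "world T (Suc (fst (nm w)), \<Delta>)" "insert p {p. holds w p} \<subseteq> \<Delta>" "q \<notin> \<Delta>" .
  then show thesis
    by (intro that[of "(Suc (fst (nm w)), \<Delta>)"]) (auto simp: le_def nm_world holds_def dom_def)
qed

lemma holds_Eq_subst: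
  "holds w (Eq i j) \<Longrightarrow> holds w (subst i p) \<Longrightarrow> fv (subst j p) \<subseteq> {i. dom w i} \<Longrightarrow> holds w (subst j p)"
  by (rule holds_prv') (auto intro: prv.EqSubst[of _ _ i j] prv.Hyp)

lemma holds_Eq_refl: "dom w i \<Longrightarrow> holds w (Eq i i)"
  by (rule holds_prv) (auto intro: prv.EqRefl)

lemma holds_Eq_sym: "holds w (Eq i j) \<Longrightarrow> holds w (Eq j i)"
  \<comment> \<open>Index 0 of the template marks the occurrence to be rewritten: the template
    becomes \<open>Eq i i\<close> at \<open>i\<close> and \<open>Eq j i\<close> at
    \<open>j\<close>.\<close>
  using holds_Eq_subst[of w i j "Eq 0 (Suc i)"] holds_Eq_refl[of w i] holds_fv[of w "Eq i j"]
  by (auto simp: subst_def)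

lemma holds_Eq_trans: "holds w (Eq i j) \<Longrightarrow> holds w (Eq j k) \<Longrightarrow> holds w (Eq i k)"
  using holds_Eq_subst[of w j k "Eq (Suc i) 0"] holds_fv[of w "Eq i j"] holds_fv[of w "Eq j k"]
  by (auto simp: subst_def)

lemma holds_Mem_cong:
  assumes "holds w (Mem x y)" "holds w (Eq x x')" "holds w (Eq y y')"
  shows "holds w (Mem x' y')"
proof -
  have d: "dom w x" "dom w y" "dom w x'" "dom w y'"
    using assms by (auto dest: holds_fv)
  have "holds w (Mem x' y)"
    using holds_Eq_subst[of w x x' "Mem 0 (Suc y)"] assms d by (auto simp: subst_def)
  then show ?thesis
    using holds_Eq_subst[of w y y' "Mem (Suc x') 0"] assms d by (auto simp: subst_def)
qed

sublocale kripke le dom "\<lambda>w x y. holds w (Mem x y)" "\<lambda>w x y. holds w (Eq x y)"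
proof unfold_locales
  show "le w w" for w by (simp add: le_def)
  show "le w v \<Longrightarrow> le v u \<Longrightarrow> le w u" for w v u unfolding le_def by auto
  show "dom w x" if "holds w (Mem x y)" for w x y by (rule holds_fv[OF that]) simp
  show "dom w y" if "holds w (Mem x y)" for w x y by (rule holds_fv[OF that]) simp
  show "dom w x" if "holds w (Eq x y)" for w x y by (rule holds_fv[OF that]) simp
qed (fact holds_up dom_up holds_Eq_refl holds_Eq_sym holds_Eq_trans holds_Mem_cong)+

text \<open>The truth lemma of the canonical model. Disjunction and existence use saturation of the
  world; implication and universal quantification, in the direction from forcing to membership, use
  an extension that refutes the conclusion.\<close>

lemma forces_iff_holds:
  assumes "\<And>i. dom w (e i)"
  shows "forces w e p \<longleftrightarrow> holds w (rename e p)"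
  using assms
proof (induction p arbitrary: w e)
  case (And p q)
  have "holds w (And (rename e p) (rename e q)) \<longleftrightarrow> holds w (rename e p) \<and> holds w (rename e q)"
    using And.prems
    by (auto intro!: holds_prv' intro: prv.AndI prv.AndE1 prv.AndE2 prv.Hyp simp: fv_rename)
  with And show ?case by simp
next
  case (Or p q)
  have "holds w (Or (rename e p) (rename e q)) \<longleftrightarrow> holds w (rename e p) \<or> holds w (rename e q)"
    using Or.prems
    by (auto intro!: holds_prv'[of w "Or _ _"] intro: prv.OrI1 prv.OrI2 prv.Hyp simp: fv_rename
      dest: holds_Or)
  with Or show ?case by simp
next
  case (Imp p q)
  have dom: "dom v (e i)" if "le w v" for v i using Imp.prems that by (rule dom_up)
  have "holds w (Imp (rename e p) (rename e q)) \<longleftrightarrow>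
      (\<forall>v. le w v \<longrightarrow> holds v (rename e p) \<longrightarrow> holds v (rename e q))" (is "?L \<longleftrightarrow> ?R")
  proof
    assume ?L
    show ?R
    proof (intro allI impI)
      fix v assume v: "le w v" "holds v (rename e p)"
      then have "prv T {p. holds v p} (rename e q)"
        using holds_up[OF \<open>?L\<close> v(1)] v(2) by (intro prv.ImpE[of _ _ "rename e p"
          "rename e q"] prv.Hyp) simp_all
      then show "holds v (rename e q)"
        using dom[OF v(1)] by (intro holds_prv') (auto simp: fv_rename)
    qed
  next
    assume R: ?R
    have "prv T (insert (rename e p) {p. holds w p}) (rename e q)"
    proof (rule ccontr)
      assume "\<not> ?thesis"
      moreover have "fv (rename e q) \<subseteq> vars (Suc (fst (nm w)))"
        using Imp.prems vars_mono[of "fst (nm w)" "Suc (fst (nm w))"]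
          by (auto simp: fv_rename dom_def)
      moreover have "dom w i" if "i \<in> fv (rename e p)" for i
        using that Imp.prems by (auto simp: fv_rename)
      ultimately obtain v where "le w v" "holds v (rename e p)" "\<not> holds v (rename e q)"
        using extension[of "rename e p" w "rename e q"] by metis
      with R show False by blast
    qed
    then show ?L using Imp.prems by (intro holds_prv' prv.ImpI) (auto simp: fv_rename)
  qed
  then show ?case using Imp.IH dom by simp
next
  case (All p)
  let ?q = "rename (lift e) p"
  have dom: "dom v (case_nat x e i)" if "le w v" "dom v x" for v x i
    using dom_up[OF All.prems that(1)] that(2) by (cases i) simp_all
  have fvq: "fv (All ?q) \<subseteq> {i. dom w i}"
    using All.prems by (auto simp: fv_rename simp flip: rename.simps)
  have "holds w (All ?q) \<longleftrightarrow> (\<forall>v x. le w v \<longrightarrow> dom v x \<longrightarrow> holds v (subst x ?q))" (is "?L \<longleftrightarrow> ?R")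
  proof
    assume ?L
    show ?R
    proof (intro allI impI)
      fix v x assume v: "le w v" "dom v x"
      have "prv T {p. holds v p} (subst x ?q)"
        using holds_up[OF \<open>?L\<close> v(1)] by (auto intro: prv.AllE prv.Hyp)
      then show "holds v (subst x ?q)"
        using dom[OF v] by (intro holds_prv') (auto simp: fv_rename subst_rename_lift)
    qed
  next
    assume R: ?R
    let ?n = "fst (nm w)"
    \<comment> \<open>\<open>c\<close> is outside the domain of \<open>w\<close>, hence fresh for
      everything that holds at \<open>w\<close>, but it lies in the domain of the world supplied by
      \<open>extension\<close>.\<close>
    obtain c where c: "c \<in> vars (Suc ?n)" "c \<notin> vars ?n"
      by (rule obtain_fresh[of "{}"]) auto
    have "prv T {p. holds w p} (subst c ?q)"
    proof (rule ccontr)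
      assume n: "\<not> ?thesis"
      \<comment> \<open>\<open>extension\<close> adds a formula to the theory; here a provable one
        is offered, which changes nothing.\<close>
      then have "\<not> prv T (insert (Imp Bot Bot) {p. holds w p}) (subst c ?q)"
        using prv_cut[OF prv.ImpI[OF prv.Hyp], of Bot Bot "{p. holds w p}" T "subst c ?q"] by blast
      moreover have "fv (subst c ?q) \<subseteq> vars (Suc ?n)"
        using fv_subst[of c ?q] fvq c vars_mono[of ?n "Suc ?n"] by (auto simp: dom_def)
      ultimately obtain v where v: "le w v" "\<not> holds v (subst c ?q)" "vars (Suc ?n) = {i. dom v i}"
        using extension[of "Imp Bot Bot" w "subst c ?q"]
          by (metis empty_iff fv.simps(3,6) sup_bot.right_neutral)
      then have "dom v c" using c(1) by blast
      with R v(1,2) show False by blast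
    qed
    then have "prv T {p. holds w p} (All ?q)"
    proof (rule prv_AllI_fresh)
      show "c \<notin> fv (All ?q)" using fvq c by (auto simp: dom_def)
      show "c \<notin> fv r" if "r \<in> {p. holds w p}" for r
        using that c holds_fv[of w r c] by (auto simp: dom_def)
    qed
    then show ?L using fvq by (rule holds_prv')
  qed
  then show ?case using All.IH dom by (simp add: subst_rename_lift)
next
  case (Ex p)
  let ?q = "rename (lift e) p"
  have dom: "dom w (case_nat x e i)" if "dom w x" for x i
    using Ex.prems that by (cases i) auto
  have fvq: "fv (Ex ?q) \<subseteq> {i. dom w i}"
    using Ex.prems by (auto simp: fv_rename simp flip: rename.simps)
  have "holds w (Ex ?q) \<longleftrightarrow> (\<exists>x. dom w x \<and> holds w (subst x ?q))"
  proof
    assume "\<exists>x. dom w x \<and> holds w (subst x ?q)"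
    then obtain x where "holds w (subst x ?q)" by blast
    with fvq show "holds w (Ex ?q)" by (intro holds_prv' prv.ExI[of _ _ x] prv.Hyp) simp_all
  qed (rule holds_Ex)
  moreover have "forces w (case_nat x e) p \<longleftrightarrow> holds w (subst x ?q)" if "dom w x" for x
    using Ex.IH[OF dom[OF that]] by (simp add: subst_rename_lift)
  ultimately show ?case by auto
qed (auto simp: not_holds_Bot)

end

text \<open>The models range over one fixed pair of types, those of the canonical model, and this
  suffices because the canonical model is the countermodel.\<close>

theorem kripke_completeness:
  assumes "\<And>(le :: nat \<times> fm set \<Rightarrow> nat \<times> fm set \<Rightarrow> bool) (D :: nat \<times> fm set \<Rightarrow> nat \<Rightarrow> bool) M E w e.
    kripke_model le D M E T \<Longrightarrow> (\<And>i. D w (e i)) \<Longrightarrow> kripke.forces le D M E w e p"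
  shows "T \<turnstile> p"
proof (rule ccontr)
  assume n: "\<not> T \<turnstile> p"
  \<comment> \<open>The free variables of \<open>p\<close> are moved into block 0, so that the later
    blocks stay available for witnesses; \<open>snd \<circ> prod_decode\<close> moves them
    back.\<close>
  let ?e = "\<lambda>i. prod_encode (0, i)"
  have "\<not> prv T {} (rename ?e p)"
  proof
    assume "prv T {} (rename ?e p)"
    from prv_rename[OF this, of "snd \<circ> prod_decode"] have "prv T {} p"
      by (simp add: rename_rename comp_def rename_ident)
    with n show False by (simp add: derives_def)
  qed
  moreover have "fv (rename ?e p) \<subseteq> vars (Suc 0)" by (auto simp: fv_rename vars_def)
  ultimately obtain \<Delta> where \<Delta>: "world T (Suc 0, \<Delta>)" "rename ?e p \<notin> \<Delta>"
    using world_extension[of "{}" 0 "rename ?e p" T] by auto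
  interpret canonical T "(Suc 0, \<Delta>)" by unfold_locales (rule \<Delta>)
  interpret kripke_model le dom "\<lambda>w x y. holds w (Mem x y)" "\<lambda>w x y. holds w (Eq x y)" T
  proof unfold_locales
    fix p w and e :: "nat \<Rightarrow> nat" assume "p \<in> T" and e: "\<And>i. dom w (e i)"
    then show "forces w e p"
      unfolding forces_iff_holds[OF e]
      by (intro holds_prv' prv_axiom_rename) (auto simp: fv_rename)
  qed
  have d: "dom (Suc 0, \<Delta>) (?e i)" for i by (simp add: dom_def nm_world[OF \<Delta>(1)] vars_def)
  have "forces (Suc 0, \<Delta>) ?e p"
    by (rule assms) (unfold_locales, rule d)
  then have "holds (Suc 0, \<Delta>) (rename ?e p)" using forces_iff_holds[OF d] by simp
  with \<Delta> show False by (simp add: holds_def nm_world)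
qed

section \<open>Satisfaction of formulas with named variables\<close>

context kripke
begin

lemma E_D2: "E w x y \<Longrightarrow> D w y"
  using E_sym E_D1 by blast

lemma forces_cong:
  "(\<And>i. i \<in> fv p \<Longrightarrow> E w (e i) (e' i)) \<Longrightarrow> forces w e p \<longleftrightarrow> forces w e' p"
proof (induction p arbitrary: w e e')
  case (Mem i j)
  from Mem[of i] Mem[of j] show ?case by (auto intro: M_cong E_sym)
next
  case (Eq i j)
  from Eq[of i] Eq[of j] show ?case by (auto intro: E_sym E_trans)
next
  case (And p q)
  from And.IH[of w e e'] And.prems show ?case by simp
next
  case (Or p q)
  from Or.IH[of w e e'] Or.prems show ?case by simp
next
  case (Imp p q)
  have "forces v e p \<longleftrightarrow> forces v e' p" "forces v e q \<longleftrightarrow> forces v e' q" if "w \<preceq> v" for v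
    using Imp.IH[of v e e'] Imp.prems E_up[OF _ that] by simp_all
  then show ?case by simp
next
  case (All p)
  have "forces v (case_nat x e) p \<longleftrightarrow> forces v (case_nat x e') p" if "w \<preceq> v" "D v x" for v x
    by (rule All.IH) (use All.prems E_up[OF _ that(1)] E_refl[OF that(2)] in \<open>auto split:
      nat.splits\<close>)
  then show ?case by simp
next
  case (Ex p)
  have "forces w (case_nat x e) p \<longleftrightarrow> forces w (case_nat x e') p" if "D w x" for x
    by (rule Ex.IH) (use Ex.prems E_refl[OF that] in \<open>auto split: nat.splits\<close>)
  then show ?case by auto
qed simp

lemma forces_rename: "forces w e (rename r p) \<longleftrightarrow> forces w (e \<circ> r) p"
proof (induction p arbitrary: w e r)
  case (All p)
  have "case_nat x e \<circ> lift r = case_nat x (e \<circ> r)" for x by (auto split: nat.splits)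
  with All show ?case by (simp del: comp_apply)
next
  case (Ex p)
  have "case_nat x e \<circ> lift r = case_nat x (e \<circ> r)" for x by (auto split: nat.splits)
  with Ex show ?case by (simp del: comp_apply)
qed auto

text \<open>\<open>sat w e xs F\<close>: the variable of level \<open>i\<close> of \<open>F\<close> denotes \<open>xs ! i\<close>, and \<open>e\<close> interprets
  the parameters of the formulas under \<open>inst\<close>.\<close>

definition env :: "(nat \<Rightarrow> 'd) \<Rightarrow> 'd list \<Rightarrow> nat \<Rightarrow> 'd" where
  "env e xs i = (if i < length xs then xs ! (length xs - Suc i) else e (i - length xs))"

definition ok :: "'w \<Rightarrow> (nat \<Rightarrow> 'd) \<Rightarrow> 'd list \<Rightarrow> bool" where
  "ok w e xs \<longleftrightarrow> (\<forall>i. D w (e i)) \<and> (\<forall>x\<in>set xs. D w x)"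

definition sat :: "'w \<Rightarrow> (nat \<Rightarrow> 'd) \<Rightarrow> 'd list \<Rightarrow> form \<Rightarrow> bool" where
  "sat w e xs F \<longleftrightarrow> ok w e xs \<and> forces w (env e xs) (F (length xs))"

lemma ok_up: "ok w e xs \<Longrightarrow> w \<preceq> v \<Longrightarrow> ok v e xs"
  by (auto simp: ok_def intro: D_up)

lemma ok_nth: "ok w e xs \<Longrightarrow> i < length xs \<Longrightarrow> D w (xs ! i)"
  by (auto simp: ok_def)

lemma ok_future:
  assumes "ok w e xs"
  shows "w \<preceq> v \<Longrightarrow> ok v e xs"
    and "w \<preceq> v \<Longrightarrow> v \<preceq> u \<Longrightarrow> ok u e xs"
    and "w \<preceq> v \<Longrightarrow> v \<preceq> u \<Longrightarrow> u \<preceq> u' \<Longrightarrow> ok u' e xs"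
    and "w \<preceq> v \<Longrightarrow> n < length xs \<Longrightarrow> D v (xs ! n)"
  using assms by (blast intro: ok_up le_trans ok_nth)+

lemma ok_append [simp]: "ok w e (xs @ ys) \<longleftrightarrow> ok w e xs \<and> (\<forall>y\<in>set ys. D w y)"
  by (auto simp: ok_def)

lemma ok_Cons: "ok w e (x # xs) \<longleftrightarrow> D w x \<and> ok w e xs"
  by (auto simp: ok_def)

lemma ok_env: "ok w (env e ps) [] \<longleftrightarrow> ok w e ps"
proof
  assume *: "ok w (env e ps) []"
  show "ok w e ps"
    unfolding ok_def
  proof (intro conjI allI ballI)
    fix i
    have "D w (env e ps (length ps + i))" using * by (simp add: ok_def)
    then show "D w (e i)" by (simp add: env_def)
  next
    fix x assume "x \<in> set ps"
    then obtain i where i: "i < length ps" "x = ps ! i" by (auto simp: in_set_conv_nth)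
    have "D w (env e ps (length ps - Suc i))" using * by (simp add: ok_def)
    moreover have "env e ps (length ps - Suc i) = x" using i by (auto simp: env_def)
    ultimately show "D w x" by simp
  qed
qed (auto simp: ok_def env_def)

lemma sat_ok: "sat w e xs F \<Longrightarrow> ok w e xs"
  by (simp add: sat_def)

text \<open>Whatever a formula expresses respects \<open>E\<close>. This is the source of the later
  congruence lemmas for pairs, relations, bases, surjections and definable classes.\<close>

lemma sat_cong:
  assumes "sat w e xs F" "list_all2 (E w) xs ys"
  shows "sat w e ys F"
proof -
  have l: "length xs = length ys" and E: "\<And>i. i < length xs \<Longrightarrow> E w (xs ! i) (ys ! i)"
    using assms(2) by (auto simp: list_all2_conv_all_nth)
  have ok: "ok w e xs" using assms(1) by (rule sat_ok)
  then have "ok w e ys" unfolding ok_def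
    using E_D2[OF E] l ok by (auto simp: in_set_conv_nth ok_def)
  moreover have "E w (env e xs i) (env e ys i)" for i
    using E l ok by (auto simp: env_def ok_def intro: E_refl)
  ultimately show ?thesis
    using assms(1) l forces_cong[of "F (length xs)" w "env e xs" "env e ys"] by (simp add: sat_def)
qed

lemma env_snoc: "env e (xs @ [x]) = case_nat x (env e xs)"
proof
  show "env e (xs @ [x]) i = case_nat x (env e xs) i" for i
    by (cases i) (auto simp: env_def nth_append)
qed

lemma env_nth: "i < length xs \<Longrightarrow> env e xs (length xs - Suc i) = xs ! i"
  by (auto simp: env_def)

lemma sat_mem [simp]:
  "i < length xs \<Longrightarrow> j < length xs \<Longrightarrow> sat w e xs (mem i j) \<longleftrightarrow> ok w e xs \<and> M w (xs ! i) (xs ! j)"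
  by (simp add: sat_def mem_def env_nth)

lemma sat_eq [simp]:
  "i < length xs \<Longrightarrow> j < length xs \<Longrightarrow> sat w e xs (eq i j) \<longleftrightarrow> ok w e xs \<and> E w (xs ! i) (xs ! j)"
  by (simp add: sat_def eq_def env_nth)

lemma sat_bot [simp]: "\<not> sat w e xs bot"
  by (simp add: sat_def bot_def)

lemma sat_conj [simp]: "sat w e xs (conj F G) \<longleftrightarrow> sat w e xs F \<and> sat w e xs G"
  by (auto simp: sat_def conj_def)

lemma sat_disj [simp]: "sat w e xs (disj F G) \<longleftrightarrow> sat w e xs F \<or> sat w e xs G"
  by (auto simp: sat_def disj_def)

lemma sat_imp [simp]:
  "sat w e xs (imp F G) \<longleftrightarrow> ok w e xs \<and> (\<forall>v. w \<preceq> v \<longrightarrow> sat v e xs F \<longrightarrow> sat v e xs G)"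
  using ok_up by (auto simp: sat_def imp_def)

lemma sat_iff [simp]:
  "sat w e xs (iff F G) \<longleftrightarrow> ok w e xs \<and> (\<forall>v. w \<preceq> v \<longrightarrow> (sat v e xs F \<longleftrightarrow> sat v e xs G))"
  by (auto simp: iff_def)

lemma sat_all:
  "sat w e xs (all F) \<longleftrightarrow>
    ok w e xs \<and> (\<forall>v x. w \<preceq> v \<longrightarrow> D v x \<longrightarrow> sat v e (xs @ [x]) (F (length xs)))"
  using ok_up by (auto simp: sat_def all_def env_snoc)

lemma sat_ex:
  "sat w e xs (ex F) \<longleftrightarrow> (\<exists>x. sat w e (xs @ [x]) (F (length xs)))"
  by (auto simp: sat_def ex_def env_snoc)

text \<open>The quantifier and the implication each move to a later world; by transitivity one move
  is enough. This keeps the chains of worlds short when nested quantifiers are unfolded.\<close>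

lemma sat_all_imp:
  "sat w e xs (all (\<lambda>x. imp (F x) (G x))) \<longleftrightarrow> ok w e xs \<and>
    (\<forall>v x. w \<preceq> v \<longrightarrow> sat v e (xs @ [x]) (F (length xs)) \<longrightarrow> sat v e (xs @ [x]) (G (length xs)))"
  using ok_up sat_ok by (auto simp: sat_all intro: le_trans D_up) fastforce

lemma sat_all_iff:
  "sat w e xs (all (\<lambda>x. iff (F x) (G x))) \<longleftrightarrow> ok w e xs \<and>
    (\<forall>v x. w \<preceq> v \<longrightarrow> (sat v e (xs @ [x]) (F (length xs)) \<longleftrightarrow> sat v e (xs @ [x]) (G (length xs))))"
  using ok_up sat_ok by (auto simp: sat_all intro: le_trans D_up) fastforce+

lemma sat_all_imp2:
  "sat w e xs (all (\<lambda>x. all (\<lambda>y. imp (F x y) (G x y)))) \<longleftrightarrow> ok w e xs \<and>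
    (\<forall>v x y. w \<preceq> v \<longrightarrow> sat v e (xs @ [x, y]) (F (length xs) (Suc (length xs))) \<longrightarrow>
      sat v e (xs @ [x, y]) (G (length xs) (Suc (length xs))))"
  (is "?L \<longleftrightarrow> _ \<and> ?R")
proof
  assume L: ?L
  show "ok w e xs \<and> ?R"
  proof (intro conjI allI impI)
    show "ok w e xs" using L by (rule sat_ok)
    fix v x y assume v: "w \<preceq> v" and F: "sat v e (xs @ [x, y]) (F (length xs) (Suc (length xs)))"
    from sat_ok[OF F] have "D v x" by (simp add: ok_def)
    with L v have "sat v e (xs @ [x]) (all (\<lambda>y. imp (F (length xs) y) (G (length xs) y)))"
      unfolding sat_all[of w e xs] by blast
    then show "sat v e (xs @ [x, y]) (G (length xs) (Suc (length xs)))"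
      using F unfolding sat_all_imp by simp
  qed
next
  assume R: "ok w e xs \<and> ?R"
  then show ?L
    by (auto simp: sat_all[of w] sat_all_imp intro: ok_up le_trans)
qed

lemma sat_all_imp3:
  "sat w e xs (all (\<lambda>x. all (\<lambda>y. all (\<lambda>z. imp (F x y z) (G x y z))))) \<longleftrightarrow> ok w e xs \<and>
    (\<forall>v x y z. w \<preceq> v \<longrightarrow>
      sat v e (xs @ [x, y, z]) (F (length xs) (Suc (length xs)) (Suc (Suc (length xs)))) \<longrightarrow>
      sat v e (xs @ [x, y, z]) (G (length xs) (Suc (length xs)) (Suc (Suc (length xs)))))"
  (is "?L \<longleftrightarrow> _ \<and> ?R")
proof
  assume L: ?L
  show "ok w e xs \<and> ?R"
  proof (intro conjI allI impI)
    let ?n = "length xs"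
    show "ok w e xs" using L by (rule sat_ok)
    fix v x y z assume v: "w \<preceq> v" and F: "sat v e (xs @ [x, y, z]) (F ?n (Suc ?n) (Suc (Suc ?n)))"
    from sat_ok[OF F] have "D v x" by (simp add: ok_def)
    with L v have "sat v e (xs @ [x]) (all (\<lambda>y. all (\<lambda>z. imp (F ?n y z) (G ?n y z))))"
      unfolding sat_all[of w e xs] by blast
    then show "sat v e (xs @ [x, y, z]) (G ?n (Suc ?n) (Suc (Suc ?n)))"
      using F unfolding sat_all_imp2 by simp
  qed
next
  assume R: "ok w e xs \<and> ?R"
  then show ?L
    by (auto simp: sat_all[of w] sat_all_imp2 intro: ok_up le_trans)
qed

subsection \<open>Semantics of the set-theoretic notions\<close>

definition Sub where
  "Sub w a b \<longleftrightarrow> D w a \<and> D w b \<and> (\<forall>v x. w \<preceq> v \<longrightarrow> M v x a \<longrightarrow> M v x b)"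

definition UPair where
  "UPair w u x y \<longleftrightarrow> D w u \<and> D w x \<and> D w y \<and>
    (\<forall>v z. w \<preceq> v \<longrightarrow> (M v z u \<longleftrightarrow> E v z x \<or> E v z y))"

definition Pair where
  "Pair w p x y \<longleftrightarrow> D w p \<and> D w x \<and> D w y \<and>
    (\<forall>v u. w \<preceq> v \<longrightarrow> (M v u p \<longleftrightarrow> UPair v u x x \<or> UPair v u x y))"

definition Rel where
  "Rel w r x y \<longleftrightarrow> (\<exists>p. M w p r \<and> Pair w p x y)"

text \<open>The guards \<open>D v x\<close> are mostly implied by the other conjuncts; with them the definitions are
  literally what unfolding \<open>sat\<close> yields.\<close>

definition FunC where
  "FunC w f a C \<longleftrightarrow> D w f \<and> D w a \<and>
    (\<forall>v p. w \<preceq> v \<longrightarrow> D v p \<longrightarrow> M v p f \<longrightarrow>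
      (\<exists>x. D v x \<and> (\<exists>y. D v y \<and> M v x a \<and> C v y \<and> Pair v p x y))) \<and>
    (\<forall>v x. w \<preceq> v \<longrightarrow> D v x \<longrightarrow> M v x a \<longrightarrow>
      (\<exists>y. D v y \<and> Rel v f x y \<and> (\<forall>u z. v \<preceq> u \<longrightarrow> D u z \<longrightarrow> Rel u f x z \<longrightarrow> E u z y)))"

definition Fun where
  "Fun w f a b \<longleftrightarrow> D w b \<and> FunC w f a (\<lambda>v y. M v y b)"

definition Surj where
  "Surj w f a b \<longleftrightarrow> Fun w f a b \<and>
    (\<forall>v y. w \<preceq> v \<longrightarrow> D v y \<longrightarrow> M v y b \<longrightarrow> (\<exists>x. D v x \<and> M v x a \<and> Rel v f x y))"

definition Comp where
  "Comp w u h t \<longleftrightarrow> D w u \<and> D w h \<and> D w t \<and>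
    (\<forall>v p. w \<preceq> v \<longrightarrow> D v p \<longrightarrow> (M v p u \<longleftrightarrow>
      (\<exists>x. D v x \<and> (\<exists>y. D v y \<and> (\<exists>z. D v z \<and> Rel v t x y \<and> Rel v h y z \<and> Pair v p x z)))))"

definition Fibre where
  "Fibre w k f a \<longleftrightarrow> D w k \<and> D w f \<and> D w a \<and>
    (\<forall>v b. w \<preceq> v \<longrightarrow> D v b \<longrightarrow> (M v b k \<longleftrightarrow> Rel v f b a))"

definition Base where
  "Base w b \<longleftrightarrow> D w b \<and> (\<forall>v c g. w \<preceq> v \<longrightarrow> D v c \<longrightarrow> D v g \<longrightarrow> Surj v g c b \<longrightarrow>
    (\<exists>s. D v s \<and> Fun v s b c \<and>
      (\<forall>u x y. v \<preceq> u \<longrightarrow> D u x \<longrightarrow> D u y \<longrightarrow> Rel u s x y \<longrightarrow> Rel u g y x)))"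

definition BaseMap where
  "BaseMap w f B A \<longleftrightarrow> Fun w f B A \<and> Base w A \<and>
    (\<forall>v a. w \<preceq> v \<longrightarrow> D v a \<longrightarrow> M v a A \<longrightarrow> (\<forall>u k. v \<preceq> u \<longrightarrow> D u k \<longrightarrow> Fibre u k f a \<longrightarrow> Base u k))"

definition Poly where
  "Poly w P f A X \<longleftrightarrow> D w P \<and> D w f \<and> D w A \<and> D w X \<and>
    (\<forall>v p. w \<preceq> v \<longrightarrow> D v p \<longrightarrow> (M v p P \<longleftrightarrow>
      (\<exists>a. D v a \<and> (\<exists>k. D v k \<and> (\<exists>t. D v t \<and> M v a A \<and> Fibre v k f a \<and> Fun v t k X \<and>
        Pair v p a t)))))"

definition Alg where
  "Alg w f A X m \<longleftrightarrow> (\<exists>P. D w P \<and> Poly w P f A X \<and> Fun w m P X)"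

definition AlgVal where
  "AlgVal w m a t x \<longleftrightarrow> (\<exists>p. D w p \<and> Pair w p a t \<and> Rel w m p x)"

definition Hom where
  "Hom w h W s X m \<longleftrightarrow> D w s \<and> D w m \<and> Fun w h W X \<and>
    (\<forall>v a t y. w \<preceq> v \<longrightarrow> D v a \<longrightarrow> D v t \<longrightarrow> D v y \<longrightarrow> AlgVal v s a t y \<longrightarrow>
      (\<exists>u. D v u \<and> (\<exists>x. D v x \<and> Comp v u h t \<and> Rel v h y x \<and> AlgVal v m a u x)))"

definition WType where
  "WType w f A W s \<longleftrightarrow> Alg w f A W s \<and>
    (\<forall>v X m. w \<preceq> v \<longrightarrow> D v X \<longrightarrow> D v m \<longrightarrow> Alg v f A X m \<longrightarrow>
      (\<exists>h. D v h \<and> Hom v h W s X m \<and> (\<forall>u g. v \<preceq> u \<longrightarrow> D u g \<longrightarrow> Hom u g W s X m \<longrightarrow> E u g h)))"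

definition RuleSet where
  "RuleSet w R X \<longleftrightarrow> D w R \<and> D w X \<and>
    (\<forall>v p. w \<preceq> v \<longrightarrow> D v p \<longrightarrow> M v p R \<longrightarrow>
      (\<exists>a. D v a \<and> (\<exists>b. D v b \<and> Sub v a X \<and> Sub v b X \<and> Pair v p a b)))"

definition Closed where
  "Closed w Y R \<longleftrightarrow> D w Y \<and> D w R \<and>
    (\<forall>v a b. w \<preceq> v \<longrightarrow> D v a \<longrightarrow> D v b \<longrightarrow> Rel v R a b \<longrightarrow>
      (\<forall>u. v \<preceq> u \<longrightarrow> Sub u a Y \<longrightarrow> (\<exists>x. D u x \<and> M u x b \<and> M u x Y)))"

lemma Sub_D: "Sub w a b \<Longrightarrow> D w a" "Sub w a b \<Longrightarrow> D w b"
  by (auto simp: Sub_def)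

lemma UPair_D: "UPair w u x y \<Longrightarrow> D w u" "UPair w u x y \<Longrightarrow> D w x" "UPair w u x y \<Longrightarrow> D w y"
  by (auto simp: UPair_def)

lemma Pair_D: "Pair w p x y \<Longrightarrow> D w p" "Pair w p x y \<Longrightarrow> D w x" "Pair w p x y \<Longrightarrow> D w y"
  by (auto simp: Pair_def)

lemma Rel_D: "Rel w r x y \<Longrightarrow> D w r" "Rel w r x y \<Longrightarrow> D w x" "Rel w r x y \<Longrightarrow> D w y"
  by (auto simp: Rel_def dest: M_D2 Pair_D)

lemma Fun_D: "Fun w f a b \<Longrightarrow> D w f" "Fun w f a b \<Longrightarrow> D w a" "Fun w f a b \<Longrightarrow> D w b"
  by (auto simp: Fun_def FunC_def)

lemma Surj_D: "Surj w f a b \<Longrightarrow> D w f" "Surj w f a b \<Longrightarrow> D w a" "Surj w f a b \<Longrightarrow> D w b"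
  by (auto simp: Surj_def dest: Fun_D)

lemma Comp_D: "Comp w u h t \<Longrightarrow> D w u" "Comp w u h t \<Longrightarrow> D w h" "Comp w u h t \<Longrightarrow> D w t"
  by (auto simp: Comp_def)

lemma Fibre_D: "Fibre w k f a \<Longrightarrow> D w k" "Fibre w k f a \<Longrightarrow> D w f" "Fibre w k f a \<Longrightarrow> D w a"
  by (auto simp: Fibre_def)

lemma Base_D: "Base w b \<Longrightarrow> D w b"
  by (auto simp: Base_def)

lemma Alg_D: "Alg w f A X m \<Longrightarrow> D w f" "Alg w f A X m \<Longrightarrow> D w A" "Alg w f A X m \<Longrightarrow> D w X"
  "Alg w f A X m \<Longrightarrow> D w m"
  by (auto simp: Alg_def Poly_def dest: Fun_D)

lemma AlgVal_D: "AlgVal w m a t x \<Longrightarrow> D w m" "AlgVal w m a t x \<Longrightarrow> D w a" "AlgVal w m a t x \<Longrightarrow> D w t"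
  "AlgVal w m a t x \<Longrightarrow> D w x"
  by (auto simp: AlgVal_def dest: Pair_D Rel_D)

lemma Hom_D: "Hom w h W s X m \<Longrightarrow> D w h" "Hom w h W s X m \<Longrightarrow> D w W" "Hom w h W s X m \<Longrightarrow> D w s"
  "Hom w h W s X m \<Longrightarrow> D w X" "Hom w h W s X m \<Longrightarrow> D w m"
  by (auto simp: Hom_def dest: Fun_D)

lemmas D_intros = M_D1 M_D2 E_D1 E_D2 Sub_D UPair_D Pair_D Rel_D Fun_D Surj_D Comp_D Fibre_D
  Base_D Alg_D AlgVal_D Hom_D

lemmas sat_quants = sat_all_imp3 sat_all_imp2 sat_all_imp sat_all_iff sat_all sat_ex

lemma sat_subset [simp]:
  assumes "i < length xs" "j < length xs"
  shows "sat w e xs (is_subset i j) \<longleftrightarrow> ok w e xs \<and> Sub w (xs ! i) (xs ! j)"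
  using assms by (auto simp: is_subset_def Sub_def sat_quants nth_append ok_nth intro: ok_up
    D_intros)

lemma sat_upair [simp]:
  assumes "i < length xs" "j < length xs" "k < length xs"
  shows "sat w e xs (is_upair i j k) \<longleftrightarrow> ok w e xs \<and> UPair w (xs ! i) (xs ! j) (xs ! k)"
  using assms by (auto simp: is_upair_def UPair_def sat_quants nth_append ok_nth intro: ok_up
    D_intros)

lemma sat_pair [simp]:
  assumes "i < length xs" "j < length xs" "k < length xs"
  shows "sat w e xs (is_pair i j k) \<longleftrightarrow> ok w e xs \<and> Pair w (xs ! i) (xs ! j) (xs ! k)"
  using assms by (auto simp: is_pair_def Pair_def sat_quants nth_append ok_nth intro: ok_up
    D_intros)

lemma sat_related [simp]:
  assumes "i < length xs" "j < length xs" "k < length xs"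
  shows "sat w e xs (related i j k) \<longleftrightarrow> ok w e xs \<and> Rel w (xs ! i) (xs ! j) (xs ! k)"
  using assms by (auto simp: related_def Rel_def sat_quants nth_append ok_nth intro: ok_up D_intros)

lemma sat_mem': "ok w e xs \<Longrightarrow> i < length xs \<Longrightarrow> j < length xs \<Longrightarrow> sat w e xs (mem i j) \<longleftrightarrow>
  M w (xs ! i) (xs ! j)"
  by simp

lemma sat_eq': "ok w e xs \<Longrightarrow> i < length xs \<Longrightarrow> j < length xs \<Longrightarrow> sat w e xs (eq i j) \<longleftrightarrow>
  E w (xs ! i) (xs ! j)"
  by simp

lemma sat_ex': "sat w e xs (ex F) \<longleftrightarrow> (\<exists>x. D w x \<and> sat w e (xs @ [x]) (F (length xs)))"
  using sat_ok by (force simp: sat_ex)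

lemma sat_all': "ok w e xs \<Longrightarrow> sat w e xs (all F) \<longleftrightarrow>
    (\<forall>v x. w \<preceq> v \<longrightarrow> D v x \<longrightarrow> sat v e (xs @ [x]) (F (length xs)))"
  by (simp add: sat_all)

lemma sat_all_imp': "ok w e xs \<Longrightarrow> sat w e xs (all (\<lambda>x. imp (F x) (G x))) \<longleftrightarrow>
    (\<forall>v x. w \<preceq> v \<longrightarrow> D v x \<longrightarrow> sat v e (xs @ [x]) (F (length xs)) \<longrightarrow> sat v e (xs @ [x]) (G (length xs)))"
  using sat_ok by (fastforce simp: sat_all_imp)

lemma sat_all_iff': "ok w e xs \<Longrightarrow> sat w e xs (all (\<lambda>x. iff (F x) (G x))) \<longleftrightarrow>
    (\<forall>v x. w \<preceq> v \<longrightarrow> D v x \<longrightarrow> (sat v e (xs @ [x]) (F (length xs)) \<longleftrightarrow> sat v e (xs @ [x]) (G (length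
      xs))))"
  using sat_ok by (fastforce simp: sat_all_iff)

lemma sat_all_imp2': "ok w e xs \<Longrightarrow> sat w e xs (all (\<lambda>x. all (\<lambda>y. imp (F x y) (G x y)))) \<longleftrightarrow>
    (\<forall>v x y. w \<preceq> v \<longrightarrow> D v x \<longrightarrow> D v y \<longrightarrow> sat v e (xs @ [x, y]) (F (length xs) (Suc (length xs))) \<longrightarrow>
      sat v e (xs @ [x, y]) (G (length xs) (Suc (length xs))))"
  using sat_ok by (fastforce simp: sat_all_imp2)

lemma sat_all_imp3': "ok w e xs \<Longrightarrow> sat w e xs (all (\<lambda>x. all (\<lambda>y. all (\<lambda>z. imp (F x y z) (G x y z)))))
  \<longleftrightarrow>
    (\<forall>v x y z. w \<preceq> v \<longrightarrow> D v x \<longrightarrow> D v y \<longrightarrow> D v z \<longrightarrow>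
      sat v e (xs @ [x, y, z]) (F (length xs) (Suc (length xs)) (Suc (Suc (length xs)))) \<longrightarrow>
      sat v e (xs @ [x, y, z]) (G (length xs) (Suc (length xs)) (Suc (Suc (length xs)))))"
  using sat_ok by (fastforce simp: sat_all_imp3)

text \<open>Splits off \<open>ok\<close> and hands its consequences for later worlds to the
  simplifier, which could not guess the intermediate worlds. With it the meaning of most notions is
  obtained by unfolding alone.\<close>

lemma sat_okI:
  assumes "ok w e xs \<Longrightarrow> (\<And>v. w \<preceq> v \<Longrightarrow> ok v e xs) \<Longrightarrow>
    (\<And>v u. w \<preceq> v \<Longrightarrow> v \<preceq> u \<Longrightarrow> ok u e xs) \<Longrightarrow>
    (\<And>v u u'. w \<preceq> v \<Longrightarrow> v \<preceq> u \<Longrightarrow> u \<preceq> u' \<Longrightarrow> ok u' e xs) \<Longrightarrow>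
    (\<And>v n. w \<preceq> v \<Longrightarrow> n < length xs \<Longrightarrow> D v (xs ! n)) \<Longrightarrow> sat w e xs F \<longleftrightarrow> P"
  shows "sat w e xs F \<longleftrightarrow> ok w e xs \<and> P"
proof (cases "ok w e xs")
  case True
  show ?thesis using assms ok_future[OF True] True by blast
qed (auto dest: sat_ok)

lemmas sem = sat_all_imp3' sat_all_imp2' sat_all_imp' sat_all_iff' sat_all' sat_ex'
  sat_mem' sat_eq' nth_append D_up

text \<open>The class is evaluated below the binders of \<open>p\<close> and \<open>x\<close>, so
  its argument \<open>y\<close> has the third new level.\<close>

lemma sat_fun_class:
  assumes "i < length xs" "j < length xs"
    and "\<And>v p x y. w \<preceq> v \<Longrightarrow> ok v e (xs @ [p, x, y]) \<Longrightarrow>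
      sat v e (xs @ [p, x, y]) (C (Suc (Suc (length xs)))) \<longleftrightarrow> K v y"
  shows "sat w e xs (is_fun_class i j C) \<longleftrightarrow> ok w e xs \<and> FunC w (xs ! i) (xs ! j) K"
proof (cases "ok w e xs")
  case True
  have ok: "ok v e xs" if "w \<preceq> v" for v using True that by (rule ok_up)
  have ok2: "ok u e xs" if "w \<preceq> v" "v \<preceq> u" for v u using True that by (blast intro: ok_up)
  have Dn: "D v (xs ! n)" if "w \<preceq> v" "n < length xs" for v n using ok[OF that(1)] that(2)
    by (rule ok_nth)
  show ?thesis
    using assms(1,2) True by (simp add: is_fun_class_def FunC_def sem assms(3) ok ok2 Dn D_up cong:
      conj_cong)
qed (auto dest: sat_ok)

lemma sat_fun [simp]:
  assumes "i < length xs" "j < length xs" "k < length xs"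
  shows "sat w e xs (is_fun i j k) \<longleftrightarrow> ok w e xs \<and> Fun w (xs ! i) (xs ! j) (xs ! k)"
  unfolding is_fun_def Fun_def using assms
  by (subst sat_fun_class[where K = "\<lambda>v y. M v y (xs ! k)"]) (auto simp: nth_append ok_nth)

lemma sat_surj [simp]:
  assumes "i < length xs" "j < length xs" "k < length xs"
  shows "sat w e xs (is_surj i j k) \<longleftrightarrow>
    ok w e xs \<and> Surj w (xs ! i) (xs ! j) (xs ! k)"
  by (rule sat_okI)
    (use assms in \<open>simp (no_asm_simp) add: is_surj_def Surj_def sem cong: conj_cong\<close>)

lemma sat_comp [simp]:
  assumes "i < length xs" "j < length xs" "k < length xs"
  shows "sat w e xs (is_comp i j k) \<longleftrightarrow>
    ok w e xs \<and> Comp w (xs ! i) (xs ! j) (xs ! k)"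
  by (rule sat_okI)
    (use assms in \<open>simp (no_asm_simp) add: is_comp_def Comp_def sem cong: conj_cong\<close>)

lemma sat_fibre [simp]:
  assumes "i < length xs" "j < length xs" "k < length xs"
  shows "sat w e xs (is_fibre i j k) \<longleftrightarrow>
    ok w e xs \<and> Fibre w (xs ! i) (xs ! j) (xs ! k)"
  by (rule sat_okI)
    (use assms in \<open>simp (no_asm_simp) add: is_fibre_def Fibre_def sem cong: conj_cong\<close>)

lemma sat_base [simp]:
  assumes "i < length xs"
  shows "sat w e xs (is_base i) \<longleftrightarrow>
    ok w e xs \<and> Base w (xs ! i)"
  by (rule sat_okI)
    (use assms in \<open>simp (no_asm_simp) add: is_base_def Base_def sem cong: conj_cong\<close>)

lemma sat_base_map [simp]:
  assumes "i < length xs" "j < length xs" "k < length xs"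
  shows "sat w e xs (is_base_map i j k) \<longleftrightarrow>
    ok w e xs \<and> BaseMap w (xs ! i) (xs ! j) (xs ! k)"
  by (rule sat_okI)
    (use assms in \<open>simp (no_asm_simp) add: is_base_map_def BaseMap_def sem cong: conj_cong\<close>)

lemma sat_poly [simp]:
  assumes "i < length xs" "j < length xs" "k < length xs" "l < length xs"
  shows "sat w e xs (is_poly i j k l) \<longleftrightarrow>
    ok w e xs \<and> Poly w (xs ! i) (xs ! j) (xs ! k) (xs ! l)"
  by (rule sat_okI)
    (use assms in \<open>simp (no_asm_simp) add: is_poly_def Poly_def sem cong: conj_cong\<close>)

lemma sat_algebra [simp]:
  assumes "i < length xs" "j < length xs" "k < length xs" "l < length xs"
  shows "sat w e xs (is_algebra i j k l) \<longleftrightarrow>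
    ok w e xs \<and> Alg w (xs ! i) (xs ! j) (xs ! k) (xs ! l)"
  by (rule sat_okI)
    (use assms in \<open>simp (no_asm_simp) add: is_algebra_def Alg_def sem cong: conj_cong\<close>)

lemma sat_alg_val [simp]:
  assumes "i < length xs" "j < length xs" "k < length xs" "l < length xs"
  shows "sat w e xs (alg_val i j k l) \<longleftrightarrow>
    ok w e xs \<and> AlgVal w (xs ! i) (xs ! j) (xs ! k) (xs ! l)"
  by (rule sat_okI)
    (use assms in \<open>simp (no_asm_simp) add: alg_val_def AlgVal_def sem cong: conj_cong\<close>)

lemma sat_alg_hom [simp]:
  assumes "i < length xs" "j < length xs" "k < length xs" "l < length xs" "m < length xs"
  shows "sat w e xs (is_alg_hom i j k l m) \<longleftrightarrow>
    ok w e xs \<and> Hom w (xs ! i) (xs ! j) (xs ! k) (xs ! l) (xs ! m)"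
  by (rule sat_okI)
    (use assms in \<open>simp (no_asm_simp) add: is_alg_hom_def Hom_def sem cong: conj_cong\<close>)

lemma sat_W_type [simp]:
  assumes "i < length xs" "j < length xs" "k < length xs" "l < length xs"
  shows "sat w e xs (is_W_type i j k l) \<longleftrightarrow>
    ok w e xs \<and> WType w (xs ! i) (xs ! j) (xs ! k) (xs ! l)"
  by (rule sat_okI)
    (use assms in \<open>simp (no_asm_simp) add: is_W_type_def WType_def sem cong: conj_cong\<close>)

lemma sat_rule_set [simp]:
  assumes "i < length xs" "j < length xs"
  shows "sat w e xs (is_rule_set i j) \<longleftrightarrow>
    ok w e xs \<and> RuleSet w (xs ! i) (xs ! j)"
  by (rule sat_okI)
    (use assms in \<open>simp (no_asm_simp) add: is_rule_set_def RuleSet_def sem cong: conj_cong\<close>)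

lemma sat_closed [simp]:
  assumes "i < length xs" "j < length xs"
  shows "sat w e xs (is_closed i j) \<longleftrightarrow>
    ok w e xs \<and> Closed w (xs ! i) (xs ! j)"
  by (rule sat_okI)
    (use assms in \<open>simp (no_asm_simp) add: is_closed_def Closed_def sem cong: conj_cong\<close>)

text \<open>The bridge between schemes and named variables: for a formula written over the levels of
  \<open>ps\<close> followed by its arguments, the parameters move into the environment and
  \<open>inst\<close> supplies the arguments.\<close>

lemma sat_inst:
  assumes "\<And>y. y \<in> set ys \<Longrightarrow> y < length xs"
  shows "sat w (env e ps) xs (inst (F (length ps + length ys)) ys) \<longleftrightarrow>
    ok w (env e ps) xs \<and> sat w e (ps @ rev (map ((!) xs) ys)) F"
proof -
  have "env (env e ps) xs (if i < length ys then length xs - Suc (ys ! i) else length xs + (i -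
    length ys)) =
      env e (ps @ rev (map ((!) xs) ys)) i" for i
  proof (cases "i < length ys")
    case True
    then have "ys ! i < length xs" using assms by simp
    moreover have "length ps + length ys - Suc i = length ps + (length ys - Suc i)"
      using True by simp
    moreover have "length ys - Suc (length ys - Suc i) = i" using True by simp
    moreover have "\<not> length ps + length ys - Suc i < length ps" using True by auto
    ultimately show ?thesis
      using True by (simp add: env_nth) (simp add: env_def nth_append rev_nth)
  next
    case False
    then show ?thesis by (auto simp: env_def nth_append intro: arg_cong)
  qed
  then have "forces w (env (env e ps) xs) (inst (F (length ps + length ys)) ys (length xs)) \<longleftrightarrow>
      forces w (env e (ps @ rev (map ((!) xs) ys))) (F (length ps + length ys))"
    by (simp add: inst_def forces_rename comp_def)
  moreover have "ok w e (ps @ rev (map ((!) xs) ys))" if "ok w (env e ps) xs"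
  proof -
    have "ok w (env e ps) []" using that by (simp add: ok_def)
    then have "ok w e ps" by (simp add: ok_env)
    then show ?thesis using that assms by (auto simp: ok_def)
  qed
  ultimately show ?thesis by (auto simp: sat_def)
qed

lemma sat_allD: "sat w e xs (all F) \<Longrightarrow> D w x \<Longrightarrow> sat w e (xs @ [x]) (F (length xs))"
  by (simp add: sat_all)

lemma sat_all_impD:
  "sat w e xs (all (\<lambda>x. imp (F x) (G x))) \<Longrightarrow> w \<preceq> v \<Longrightarrow>
    sat v e (xs @ [x]) (F (length xs)) \<Longrightarrow> sat v e (xs @ [x]) (G (length xs))"
  by (simp add: sat_all_imp)

lemma sat_all_iffD:
  "sat w e xs (all (\<lambda>x. iff (F x) (G x))) \<Longrightarrow> w \<preceq> v \<Longrightarrow>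
    sat v e (xs @ [x]) (F (length xs)) \<longleftrightarrow> sat v e (xs @ [x]) (G (length xs))"
  by (simp add: sat_all_iff)

lemma sat_impD: "sat w e xs (imp F G) \<Longrightarrow> sat w e xs F \<Longrightarrow> sat w e xs G"
  by auto

lemma sat_exE:
  assumes "sat w e xs (ex F)"
  obtains x where "D w x" "sat w e (xs @ [x]) (F (length xs))"
  using assms unfolding sat_ex' by blast

text \<open>The arguments are appended in reverse order because \<open>inst\<close> substitutes its first variable
  for the index \<open>0\<close>, which is the last level.\<close>

definition bounded_class :: "'w \<Rightarrow> ('w \<Rightarrow> 'd \<Rightarrow> bool) \<Rightarrow> bool" where
  "bounded_class w \<Phi> \<longleftrightarrow> (\<exists>F ps e. ok w e ps \<and> bounded (F (Suc (length ps))) \<and>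
    (\<forall>v x. w \<preceq> v \<longrightarrow> D v x \<longrightarrow> (\<Phi> v x \<longleftrightarrow> sat v e (ps @ [x]) F)))"

definition class_rel :: "'w \<Rightarrow> ('w \<Rightarrow> 'd \<Rightarrow> 'd \<Rightarrow> bool) \<Rightarrow> bool" where
  "class_rel w \<Phi> \<longleftrightarrow> (\<exists>F ps e. ok w e ps \<and>
    (\<forall>v x y. w \<preceq> v \<longrightarrow> D v x \<longrightarrow> D v y \<longrightarrow> (\<Phi> v x y \<longleftrightarrow> sat v e (ps @ [y, x]) F)))"

text \<open>An environment is an infinite assignment into the domain. The first parameter
  \<open>p0\<close> fills all of it, so at least one parameter is asked for.\<close>

lemma bounded_classI:
  assumes "\<forall>p\<in>set (p0 # ps). D w p" "bounded (F (Suc (Suc (length ps))))"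
    and "\<And>v x. w \<preceq> v \<Longrightarrow> ok v (\<lambda>_. p0) (p0 # ps @ [x]) \<Longrightarrow> \<Phi> v x \<longleftrightarrow> sat v (\<lambda>_. p0) (p0 # ps @ [x]) F"
  shows "bounded_class w \<Phi>"
proof -
  have ok: "ok v (\<lambda>_. p0) (p0 # ps)" if "w \<preceq> v" for v
    using assms(1) D_up[OF _ that] by (auto simp: ok_def)
  show ?thesis
    unfolding bounded_class_def
  proof (intro exI conjI allI impI)
    fix v x assume "w \<preceq> v" "D v x"
    then show "\<Phi> v x \<longleftrightarrow> sat v (\<lambda>_. p0) ((p0 # ps) @ [x]) F"
      using assms(3)[of v x] ok by (simp add: ok_Cons)
  qed (use assms(2) ok in simp_all)
qed

lemma class_relI:
  assumes "\<forall>p\<in>set (p0 # ps). D w p"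
    and "\<And>v x y. w \<preceq> v \<Longrightarrow> ok v (\<lambda>_. p0) (p0 # ps @ [y, x]) \<Longrightarrow>
      \<Phi> v x y \<longleftrightarrow> sat v (\<lambda>_. p0) (p0 # ps @ [y, x]) F"
  shows "class_rel w \<Phi>"
proof -
  have ok: "ok v (\<lambda>_. p0) (p0 # ps)" if "w \<preceq> v" for v
    using assms(1) D_up[OF _ that] by (auto simp: ok_def)
  show ?thesis
    unfolding class_rel_def
  proof (intro exI conjI allI impI)
    fix v x y assume "w \<preceq> v" "D v x" "D v y"
    then show "\<Phi> v x y \<longleftrightarrow> sat v (\<lambda>_. p0) ((p0 # ps) @ [y, x]) F"
      using assms(2)[of v y x] ok by (simp add: ok_Cons)
  qed (use assms(1) ok in simp_all)
qed

definition class_rel3 :: "'w \<Rightarrow> ('w \<Rightarrow> 'd \<Rightarrow> 'd \<Rightarrow> 'd \<Rightarrow> bool) \<Rightarrow> bool" where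
  "class_rel3 w \<Phi> \<longleftrightarrow> (\<exists>F ps e. ok w e ps \<and>
    (\<forall>v x y z. w \<preceq> v \<longrightarrow> D v x \<longrightarrow> D v y \<longrightarrow> D v z \<longrightarrow> (\<Phi> v x y z \<longleftrightarrow> sat v e (ps @ [z, y, x]) F)))"

lemma class_rel3I:
  assumes "\<forall>p\<in>set (p0 # ps). D w p"
    and "\<And>v x y z. w \<preceq> v \<Longrightarrow> ok v (\<lambda>_. p0) (p0 # ps @ [z, y, x]) \<Longrightarrow>
      \<Phi> v x y z \<longleftrightarrow> sat v (\<lambda>_. p0) (p0 # ps @ [z, y, x]) F"
  shows "class_rel3 w \<Phi>"
proof -
  have ok: "ok v (\<lambda>_. p0) (p0 # ps)" if "w \<preceq> v" for v
    using assms(1) D_up[OF _ that] by (auto simp: ok_def)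
  show ?thesis
    unfolding class_rel3_def
  proof (intro exI conjI allI impI)
    fix v x y z assume "w \<preceq> v" "D v x" "D v y" "D v z"
    then show "\<Phi> v x y z \<longleftrightarrow> sat v (\<lambda>_. p0) ((p0 # ps) @ [z, y, x]) F"
      using assms(2)[of v z y x] ok by (simp add: ok_Cons)
  qed (use assms(1) ok in simp_all)
qed

end

subsection \<open>The axioms in a Kripke model\<close>

locale czf = kripke_model le D M E "CZF \<union> {PA 0} \<union> RDC_W"
  for le :: "'w \<Rightarrow> 'w \<Rightarrow> bool" (infix "\<preceq>" 50) and D :: "'w \<Rightarrow> 'd \<Rightarrow> bool" and M E
begin

lemma axiom_sat: "F 0 \<in> CZF \<union> {PA 0} \<union> RDC_W \<Longrightarrow> ok w e [] \<Longrightarrow> sat w e [] F"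
  using axiom[of "F 0" w e] by (simp add: sat_def ok_def env_def[abs_def])

lemma ok_const: "ok w (\<lambda>_. a) [] \<longleftrightarrow> D w a"
  by (simp add: ok_def)

lemma extensionality:
  assumes "D w a" "D w b" "\<And>v x. w \<preceq> v \<Longrightarrow> M v x a \<longleftrightarrow> M v x b"
  shows "E w a b"
proof -
  have "sat w (\<lambda>_. a) [] Extensionality"
    using assms(1) by (intro axiom_sat) (auto simp: CZF_def ok_const)
  from sat_allD[OF sat_allD[OF this[unfolded Extensionality_def] assms(1)] assms(2)]
  have "sat w (\<lambda>_. a) [a, b] (imp (all (\<lambda>x. iff (mem x 0) (mem x (Suc 0)))) (eq 0 (Suc 0)))"
    by simp
  moreover have "sat w (\<lambda>_. a) [a, b] (all (\<lambda>x. iff (mem x 0) (mem x (Suc 0))))"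
    using assms by (auto simp: sat_all_iff ok_def intro: D_up dest: M_D1)
  ultimately show ?thesis by (auto dest: sat_impD)
qed

lemma pairing:
  assumes "D w a" "D w b"
  obtains c where "UPair w c a b"
proof -
  have "sat w (\<lambda>_. a) [] Pairing"
    using assms(1) by (intro axiom_sat) (auto simp: CZF_def ok_const)
  from sat_allD[OF sat_allD[OF this[unfolded Pairing_def] assms(1)] assms(2)]
  obtain c where "D w c"
    "sat w (\<lambda>_. a) [a, b, c] (is_upair (Suc (Suc 0)) 0 (Suc 0))"
    by (auto elim!: sat_exE simp: is_upair_def)
  then have "UPair w c a b" by simp
  then show thesis by (rule that)
qed

lemma union:
  assumes "D w a"
  obtains c where "D w c" "\<And>v x. w \<preceq> v \<Longrightarrow> M v x c \<longleftrightarrow> (\<exists>y. M v y a \<and> M v x y)"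
proof -
  have "sat w (\<lambda>_. a) [] Union"
    using assms(1) by (intro axiom_sat) (auto simp: CZF_def ok_const)
  from sat_allD[OF this[unfolded Union_def] assms(1)]
  obtain c where c: "D w c"
    "sat w (\<lambda>_. a) [a, c] (all (\<lambda>x. iff (mem x (Suc 0)) (ex (\<lambda>y. conj (mem y 0) (mem x y)))))"
    by (auto elim!: sat_exE)
  have "M v x c \<longleftrightarrow> (\<exists>y. M v y a \<and> M v x y)" if v: "w \<preceq> v" for v x
  proof (cases "D v x")
    case True
    have ok: "ok v (\<lambda>_. a) [a, c, x]" using True D_up[OF c(1) v] D_up[OF assms v]
      by (simp add: ok_def)
    have "M v x c \<longleftrightarrow> (\<exists>y. D v y \<and> M v y a \<and> M v x y)"
      using sat_all_iffD[OF c(2) v, of x] ok by (simp add: sem ok_Cons cong: conj_cong)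
    then show ?thesis by (auto dest: M_D1)
  qed (auto dest: M_D1)
  with c(1) show thesis by (rule that)
qed

lemma separation:
  assumes "D w a" "bounded_class w \<Phi>"
  obtains c where "D w c" "\<And>v x. w \<preceq> v \<Longrightarrow> M v x c \<longleftrightarrow> M v x a \<and> \<Phi> v x"
proof -
  obtain F ps e where F: "ok w e ps" "bounded (F (Suc (length ps)))"
    "\<And>v x. w \<preceq> v \<Longrightarrow> D v x \<Longrightarrow> \<Phi> v x \<longleftrightarrow> sat v e (ps @ [x]) F"
    using assms(2) unfolding bounded_class_def by blast
  let ?p = "F (length ps + length [Suc (Suc 0)])"
  have ok: "ok v (env e ps) []" if "w \<preceq> v" for v
    using F(1) that by (simp add: ok_env ok_up)
  have "sat w (env e ps) [] (Separation ?p)"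
    using F(2) ok by (intro axiom_sat) (auto simp: CZF_def)
  from sat_allD[OF this[unfolded Separation_def] assms(1)]
  obtain c where c: "D w c"
    "sat w (env e ps) [a, c] (all (\<lambda>x. iff (mem x (Suc 0)) (conj (mem x 0) (inst ?p [x]))))"
    by (auto elim!: sat_exE)
  have "M v x c \<longleftrightarrow> M v x a \<and> \<Phi> v x" if v: "w \<preceq> v" for v x
  proof -
    have "sat v (env e ps) [a, c, x] (inst ?p [Suc (Suc 0)]) \<longleftrightarrow> ok v (env e ps) [a, c, x] \<and>
      sat v e (ps @ [x]) F"
      by (subst sat_inst) simp_all
    then show ?thesis
      using c(2) v ok[OF v] D_up[OF c(1) v] D_up[OF assms(1) v] F(3)[OF v, of x]
      by (auto simp: sat_all_iff ok_Cons dest: M_D1)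
  qed
  with c(1) show thesis by (rule that)
qed

definition total :: "'w \<Rightarrow> 'd \<Rightarrow> ('w \<Rightarrow> 'd \<Rightarrow> 'd \<Rightarrow> bool) \<Rightarrow> bool" where
  "total w a \<Phi> \<longleftrightarrow> (\<forall>v x. w \<preceq> v \<longrightarrow> M v x a \<longrightarrow> (\<exists>y. D v y \<and> \<Phi> v x y))"

lemma totalI: "(\<And>v x. w \<preceq> v \<Longrightarrow> M v x a \<Longrightarrow> \<exists>y. D v y \<and> \<Phi> v x y) \<Longrightarrow> total w a \<Phi>"
  by (simp add: total_def)

lemma totalD: "total w a \<Phi> \<Longrightarrow> w \<preceq> v \<Longrightarrow> M v x a \<Longrightarrow> \<exists>y. D v y \<and> \<Phi> v x y"
  by (simp add: total_def)

lemma collection: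
  assumes "D w a" "class_rel w \<Phi>" "total w a \<Phi>"
  shows "\<exists>b. D w b \<and>
    (\<forall>v x. w \<preceq> v \<longrightarrow> M v x a \<longrightarrow> (\<exists>y. M v y b \<and> \<Phi> v x y)) \<and>
    (\<forall>v y. w \<preceq> v \<longrightarrow> M v y b \<longrightarrow> (\<exists>x. M v x a \<and> \<Phi> v x y))"
proof -
  obtain F ps e where F: "ok w e ps"
    "\<And>v x y. w \<preceq> v \<Longrightarrow> D v x \<Longrightarrow> D v y \<Longrightarrow> \<Phi> v x y \<longleftrightarrow> sat v e (ps @ [y, x]) F"
    using assms(2) unfolding class_rel_def by blast
  define p where "p = F (length ps + 2)"
  have ok: "ok v (env e ps) []" if "w \<preceq> v" for v
    using F(1) that by (simp add: ok_env ok_up)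
  have inst: "sat v (env e ps) xs (inst p [i, j]) \<longleftrightarrow> \<Phi> v (xs ! i) (xs ! j)"
    if "w \<preceq> v" "ok v (env e ps) xs" "i < length xs" "j < length xs" for v xs i j
    using that sat_inst[of "[i, j]" xs v e ps F] F(2)[OF that(1), of "xs ! i" "xs ! j"]
    by (auto simp: ok_nth p_def)
  have "sat w (env e ps) [] (Strong_Collection p)"
    using ok by (intro axiom_sat) (auto simp: CZF_def)
  from sat_allD[OF this[unfolded Strong_Collection_def] assms(1)]
  have *: "sat w (env e ps) [a] (imp (all (\<lambda>x. imp (mem x 0) (ex (\<lambda>y. inst p [x, y]))))
     (ex (\<lambda>b. conj (all (\<lambda>x. imp (mem x 0) (ex (\<lambda>y. conj (mem y b) (inst p [x, y])))))
        (all (\<lambda>y. imp (mem y b) (ex (\<lambda>x. conj (mem x 0) (inst p [x, y]))))))))"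
    by simp
  have "sat w (env e ps) [a] (all (\<lambda>x. imp (mem x 0) (ex (\<lambda>y. inst p [x, y]))))"
    unfolding sat_all_imp
  proof (intro conjI allI impI)
    show "ok w (env e ps) [a]" using ok[OF le_refl] assms(1) by (simp add: ok_Cons)
    fix v x assume v: "w \<preceq> v" and "sat v (env e ps) ([a] @ [x]) (mem (length [a]) 0)"
    then have okv: "ok v (env e ps) [a, x]" and "M v x a" by (auto dest: sat_ok)
    with totalD[OF assms(3) v] obtain y where "D v y" "\<Phi> v x y" by blast
    then show "sat v (env e ps) ([a] @ [x]) (ex (\<lambda>y. inst p [length [a], y]))"
      using okv inst[OF v, of "[a, x, y]" "Suc 0" "Suc (Suc 0)"]
        by (auto simp: sat_ex ok_Cons intro!: exI[of _ y])
  qed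
  from sat_impD[OF * this] obtain b where b: "D w b"
    "sat w (env e ps) [a, b] (conj (all (\<lambda>x. imp (mem x 0) (ex (\<lambda>y. conj (mem y (Suc 0)) (inst p [x,
      y])))))
        (all (\<lambda>y. imp (mem y (Suc 0)) (ex (\<lambda>x. conj (mem x 0) (inst p [x, y]))))))"
    by (auto elim!: sat_exE)
  then have b1: "sat w (env e ps) [a, b] (all (\<lambda>x. imp (mem x 0) (ex (\<lambda>y. conj (mem y (Suc 0)) (inst
    p [x, y])))))"
    and b2: "sat w (env e ps) [a, b] (all (\<lambda>y. imp (mem y (Suc 0)) (ex (\<lambda>x. conj (mem x 0) (inst p
      [x, y])))))"
    unfolding sat_conj by blast+
  have okv: "ok v (env e ps) [a, b]" if "w \<preceq> v" for v
    using ok[OF that] D_up[OF assms(1) that] D_up[OF b(1) that] by (simp add: ok_Cons)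
  show ?thesis
  proof (rule exI[of _ b], intro conjI allI impI)
    show "D w b" by (rule b(1))
  next
    fix v x assume v: "w \<preceq> v" "M v x a"
    have okx: "ok v (env e ps) [a, b, x]" using okv[OF v(1)] M_D1[OF v(2)] by (simp add: ok_Cons)
    have "sat v (env e ps) [a, b, x] (ex (\<lambda>y. conj (mem y (Suc 0)) (inst p [Suc (Suc 0), y])))"
      using sat_all_impD[OF b1 v(1), of x] v(2) okx by simp
    then obtain y where y: "sat v (env e ps) [a, b, x, y] (conj (mem (Suc (Suc (Suc 0))) (Suc 0))
      (inst p [Suc (Suc 0), Suc (Suc (Suc 0))]))"
      by (auto elim!: sat_exE)
    then have "M v y b" "\<Phi> v x y" using inst[OF v(1), of "[a, b, x, y]" "Suc (Suc 0)"
      "Suc (Suc (Suc 0))"] sat_ok[OF y] by simp_all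
    then show "\<exists>y. M v y b \<and> \<Phi> v x y" by blast
  next
    fix v y assume v: "w \<preceq> v" "M v y b"
    have oky: "ok v (env e ps) [a, b, y]" using okv[OF v(1)] M_D1[OF v(2)] by (simp add: ok_Cons)
    have "sat v (env e ps) [a, b, y] (ex (\<lambda>x. conj (mem x 0) (inst p [x, Suc (Suc 0)])))"
      using sat_all_impD[OF b2 v(1), of y] v(2) oky by simp
    then obtain x where x: "sat v (env e ps) [a, b, y, x] (conj (mem (Suc (Suc (Suc 0))) 0) (inst p
      [Suc (Suc (Suc 0)), Suc (Suc 0)]))"
      by (auto elim!: sat_exE)
    then have "M v x a" "\<Phi> v x y" using inst[OF v(1), of "[a, b, y, x]" "Suc (Suc (Suc 0))"
      "Suc (Suc 0)"] sat_ok[OF x] by simp_all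
    then show "\<exists>x. M v x a \<and> \<Phi> v x y" by blast
  qed
qed

lemma subset_collection:
  assumes "D w a" "D w b" "class_rel3 w \<Phi>"
  obtains c where "D w c"
    "\<And>v u. w \<preceq> v \<Longrightarrow> D v u \<Longrightarrow> (\<And>v' x. v \<preceq> v' \<Longrightarrow> M v' x a \<Longrightarrow> \<exists>y. M v' y b \<and> \<Phi> v' x y u) \<Longrightarrow>
      \<exists>d. M v d c \<and> (\<forall>v' x. v \<preceq> v' \<longrightarrow> M v' x a \<longrightarrow> (\<exists>y. M v' y d \<and> \<Phi> v' x y u)) \<and>
        (\<forall>v' y. v \<preceq> v' \<longrightarrow> M v' y d \<longrightarrow> (\<exists>x. M v' x a \<and> \<Phi> v' x y u))"
proof -
  obtain F ps e where F: "ok w e ps"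
    "\<And>v x y z. w \<preceq> v \<Longrightarrow> D v x \<Longrightarrow> D v y \<Longrightarrow> D v z \<Longrightarrow> \<Phi> v x y z \<longleftrightarrow> sat v e (ps @ [z, y, x]) F"
    using assms(3) unfolding class_rel3_def by blast
  define p where "p = F (length ps + 3)"
  define E' where "E' = env e ps"
  have ok: "ok v E' []" if "w \<preceq> v" for v
    using F(1) that by (simp add: E'_def ok_env ok_up)
  have inst: "sat v E' xs (inst p [i, j, k]) \<longleftrightarrow> \<Phi> v (xs ! i) (xs ! j) (xs ! k)"
    if "w \<preceq> v" "ok v E' xs" "i < length xs" "j < length xs" "k < length xs" for v xs i j k
    using that sat_inst[of "[i, j, k]" xs v e ps F] F(2)[OF that(1), of "xs ! i" "xs ! j" "xs ! k"]
    by (auto simp: ok_nth p_def E'_def numeral_3_eq_3)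
  have "sat w E' [] (Subset_Collection p)"
    using ok by (intro axiom_sat) (auto simp: CZF_def)
  from sat_allD[OF sat_allD[OF this[unfolded Subset_Collection_def] assms(1)] assms(2)]
  obtain c where c: "D w c"
    "sat w E' [a, b, c] (all (\<lambda>u. imp
       (all (\<lambda>x. imp (mem x 0) (ex (\<lambda>y. conj (mem y (Suc 0)) (inst p [x, y, u])))))
       (ex (\<lambda>d. conj (mem d (Suc (Suc 0))) (conj
          (all (\<lambda>x. imp (mem x 0) (ex (\<lambda>y. conj (mem y d) (inst p [x, y, u])))))
          (all (\<lambda>y. imp (mem y d) (ex (\<lambda>x. conj (mem x 0) (inst p [x, y, u]))))))))))"
    by (auto elim!: sat_exE)
  have D: "ok v E' [a, b, c]" if "w \<preceq> v" for v
    using ok[OF that] D_up[OF assms(1) that] D_up[OF assms(2) that] D_up[OF c(1) that]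
      by (simp add: ok_Cons)
  let ?n = "Suc (Suc (Suc 0))"
  show thesis
  proof (rule that[OF c(1)])
    fix v u assume v: "w \<preceq> v" "D v u"
      and tot: "\<And>v' x. v \<preceq> v' \<Longrightarrow> M v' x a \<Longrightarrow> \<exists>y. M v' y b \<and> \<Phi> v' x y u"
    have wv': "w \<preceq> v'" if "v \<preceq> v'" for v' using v(1) that by (rule le_trans)
    have D': "ok v' E' [a, b, c, u]" if "v \<preceq> v'" for v'
      using D[OF wv'[OF that]] D_up[OF v(2) that] by (simp add: ok_Cons)
    have "sat v E' [a, b, c, u] (all (\<lambda>x. imp (mem x 0) (ex (\<lambda>y. conj (mem y (Suc 0)) (inst p [x, y,
      ?n])))))"
      unfolding sat_all_imp
    proof (intro conjI allI impI)
      show "ok v E' [a, b, c, u]" by (rule D') (rule le_refl)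
      fix v' x assume v': "v \<preceq> v'" and "sat v' E' ([a, b, c, u] @ [x]) (mem (length [a, b, c, u])
        0)"
      then have x: "M v' x a" by simp
      with tot[OF v'] obtain y where y: "M v' y b" "\<Phi> v' x y u" by blast
      have "ok v' E' [a, b, c, u, x, y]" using D'[OF v'] x y by (auto simp: ok_Cons dest: M_D1)
      with y inst[OF wv'[OF v'] this, of "Suc ?n" "Suc (Suc ?n)" ?n]
      show "sat v' E' ([a, b, c, u] @ [x]) (ex (\<lambda>y. conj (mem y (Suc 0)) (inst p [length [a, b, c,
        u], y, ?n])))"
        by (auto simp: sat_ex intro!: exI[of _ y])
    qed
    with sat_all_impD[OF c(2) v(1), of u] obtain d where d: "D v d"
      "sat v E' [a, b, c, u, d] (mem (Suc ?n) (Suc (Suc 0)))"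
      "sat v E' [a, b, c, u, d] (all (\<lambda>x. imp (mem x 0) (ex (\<lambda>y. conj (mem y (Suc ?n)) (inst p [x,
        y, ?n])))))"
      "sat v E' [a, b, c, u, d] (all (\<lambda>y. imp (mem y (Suc ?n)) (ex (\<lambda>x. conj (mem x 0) (inst p [x,
        y, ?n])))))"
      by (auto elim!: sat_exE)
    have okd: "ok v' E' [a, b, c, u, d, x]" if "v \<preceq> v'" "D v' x" for v' x
      using D'[OF that(1)] D_up[OF d(1) that(1)] that(2) by (simp add: ok_Cons)
    show "\<exists>d. M v d c \<and> (\<forall>v' x. v \<preceq> v' \<longrightarrow> M v' x a \<longrightarrow> (\<exists>y. M v' y d \<and> \<Phi> v' x y u)) \<and>
        (\<forall>v' y. v \<preceq> v' \<longrightarrow> M v' y d \<longrightarrow> (\<exists>x. M v' x a \<and> \<Phi> v' x y u))"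
    proof (rule exI[of _ d], intro conjI allI impI)
      show "M v d c" using d(2) by simp
    next
      fix v' x assume v': "v \<preceq> v'" "M v' x a"
      note okx = okd[OF v'(1) M_D1[OF v'(2)]]
      have "sat v' E' [a, b, c, u, d, x] (ex (\<lambda>y. conj (mem y (Suc ?n)) (inst p [Suc (Suc ?n), y,
        ?n])))"
        using sat_all_impD[OF d(3) v'(1), of x] okx v'(2) by simp
      then obtain y where y: "sat v' E' [a, b, c, u, d, x, y] (conj (mem (Suc (Suc (Suc ?n))) (Suc
        ?n)) (inst p [Suc (Suc ?n), Suc (Suc (Suc ?n)), ?n]))"
        by (auto elim!: sat_exE)
      then show "\<exists>y. M v' y d \<and> \<Phi> v' x y u"
        using inst[OF wv'[OF v'(1)] sat_ok[OF y], of "Suc (Suc ?n)" "Suc (Suc (Suc ?n))" ?n] by auto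
    next
      fix v' x assume v': "v \<preceq> v'" "M v' x d"
      note okx = okd[OF v'(1) M_D1[OF v'(2)]]
      have "sat v' E' [a, b, c, u, d, x] (ex (\<lambda>y. conj (mem y 0) (inst p [y, Suc (Suc ?n), ?n])))"
        using sat_all_impD[OF d(4) v'(1), of x] okx v'(2) by simp
      then obtain y where y: "sat v' E' [a, b, c, u, d, x, y] (conj (mem (Suc (Suc (Suc ?n))) 0)
        (inst p [Suc (Suc (Suc ?n)), Suc (Suc ?n), ?n]))"
        by (auto elim!: sat_exE)
      then show "\<exists>y. M v' y a \<and> \<Phi> v' y x u"
        using inst[OF wv'[OF v'(1)] sat_ok[OF y], of "Suc (Suc (Suc ?n))" "Suc (Suc ?n)" ?n] by auto
    qed
  qed
qed

lemma presentation:
  assumes "D w x"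
  obtains b g where "Base w b" "Surj w g b x"
proof -
  have "sat w (\<lambda>_. x) [] PA"
    using assms by (intro axiom_sat) (auto simp: ok_const)
  from sat_allD[OF this[unfolded PA_def] assms] obtain b where
    "sat w (\<lambda>_. x) [x, b] (conj (is_base (Suc 0)) (ex (\<lambda>g. is_surj g (Suc 0) 0)))"
    by (auto elim!: sat_exE)
  then show thesis by (auto elim!: sat_exE intro: that)
qed

lemma W_type:
  assumes "BaseMap w f B A"
  obtains W s where "WType w f A W s"
proof -
  have D: "D w f" "D w B" "D w A" using assms by (auto simp: BaseMap_def dest: Fun_D)
  have "sat w (\<lambda>_. A) [] W_types_exist"
    using D by (intro axiom_sat) (auto simp: RDC_W_def ok_const)
  from sat_allD[OF sat_allD[OF sat_allD[OF this[unfolded W_types_exist_def] D(2)] D(3)] D(1)]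
  have "sat w (\<lambda>_. A) [B, A, f] (imp (is_base_map (Suc (Suc 0)) 0 (Suc 0)) (ex (\<lambda>W. ex (\<lambda>s.
    is_W_type (Suc (Suc 0)) (Suc 0) W s))))"
    by simp
  from sat_impD[OF this] show thesis
    using assms D by (auto simp: ok_def elim!: sat_exE intro: that)
qed

text \<open>The hypotheses \<open>C\<close> and \<open>Q\<close> present the class and the relation
  by formulas over common parameters \<open>ps\<close>; the other hypotheses and the conclusion are
  purely semantic, so that applications never meet \<open>inst\<close>.\<close>

lemma W_choice:
  assumes f: "BaseMap w f B A" and W: "WType w f A W s" and ps: "ok w e ps"
    and C: "\<And>v x. w \<preceq> v \<Longrightarrow> D v x \<Longrightarrow> C v x \<longleftrightarrow> sat v e (ps @ [x]) FC"
    and Q: "\<And>v a t x. w \<preceq> v \<Longrightarrow> D v a \<Longrightarrow> D v t \<Longrightarrow> D v x \<Longrightarrow> Q v a t x \<longleftrightarrow> sat v e (ps @ [x, t, a]) FQ"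
    and QC: "\<And>v a k t x. w \<preceq> v \<Longrightarrow> M v a A \<Longrightarrow> Fibre v k f a \<Longrightarrow> Q v a t x \<Longrightarrow> FunC v t k C \<and> C v x"
    and tot: "\<And>v a k t. w \<preceq> v \<Longrightarrow> M v a A \<Longrightarrow> Fibre v k f a \<Longrightarrow> FunC v t k C \<Longrightarrow> \<exists>x. D v x \<and> Q v a t x"
  shows "\<exists>h. FunC w h W C \<and> (\<forall>v a t y. w \<preceq> v \<longrightarrow> AlgVal v s a t y \<longrightarrow>
    (\<exists>u x. Comp v u h t \<and> Rel v h y x \<and> Q v a u x))"
proof -
  have D: "D w f" "D w B" "D w A" "D w W" "D w s"
    using f W by (auto simp: BaseMap_def WType_def dest: Fun_D Alg_D)
  define E' where "E' = env e ps"
  define p where "p = FC (length ps + 1)"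
  define q where "q = FQ (length ps + 3)"
  let ?xs = "[B, A, f, W, s]"
  have ok: "ok v E' ?xs" if "w \<preceq> v" for v
    using ok_up[OF ps that] D D_up[OF _ that] by (simp add: E'_def ok_Cons ok_env)
  have p: "sat v E' xs (inst p [i]) \<longleftrightarrow> C v (xs ! i)"
    if "w \<preceq> v" "ok v E' xs" "i < length xs" for v xs i
    using that sat_inst[of "[i]" xs v e ps FC] C[OF that(1), of "xs ! i"]
    by (auto simp: ok_nth p_def E'_def)
  have q: "sat v E' xs (inst q [i, j, k]) \<longleftrightarrow> Q v (xs ! i) (xs ! j) (xs ! k)"
    if "w \<preceq> v" "ok v E' xs" "i < length xs" "j < length xs" "k < length xs" for v xs i j k
    using that sat_inst[of "[i, j, k]" xs v e ps FQ] Q[OF that(1), of "xs ! i" "xs ! j" "xs ! k"]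
    by (auto simp: ok_nth q_def E'_def numeral_3_eq_3)
  have fc: "sat v E' xs (is_fun_class i j (\<lambda>y. inst p [y])) \<longleftrightarrow> FunC v (xs ! i) (xs ! j) C"
    if "w \<preceq> v" "ok v E' xs" "i < length xs" "j < length xs" for v xs i j
    using that(2) by (subst sat_fun_class[where K = C])
      (use that in \<open>auto simp: p le_trans nth_append\<close>)
  have "ok w E' []" using ps by (simp add: E'_def ok_env)
  then have "sat w E' [] (W_dependent_choice p q)"
    by (intro axiom_sat) (auto simp: RDC_W_def)
  note * = sat_allD[OF sat_allD[OF sat_allD[OF sat_allD[OF sat_allD[OF this[unfolded
    W_dependent_choice_def]
    D(2)] D(3)] D(1)] D(4)] D(5), simplified append.simps list.size add_Suc_right add_0_right]
  have "sat w E' ?xs (is_base_map (Suc (Suc 0)) 0 (Suc 0))" using ok f by simp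
  note * = sat_impD[OF * this]
  have "sat w E' ?xs (is_W_type (Suc (Suc 0)) (Suc 0) (Suc (Suc (Suc 0))) (Suc (Suc (Suc (Suc
    0)))))" using ok W by simp
  note * = sat_impD[OF * this]
  have "sat w E' ?xs (all (\<lambda>a. all (\<lambda>k. imp (mem a (Suc 0)) (imp (is_fibre k (Suc (Suc 0)) a)
      (all (\<lambda>t. all (\<lambda>x. imp (inst q [a, t, x])
        (conj (is_fun_class t k (\<lambda>y. inst p [y])) (inst p [x])))))))))"
    unfolding sat_all_imp2
  proof (intro conjI allI impI)
    show "ok w E' ?xs" by (rule ok) (rule le_refl)
    fix v a k assume v: "w \<preceq> v" and "sat v E' (?xs @ [a, k]) (mem (length ?xs) (Suc 0))"
    then have a: "M v a A" and "ok v E' (?xs @ [a, k])" by (simp_all add: numeral_eq_Suc)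
    then show "sat v E' (?xs @ [a, k]) (imp (is_fibre (Suc (length ?xs)) (Suc (Suc 0)) (length ?xs))
      (all (\<lambda>t. all (\<lambda>x. imp (inst q [length ?xs, t, x])
        (conj (is_fun_class t (Suc (length ?xs)) (\<lambda>y. inst p [y])) (inst p [x]))))))"
      unfolding sat_imp sat_all_imp2
    proof (intro conjI allI impI)
      fix v1 v2 t x assume v12: "v \<preceq> v1" "v1 \<preceq> v2"
        and "sat v1 E' (?xs @ [a, k]) (is_fibre (Suc (length ?xs)) (Suc (Suc 0)) (length ?xs))"
        and qq: "sat v2 E' ((?xs @ [a, k]) @ [t, x]) (inst q [length ?xs, length (?xs @ [a, k]), Suc
          (length (?xs @ [a, k]))])"
      then have "Fibre v1 k f a" by simp
      then have k: "Fibre v2 k f a" using v12 by (auto simp: Fibre_def intro: D_up le_trans)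
      have wv: "w \<preceq> v2" using v v12 by (blast intro: le_trans)
      have "Q v2 a t x" using qq q[OF wv sat_ok[OF qq]] by simp
      from QC[OF wv _ k this] M_up[OF a] v12 have "FunC v2 t k C" "C v2 x"
        by (blast intro: le_trans)+
      then show "sat v2 E' ((?xs @ [a, k]) @ [t, x])
          (conj (is_fun_class (length (?xs @ [a, k])) (Suc (length ?xs)) (\<lambda>y. inst p [y])) (inst p
            [Suc (length (?xs @ [a, k]))]))"
        using fc[OF wv sat_ok[OF qq]] p[OF wv sat_ok[OF qq]] by simp
    qed (auto dest: ok_up)
  qed
  note * = sat_impD[OF * this]
  have "sat w E' ?xs (all (\<lambda>a. all (\<lambda>k. imp (mem a (Suc 0)) (imp (is_fibre k (Suc (Suc 0)) a)
      (all (\<lambda>t. imp (is_fun_class t k (\<lambda>y. inst p [y])) (ex (\<lambda>x. conj (inst p [x]) (inst q [a, t,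
        x])))))))))"
    unfolding sat_all_imp2
  proof (intro conjI allI impI)
    show "ok w E' ?xs" by (rule ok) (rule le_refl)
    fix v a k assume v: "w \<preceq> v" and "sat v E' (?xs @ [a, k]) (mem (length ?xs) (Suc 0))"
    then have a: "M v a A" and "ok v E' (?xs @ [a, k])" by (simp_all add: numeral_eq_Suc)
    then show "sat v E' (?xs @ [a, k]) (imp (is_fibre (Suc (length ?xs)) (Suc (Suc 0)) (length ?xs))
      (all (\<lambda>t. imp (is_fun_class t (Suc (length ?xs)) (\<lambda>y. inst p [y])) (ex (\<lambda>x. conj (inst p [x])
        (inst q [length ?xs, t, x]))))))"
      unfolding sat_imp sat_all_imp
    proof (intro conjI allI impI)
      fix v1 v2 t assume v12: "v \<preceq> v1" "v1 \<preceq> v2"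
        and "sat v1 E' (?xs @ [a, k]) (is_fibre (Suc (length ?xs)) (Suc (Suc 0)) (length ?xs))"
        and tt: "sat v2 E' ((?xs @ [a, k]) @ [t]) (is_fun_class (length (?xs @ [a, k])) (Suc (length
          ?xs)) (\<lambda>y. inst p [y]))"
      then have "Fibre v1 k f a" by simp
      then have k: "Fibre v2 k f a" using v12 by (auto simp: Fibre_def intro: D_up le_trans)
      have wv: "w \<preceq> v2" using v v12 by (blast intro: le_trans)
      have aA: "M v2 a A" using M_up[OF a] v12 by (blast intro: le_trans)
      have t: "FunC v2 t k C" using tt fc[OF wv sat_ok[OF tt]] by simp
      from tot[OF wv aA k t] obtain x where x: "D v2 x" "Q v2 a t x" by blast
      have okx: "ok v2 E' ((?xs @ [a, k, t]) @ [x])" using sat_ok[OF tt] x(1) by (simp add: ok_Cons)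
      \<comment> \<open>Levels 0 to 4 are \<open>B\<close>, \<open>A\<close>, \<open>f\<close>,
        \<open>W\<close>, \<open>s\<close>; levels 5 to 8 are \<open>a\<close>, \<open>k\<close>,
        \<open>t\<close>, \<open>x\<close>.\<close>
      show "sat v2 E' ((?xs @ [a, k]) @ [t]) (ex (\<lambda>x. conj (inst p [x]) (inst q [length ?xs, length
        (?xs @ [a, k]), x])))"
        unfolding sat_ex using okx x QC[OF wv aA k x(2)] p[OF wv okx, of 8] q[OF wv okx, of 5 7 8]
        by (intro exI[of _ x]) (simp add: numeral_eq_Suc)
    qed (auto dest: ok_up)
  qed
  from sat_impD[OF * this] obtain h where h: "D w h"
    "sat w E' (?xs @ [h]) (is_fun_class (length ?xs) (Suc (Suc (Suc 0))) (\<lambda>y. inst p [y]))"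
    "sat w E' (?xs @ [h]) (all (\<lambda>a. all (\<lambda>t. all (\<lambda>y. imp (alg_val (Suc (Suc (Suc (Suc 0)))) a t y)
      (ex (\<lambda>u. ex (\<lambda>x. conj (is_comp u (length ?xs) t) (conj (related (length ?xs) y x) (inst q [a,
        u, x])))))))))"
    by (auto elim!: sat_exE)
  have "FunC w h W C" using h(2) fc[OF le_refl sat_ok[OF h(2)]] by (simp add: nth_append)
  moreover have "\<exists>u x. Comp v u h t \<and> Rel v h y x \<and> Q v a u x" if v: "w \<preceq> v" and y:
    "AlgVal v s a t y" for v a t y
  proof -
    have "ok v E' ((?xs @ [h]) @ [a, t, y])"
      using ok[OF v] D_up[OF h(1) v] AlgVal_D[OF y] by (simp add: ok_Cons)
    moreover have "sat v E' ((?xs @ [h]) @ [a, t, y]) (alg_val (Suc (Suc (Suc (Suc 0)))) (length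
      (?xs @ [h])) (Suc (length (?xs @ [h]))) (Suc (Suc (length (?xs @ [h])))))"
      using y calculation by (simp add: nth_append)
    ultimately have "sat v E' ((?xs @ [h]) @ [a, t, y]) (ex (\<lambda>u. ex (\<lambda>x. conj (is_comp u (length
      ?xs) (Suc (length (?xs @ [h])))) (conj (related (length ?xs) (Suc (Suc (length (?xs @ [h]))))
        x) (inst q [length (?xs @ [h]), u, x])))))"
      using h(3) v unfolding sat_all_imp3 by blast
    \<comment> \<open>Level 5 is now \<open>h\<close>, and levels 6 to 10 are \<open>a\<close>,
      \<open>t\<close>, \<open>y\<close>, \<open>u\<close>, \<open>x\<close>.\<close>
    then obtain u x where "sat v E' ((?xs @ [h, a, t, y]) @ [u, x]) (conj (is_comp 9 5 7) (conj
      (related 5 8 10) (inst q [6, 9, 10])))"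
      by (auto elim!: sat_exE simp: numeral_eq_Suc)
    then show ?thesis
      using q[OF v sat_ok, of "(?xs @ [h, a, t, y]) @ [u, x]" _ 6 9 10]
        by (auto simp: numeral_eq_Suc)
  qed
  ultimately show ?thesis by blast
qed

end

subsection \<open>Pairs, functions and bases\<close>

context kripke
begin

lemma Sub_up: "Sub w a b \<Longrightarrow> w \<preceq> v \<Longrightarrow> Sub v a b"
  by (auto simp: Sub_def intro: D_up le_trans)

lemma UPair_up: "UPair w u x y \<Longrightarrow> w \<preceq> v \<Longrightarrow> UPair v u x y"
  by (auto simp: UPair_def intro: D_up le_trans)

lemma Pair_up: "Pair w p x y \<Longrightarrow> w \<preceq> v \<Longrightarrow> Pair v p x y"
  by (auto simp: Pair_def intro: D_up le_trans)

lemma Rel_up: "Rel w r x y \<Longrightarrow> w \<preceq> v \<Longrightarrow> Rel v r x y"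
  by (auto simp: Rel_def intro: M_up Pair_up)

lemma FunC_up: "FunC w f a C \<Longrightarrow> w \<preceq> v \<Longrightarrow> FunC v f a C"
  unfolding FunC_def by (meson D_up le_trans)

lemma Fun_up: "Fun w f a b \<Longrightarrow> w \<preceq> v \<Longrightarrow> Fun v f a b"
  by (auto simp: Fun_def intro: D_up FunC_up)

lemma Surj_up: "Surj w f a b \<Longrightarrow> w \<preceq> v \<Longrightarrow> Surj v f a b"
  unfolding Surj_def by (meson Fun_up le_trans)

lemma Comp_up: "Comp w u h t \<Longrightarrow> w \<preceq> v \<Longrightarrow> Comp v u h t"
  unfolding Comp_def by (meson D_up le_trans)

lemma Base_up: "Base w b \<Longrightarrow> w \<preceq> v \<Longrightarrow> Base v b"
  unfolding Base_def by (meson D_up le_trans)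

lemma BaseMap_up: "BaseMap w f B A \<Longrightarrow> w \<preceq> v \<Longrightarrow> BaseMap v f B A"
  unfolding BaseMap_def by (meson Fun_up Base_up le_trans)

lemma Poly_up: "Poly w P f A X \<Longrightarrow> w \<preceq> v \<Longrightarrow> Poly v P f A X"
  unfolding Poly_def by (meson D_up le_trans)

lemma Alg_up: "Alg w f A X m \<Longrightarrow> w \<preceq> v \<Longrightarrow> Alg v f A X m"
  unfolding Alg_def by (meson D_up Poly_up Fun_up)

lemma WType_up: "WType w f A W s \<Longrightarrow> w \<preceq> v \<Longrightarrow> WType v f A W s"
  unfolding WType_def by (meson Alg_up le_trans)

lemma RuleSet_up: "RuleSet w R X \<Longrightarrow> w \<preceq> v \<Longrightarrow> RuleSet v R X"
  unfolding RuleSet_def by (meson D_up le_trans)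

lemma Closed_up: "Closed w Y R \<Longrightarrow> w \<preceq> v \<Longrightarrow> Closed v Y R"
  unfolding Closed_def by (meson D_up le_trans)

lemma UPair_cong: "UPair w u x y \<Longrightarrow> E w u u' \<Longrightarrow> E w x x' \<Longrightarrow> E w y y' \<Longrightarrow> UPair w u' x' y'"
  using sat_cong[of w "\<lambda>_. u" "[u, x, y]" "is_upair 0 1 2" "[u', x', y']"]
  by (simp add: ok_def UPair_D E_D1)

lemma Pair_cong: "Pair w p x y \<Longrightarrow> E w p p' \<Longrightarrow> E w x x' \<Longrightarrow> E w y y' \<Longrightarrow> Pair w p' x' y'"
  using sat_cong[of w "\<lambda>_. p" "[p, x, y]" "is_pair 0 1 2" "[p', x', y']"]
  by (simp add: ok_def Pair_D E_D1)

lemma Rel_cong: "Rel w r x y \<Longrightarrow> E w x x' \<Longrightarrow> E w y y' \<Longrightarrow> Rel w r x' y'"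
  using sat_cong[of w "\<lambda>_. r" "[r, x, y]" "related 0 1 2" "[r, x', y']"] E_refl[of w r]
  by (simp add: ok_def Rel_D E_D1)

lemma Pair_congP: "Pair w p x y \<Longrightarrow> E w p p' \<Longrightarrow> Pair w p' x y"
  by (rule Pair_cong) (auto intro: E_refl Pair_D)

lemma Rel_congL: "Rel w r x y \<Longrightarrow> E w x x' \<Longrightarrow> Rel w r x' y"
  by (rule Rel_cong) (auto intro: E_refl Rel_D)

lemma Rel_congR: "Rel w r x y \<Longrightarrow> E w y y' \<Longrightarrow> Rel w r x y'"
  by (rule Rel_cong) (auto intro: E_refl Rel_D)

lemma Base_cong: "Base w b \<Longrightarrow> E w b b' \<Longrightarrow> Base w b'"
  using sat_cong[of w "\<lambda>_. b" "[b]" "is_base 0" "[b']"]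
  by (simp add: ok_def Base_D E_D1)

lemma Surj_cong: "Surj w g k a \<Longrightarrow> E w k k' \<Longrightarrow> E w a a' \<Longrightarrow> Surj w g k' a'"
  using sat_cong[of w "\<lambda>_. k" "[g, k, a]" "is_surj 0 1 2" "[g, k', a']"] E_refl[of w g]
  by (simp add: ok_def Surj_D E_D1)

text \<open>Definability makes a relation extensional. This matters because the components of a pair
  are determined only up to \<open>E\<close>.\<close>

lemma class_rel_cong:
  assumes "class_rel w \<Phi>" "w \<preceq> v" "E v x x'" "E v y y'" "\<Phi> v x y"
  shows "\<Phi> v x' y'"
proof -
  obtain F ps e where ps: "ok w e ps"
    and F: "\<And>v x y. w \<preceq> v \<Longrightarrow> D v x \<Longrightarrow> D v y \<Longrightarrow> \<Phi> v x y \<longleftrightarrow> sat v e (ps @ [y, x]) F"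
    using assms(1) unfolding class_rel_def by blast
  have "sat v e (ps @ [y, x]) F" using F[OF assms(2)] E_D1 assms(3-5) by blast
  moreover have "list_all2 (E v) ps ps"
    using ok_up[OF ps assms(2)] by (auto simp: list_all2_same ok_def intro: E_refl)
  ultimately have "sat v e (ps @ [y', x']) F"
    using sat_cong[of v e "ps @ [y, x]" F "ps @ [y', x']"] assms(3,4)
    by (simp add: list_all2_append)
  then show ?thesis using F[OF assms(2)] E_D2 assms(3,4) by blast
qed

end

context czf
begin

lemma UPair_iff: "UPair w u x y \<Longrightarrow> M w z u \<longleftrightarrow> E w z x \<or> E w z y"
  by (auto simp: UPair_def)

lemma UPair_unique: "UPair w u x y \<Longrightarrow> UPair w u' x y \<Longrightarrow> E w u u'"
  by (rule extensionality) (auto simp: UPair_def)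

lemma Pair_iff: "Pair w p x y \<Longrightarrow> M w u p \<longleftrightarrow> UPair w u x x \<or> UPair w u x y"
  by (auto simp: Pair_def)

lemma Pair_unique: "Pair w p x y \<Longrightarrow> Pair w p' x y \<Longrightarrow> E w p p'"
  by (rule extensionality) (auto simp: Pair_def)

lemma Pair_inj:
  assumes "Pair w p x y" "Pair w p x' y'"
  shows "E w x x' \<and> E w y y'"
proof -
  note D = Pair_D(2,3)[OF assms(1)] Pair_D(2,3)[OF assms(2)]
  note refl = D[THEN E_refl]
  obtain u1 where u1: "UPair w u1 x x" using D(1,1) by (rule pairing)
  obtain u2 where u2: "UPair w u2 x y" using D(1,2) by (rule pairing)
  obtain v2 where v2: "UPair w v2 x' y'" using D(3,4) by (rule pairing)
  have "UPair w u1 x' x' \<or> UPair w u1 x' y'"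
    using u1 Pair_iff[OF assms(1)] Pair_iff[OF assms(2)] by blast
  then have "M w x' u1" using UPair_iff refl by blast
  then have x: "E w x' x" using UPair_iff[OF u1] by blast
  have "UPair w u2 x' x' \<or> UPair w u2 x' y'"
    using u2 Pair_iff[OF assms(1)] Pair_iff[OF assms(2)] by blast
  moreover have "M w y u2" using UPair_iff[OF u2] refl by blast
  ultimately have y: "E w y x' \<or> E w y y'" using UPair_iff by blast
  have "UPair w v2 x x \<or> UPair w v2 x y"
    using v2 Pair_iff[OF assms(1)] Pair_iff[OF assms(2)] by blast
  moreover have "M w y' v2" using UPair_iff[OF v2] refl by blast
  ultimately have "E w y' x \<or> E w y' y" using UPair_iff by blast
  with x y show ?thesis by (blast intro: E_sym E_trans)
qed

lemma pair_exists:
  assumes "D w x" "D w y"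
  obtains p where "Pair w p x y"
proof -
  obtain u1 where u1: "UPair w u1 x x" using assms(1,1) by (rule pairing)
  obtain u2 where u2: "UPair w u2 x y" using assms by (rule pairing)
  obtain p where p: "UPair w p u1 u2" using UPair_D(1)[OF u1] UPair_D(1)[OF u2] by (rule pairing)
  have "M v u p \<longleftrightarrow> UPair v u x x \<or> UPair v u x y" if v: "w \<preceq> v" for v u
  proof -
    note u = UPair_up[OF u1 v] UPair_up[OF u2 v]
    have "E v u c \<longleftrightarrow> UPair v u a b" if "UPair v c a b" for a b c
      using that UPair_unique UPair_cong[OF that E_sym] E_refl UPair_D[OF that] by blast
    with u show ?thesis using UPair_iff[OF UPair_up[OF p v]] by blast
  qed
  then have "Pair w p x y" using assms UPair_D(1)[OF p] by (simp add: Pair_def)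
  then show thesis by (rule that)
qed

lemma M_congL: "M w x y \<Longrightarrow> E w x x' \<Longrightarrow> M w x' y"
  using M_cong E_refl M_D2 by blast

lemma M_congR: "M w x y \<Longrightarrow> E w y y' \<Longrightarrow> M w x y'"
  using M_cong E_refl M_D1 by blast

lemma FunC_mem: "FunC w f a C \<Longrightarrow> M w p f \<Longrightarrow> \<exists>x y. M w x a \<and> C w y \<and> Pair w p x y"
  unfolding FunC_def using le_refl M_D1 by blast

lemma FunC_dom:
  assumes "FunC w f a C" "Rel w f x y"
  shows "M w x a"
proof -
  obtain p where p: "M w p f" "Pair w p x y" using assms(2) by (auto simp: Rel_def)
  from FunC_mem[OF assms(1) p(1)] obtain x' y' where "M w x' a" "Pair w p x' y'" by blast
  with Pair_inj[OF p(2)] show ?thesis using M_congL E_sym by blast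
qed

lemma FunC_ran:
  assumes "FunC w f a C" "Rel w f x y" "\<And>y y'. C w y \<Longrightarrow> E w y y' \<Longrightarrow> C w y'"
  shows "C w y"
proof -
  obtain p where p: "M w p f" "Pair w p x y" using assms(2) by (auto simp: Rel_def)
  from FunC_mem[OF assms(1) p(1)] obtain x' y' where "C w y'" "Pair w p x' y'" by blast
  with Pair_inj[OF p(2)] show ?thesis using assms(3) E_sym by blast
qed

lemma FunC_total: "FunC w f a C \<Longrightarrow> M w x a \<Longrightarrow> \<exists>y. Rel w f x y"
  unfolding FunC_def using le_refl M_D1 by blast

lemma FunC_unique:
  assumes "FunC w f a C" "Rel w f x y" "Rel w f x z"
  shows "E w y z"
proof -
  have "M w x a" using assms(1,2) by (rule FunC_dom)
  then obtain y' where "\<And>z. Rel w f x z \<Longrightarrow> E w z y'"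
    using assms(1) unfolding FunC_def using le_refl M_D1 Rel_D(3) by meson
  with assms(2,3) show ?thesis using E_sym E_trans by blast
qed

lemma FunCI:
  assumes "D w f" "D w a"
    "\<And>v p. w \<preceq> v \<Longrightarrow> M v p f \<Longrightarrow> \<exists>x y. M v x a \<and> C v y \<and> Pair v p x y"
    "\<And>v x. w \<preceq> v \<Longrightarrow> M v x a \<Longrightarrow> \<exists>y. Rel v f x y"
    "\<And>v x y z. w \<preceq> v \<Longrightarrow> Rel v f x y \<Longrightarrow> Rel v f x z \<Longrightarrow> E v y z"
  shows "FunC w f a C"
  unfolding FunC_def
proof (intro conjI allI impI)
  fix v p assume "w \<preceq> v" "M v p f"
  from assms(3)[OF this] show "\<exists>x. D v x \<and> (\<exists>y. D v y \<and> M v x a \<and> C v y \<and> Pair v p x y)"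
    using Pair_D by blast
next
  fix v x assume v: "w \<preceq> v" "M v x a"
  from assms(4)[OF this] obtain y where y: "Rel v f x y" by blast
  have "E u z y" if "v \<preceq> u" "Rel u f x z" for u z
    using assms(5)[OF le_trans[OF v(1) that(1)] that(2) Rel_up[OF y that(1)]] .
  with y show "\<exists>y. D v y \<and> Rel v f x y \<and> (\<forall>u z. v \<preceq> u \<longrightarrow> D u z \<longrightarrow> Rel u f x z \<longrightarrow> E u z y)"
    using Rel_D(3) by blast
qed (use assms in auto)

lemma FunC_mono:
  assumes "FunC w f a C" "\<And>v y. w \<preceq> v \<Longrightarrow> D v y \<Longrightarrow> C v y \<Longrightarrow> C' v y"
  shows "FunC w f a C'"
  using assms unfolding FunC_def by meson

lemma Fun_FunC: "Fun w f a b \<Longrightarrow> FunC w f a (\<lambda>v y. M v y b)"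
  by (simp add: Fun_def)

lemma Fun_dom: "Fun w f a b \<Longrightarrow> Rel w f x y \<Longrightarrow> M w x a"
  unfolding Fun_def using FunC_dom by blast

lemma Fun_ran: "Fun w f a b \<Longrightarrow> Rel w f x y \<Longrightarrow> M w y b"
  unfolding Fun_def using FunC_ran[of w f a "\<lambda>v y. M v y b"] M_congL by blast

lemma Fun_total: "Fun w f a b \<Longrightarrow> M w x a \<Longrightarrow> \<exists>y. Rel w f x y"
  unfolding Fun_def using FunC_total by blast

lemma Fun_unique: "Fun w f a b \<Longrightarrow> Rel w f x y \<Longrightarrow> Rel w f x z \<Longrightarrow> E w y z"
  unfolding Fun_def using FunC_unique by blast

lemma Surj_Fun: "Surj w g a b \<Longrightarrow> Fun w g a b"
  by (simp add: Surj_def)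

lemma Surj_onto: "Surj w g a b \<Longrightarrow> M w y b \<Longrightarrow> \<exists>x. M w x a \<and> Rel w g x y"
  unfolding Surj_def using le_refl M_D1 by blast

lemma Base_section:
  assumes "Base w b" "Surj w g c b"
  obtains s where "Fun w s b c" "\<And>u x y. w \<preceq> u \<Longrightarrow> Rel u s x y \<Longrightarrow> Rel u g y x"
proof -
  have "D w c" "D w g" using Surj_D[OF assms(2)] by auto
  with assms obtain s where "Fun w s b c" "\<forall>u x y. w \<preceq> u \<longrightarrow> D u x \<longrightarrow> D u y \<longrightarrow> Rel u s x y \<longrightarrow>
    Rel u g y x"
    unfolding Base_def using le_refl by blast
  then show thesis using that Rel_D by blast
qed

lemma BaseI:
  assumes "D w b"
    "\<And>v c g. w \<preceq> v \<Longrightarrow> Surj v g c b \<Longrightarrow> \<exists>s. Fun v s b c \<and> (\<forall>u x y. v \<preceq> u \<longrightarrow> Rel u s x y \<longrightarrow> Rel u g y x)"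
  shows "Base w b"
  unfolding Base_def using assms Fun_D by meson

text \<open>Strong collection is applied to pairs rather than to values, so that it remembers which
  \<open>y\<close> belongs to which \<open>x\<close>. The result is a total, set-sized part of
  \<open>\<Phi>\<close>, possibly multivalued.\<close>

lemma graph:
  assumes a: "D w a" and \<Phi>: "class_rel w \<Phi>"
    and tot: "total w a \<Phi>"
  shows "\<exists>f. D w f \<and>
    (\<forall>v p. w \<preceq> v \<longrightarrow> M v p f \<longrightarrow> (\<exists>x y. M v x a \<and> \<Phi> v x y \<and> Pair v p x y)) \<and>
    (\<forall>v x y. w \<preceq> v \<longrightarrow> Rel v f x y \<longrightarrow> M v x a \<and> \<Phi> v x y) \<and>
    (\<forall>v x. w \<preceq> v \<longrightarrow> M v x a \<longrightarrow> (\<exists>y. Rel v f x y))"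
proof -
  obtain F ps e where F: "ok w e ps"
    "\<And>v x y. w \<preceq> v \<Longrightarrow> D v x \<Longrightarrow> D v y \<Longrightarrow> \<Phi> v x y \<longleftrightarrow> sat v e (ps @ [y, x]) F"
    using \<Phi> unfolding class_rel_def by blast
  define \<Psi> where "\<Psi> = (\<lambda>v x p. \<exists>y. Pair v p x y \<and> \<Phi> v x y)"
  let ?p = "F (length ps + length [Suc 0, 2])"
  have "\<Psi> v x p \<longleftrightarrow> sat v (env e ps) ([] @ [p, x]) (ex (\<lambda>y. conj (is_pair 0 (Suc 0) y) (inst ?p [Suc
    0, y])))"
    if v: "w \<preceq> v" and D: "D v x" "D v p" for v x p
  proof -
    have "sat v (env e ps) [p, x, y] (inst ?p [Suc 0, 2]) \<longleftrightarrow> \<Phi> v x y" if "D v y" for y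
      using F(2)[OF v D(1) that] ok_up[OF F(1) v] D that
      by (subst sat_inst) (auto simp: ok_Cons ok_env)
    then show ?thesis
      using ok_up[OF F(1) v] D
      by (auto simp: \<Psi>_def sat_ex' ok_Cons ok_env numeral_2_eq_2 dest: Pair_D)
  qed
  then have d: "class_rel w \<Psi>" unfolding class_rel_def
    using F(1) by (intro exI[of _ "ex (\<lambda>y. conj (is_pair 0 (Suc 0) y) (inst ?p [Suc 0, y]))"]
      exI[of _ "[]"] exI[of _ "env e ps"]) (simp add: ok_env)
  have t: "total w a \<Psi>"
  proof (rule totalI)
    fix v x assume v: "w \<preceq> v" "M v x a"
    obtain y where y: "D v y" "\<Phi> v x y" using totalD[OF tot v] by blast
    obtain p where "Pair v p x y" using M_D1[OF v(2)] y(1) by (rule pair_exists)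
    with y show "\<exists>p. D v p \<and> \<Psi> v x p" unfolding \<Psi>_def using Pair_D by blast
  qed
  obtain f where f: "D w f"
    "\<And>v x. w \<preceq> v \<Longrightarrow> M v x a \<Longrightarrow> \<exists>y. M v y f \<and> \<Psi> v x y"
    "\<And>v y. w \<preceq> v \<Longrightarrow> M v y f \<Longrightarrow> \<exists>x. M v x a \<and> \<Psi> v x y"
    using collection[OF a d t] by blast
  show ?thesis
  proof (rule exI[of _ f], intro conjI allI impI)
    show "D w f" by (rule f(1))
    have *: "\<exists>x y. M v x a \<and> \<Phi> v x y \<and> Pair v p x y" if "w \<preceq> v" "M v p f" for v p
      using f(3)[OF that] unfolding \<Psi>_def by blast
    show "\<exists>x y. M v x a \<and> \<Phi> v x y \<and> Pair v p x y" if "w \<preceq> v" "M v p f" for v p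
      using *[OF that] .
    have **: "M v x a \<and> \<Phi> v x y" if v: "w \<preceq> v" "Rel v f x y" for v x y
    proof -
      obtain p where p: "M v p f" "Pair v p x y" using v(2) by (auto simp: Rel_def)
      obtain x' y' where xy: "M v x' a" "\<Phi> v x' y'" "Pair v p x' y'" using *[OF v(1) p(1)] by blast
      have E: "E v x' x" "E v y' y" using Pair_inj[OF xy(3) p(2)] by auto
      show ?thesis using M_congL[OF xy(1) E(1)] class_rel_cong[OF \<Phi> v(1) E xy(2)] ..
    qed
    show "M v x a" "\<Phi> v x y" if "w \<preceq> v" "Rel v f x y" for v x y
      using **[OF that] by blast+
    show "\<exists>y. Rel v f x y" if v: "w \<preceq> v" "M v x a" for v x
      using f(2)[OF v] unfolding \<Psi>_def Rel_def by blast
  qed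
qed

definition functional :: "'w \<Rightarrow> ('w \<Rightarrow> 'd \<Rightarrow> 'd \<Rightarrow> bool) \<Rightarrow> bool" where
  "functional w \<Phi> \<longleftrightarrow> (\<forall>v x y z. w \<preceq> v \<longrightarrow> \<Phi> v x y \<longrightarrow> \<Phi> v x z \<longrightarrow> E v y z)"

lemma functionalI:
  "(\<And>v x y z. w \<preceq> v \<Longrightarrow> \<Phi> v x y \<Longrightarrow> \<Phi> v x z \<Longrightarrow> E v y z) \<Longrightarrow> functional w \<Phi>"
  by (simp add: functional_def)

lemma functionalD: "functional w \<Phi> \<Longrightarrow> w \<preceq> v \<Longrightarrow> \<Phi> v x y \<Longrightarrow> \<Phi> v x z \<Longrightarrow> E v y z"
  by (simp add: functional_def)

lemma function_exists:
  assumes a: "D w a" and \<Phi>: "class_rel w \<Phi>"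
    and tot: "total w a \<Phi>"
    and func: "functional w \<Phi>"
  obtains f where "FunC w f a (\<lambda>v y. \<exists>x. M v x a \<and> \<Phi> v x y)"
    "\<And>v x y. w \<preceq> v \<Longrightarrow> M v x a \<Longrightarrow> D v y \<Longrightarrow> Rel v f x y \<longleftrightarrow> \<Phi> v x y"
proof -
  obtain f where f: "D w f"
    "\<And>v p. w \<preceq> v \<Longrightarrow> M v p f \<Longrightarrow> \<exists>x y. M v x a \<and> \<Phi> v x y \<and> Pair v p x y"
    "\<And>v x y. w \<preceq> v \<Longrightarrow> Rel v f x y \<Longrightarrow> M v x a \<and> \<Phi> v x y"
    "\<And>v x. w \<preceq> v \<Longrightarrow> M v x a \<Longrightarrow> \<exists>y. Rel v f x y"
    using graph[OF a \<Phi> tot] by blast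
  have "FunC w f a (\<lambda>v y. \<exists>x. M v x a \<and> \<Phi> v x y)"
  proof (rule FunCI[OF f(1) a])
    show "\<exists>x y. M v x a \<and> (\<exists>x. M v x a \<and> \<Phi> v x y) \<and> Pair v p x y" if "w \<preceq> v" "M v p f" for v p
      using f(2)[OF that] by blast
    show "\<exists>y. Rel v f x y" if "w \<preceq> v" "M v x a" for v x using f(4)[OF that] .
    show "E v y z" if "w \<preceq> v" "Rel v f x y" "Rel v f x z" for v x y z
      using functionalD[OF func that(1)] f(3)[OF that(1)] that(2,3) by blast
  qed
  moreover have "Rel v f x y \<longleftrightarrow> \<Phi> v x y" if v: "w \<preceq> v" "M v x a" "D v y" for v x y
  proof
    assume "Rel v f x y"
    with f(3)[OF v(1)] show "\<Phi> v x y" by blast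
  next
    assume xy: "\<Phi> v x y"
    obtain z where z: "Rel v f x z" using f(4)[OF v(1,2)] by blast
    with f(3)[OF v(1)] have "\<Phi> v x z" by blast
    with functionalD[OF func v(1)] xy have "E v z y" by blast
    with z show "Rel v f x y" using Rel_congR by blast
  qed
  ultimately show thesis by (rule that)
qed

lemma range_exists:
  assumes f: "FunC w f a C"
  obtains r where "D w r" "\<And>v y. w \<preceq> v \<Longrightarrow> M v y r \<longleftrightarrow> (\<exists>x. Rel v f x y)"
proof -
  have D: "D w f" "D w a" using f by (auto simp: FunC_def)
  have d: "class_rel w (\<lambda>v x y. Rel v f x y)"
    by (rule class_relI[of f "[]" w _ "related 0 2 1"]) (use D in \<open>auto simp: ok_def\<close>)
  have t: "total w a (\<lambda>v x y. Rel v f x y)"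
    by (rule totalI) (use FunC_total[OF FunC_up[OF f]] Rel_D in blast)
  obtain r where r: "D w r"
    "\<And>v x. w \<preceq> v \<Longrightarrow> M v x a \<Longrightarrow> \<exists>y. M v y r \<and> Rel v f x y"
    "\<And>v y. w \<preceq> v \<Longrightarrow> M v y r \<Longrightarrow> \<exists>x. M v x a \<and> Rel v f x y"
    using collection[OF D(2) d t] by blast
  have "M v y r \<longleftrightarrow> (\<exists>x. Rel v f x y)" if v: "w \<preceq> v" for v y
  proof
    assume "\<exists>x. Rel v f x y"
    then obtain x where x: "Rel v f x y" by blast
    note fv = FunC_up[OF f v]
    obtain y' where "M v y' r" "Rel v f x y'" using r(2)[OF v FunC_dom[OF fv x]] by blast
    then show "M v y r" using FunC_unique[OF fv _ x] M_congL by blast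
  qed (use r(3)[OF v] in blast)
  with r(1) show thesis by (rule that)
qed

text \<open>Over a base, total relations have choice functions. Pairs of the relation, collected
  into \<open>Z\<close>, project onto \<open>A\<close>; a section of the projection picks one pair
  over each element, and the range of the section is already the graph of the choice
  function.\<close>

lemma base_choice:
  assumes A: "Base w A" and \<Phi>: "class_rel w \<Phi>" and tot: "total w A \<Phi>"
  shows "\<exists>f. FunC w f A D \<and> (\<forall>v x y. w \<preceq> v \<longrightarrow> Rel v f x y \<longrightarrow> \<Phi> v x y)"
proof -
  obtain Z where Z: "D w Z"
    "\<And>v p. w \<preceq> v \<Longrightarrow> M v p Z \<Longrightarrow> \<exists>x y. M v x A \<and> \<Phi> v x y \<and> Pair v p x y"
    "\<And>v x y. w \<preceq> v \<Longrightarrow> Rel v Z x y \<Longrightarrow> M v x A \<and> \<Phi> v x y"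
    "\<And>v x. w \<preceq> v \<Longrightarrow> M v x A \<Longrightarrow> \<exists>y. Rel v Z x y"
    using graph[OF Base_D[OF A] \<Phi> tot] by blast
  define \<Psi> where "\<Psi> = (\<lambda>v z x. \<exists>y. Pair v z x y)"
  have d: "class_rel w \<Psi>" unfolding \<Psi>_def
    by (rule class_relI[of Z "[]" w _ "ex (\<lambda>y. is_pair 2 1 y)"])
      (use Z(1) in \<open>auto simp: sat_ex' ok_Cons ok_const numeral_eq_Suc dest: Pair_D\<close>)
  have t: "total w Z \<Psi>"
  proof (rule totalI)
    fix v z assume "w \<preceq> v" "M v z Z"
    from Z(2)[OF this] show "\<exists>x. D v x \<and> \<Psi> v z x" unfolding \<Psi>_def using Pair_D by blast
  qed
  have u0: "E v x x'" if "w \<preceq> v" "\<Psi> v z x" "\<Psi> v z x'" for v z x x'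
    using that Pair_inj unfolding \<Psi>_def by blast
  have u: "functional w \<Psi>" by (rule functionalI, rule u0)
  obtain g where g: "FunC w g Z (\<lambda>v y. \<exists>x. M v x Z \<and> \<Psi> v x y)"
    "\<And>v x y. w \<preceq> v \<Longrightarrow> M v x Z \<Longrightarrow> D v y \<Longrightarrow> Rel v g x y \<longleftrightarrow> \<Psi> v x y"
    using function_exists[OF Z(1) d t u] by blast
  have gD: "M v z Z \<and> \<Psi> v z x" if v: "w \<preceq> v" "Rel v g z x" for v z x
    using FunC_dom[OF FunC_up[OF g(1) v(1)] v(2)] g(2)[OF v(1)] v(2) Rel_D(3) by blast
  have "Surj w g Z A"
    unfolding Surj_def Fun_def
  proof (intro conjI allI impI)
    show "D w A" using A by (rule Base_D)
    show "FunC w g Z (\<lambda>v y. M v y A)"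
    proof (rule FunC_mono[OF g(1)])
      fix v y assume v: "w \<preceq> v" and "\<exists>x. M v x Z \<and> \<Psi> v x y"
      then obtain z y' where "M v z Z" "Pair v z y y'" unfolding \<Psi>_def by blast
      with Z(2)[OF v] show "M v y A" using Pair_inj M_congL by blast
    qed
    fix v y assume v: "w \<preceq> v" "M v y A"
    obtain y' where "Rel v Z y y'" using Z(4)[OF v] by blast
    then obtain z where z: "M v z Z" "Pair v z y y'" by (auto simp: Rel_def)
    then have "Rel v g z y" using g(2)[OF v(1) z(1) M_D1[OF v(2)]] unfolding \<Psi>_def by blast
    with z(1) show "\<exists>x. D v x \<and> M v x Z \<and> Rel v g x y" using M_D1 by blast
  qed
  from Base_section[OF A this] obtain s where s: "Fun w s A Z" "\<And>u x y. w \<preceq> u \<Longrightarrow> Rel u s x y \<Longrightarrow>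
    Rel u g y x"
    by blast
  obtain f where f: "D w f" "\<And>v y. w \<preceq> v \<Longrightarrow> M v y f \<longleftrightarrow> (\<exists>x. Rel v s x y)"
    using range_exists[OF Fun_FunC[OF s(1)]] by blast
  have fZ: "M v z Z" if "w \<preceq> v" "M v z f" for v z
    using that f(2) Fun_ran[OF Fun_up[OF s(1) that(1)]] by blast
  have fs: "Rel v s x z" if v: "w \<preceq> v" "M v z f" "Pair v z x y" for v x y z
  proof -
    obtain x' where x': "Rel v s x' z" using f(2)[OF v(1)] v(2) by blast
    then obtain y' where "Pair v z x' y'" using s(2)[OF v(1)] gD[OF v(1)] unfolding \<Psi>_def by blast
    then have "E v x' x" using Pair_inj v(3) by blast
    with x' show ?thesis using Rel_congL by blast
  qed
  have "FunC w f A D"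
  proof (rule FunCI[OF f(1) Base_D[OF A]])
    fix v p assume "w \<preceq> v" "M v p f"
    then show "\<exists>x y. M v x A \<and> D v y \<and> Pair v p x y"
      using fZ Z(2) Pair_D by blast
  next
    fix v x assume v: "w \<preceq> v" "M v x A"
    obtain z where z: "Rel v s x z" using Fun_total[OF Fun_up[OF s(1) v(1)] v(2)] by blast
    then obtain y where "Pair v z x y" using s(2)[OF v(1)] gD[OF v(1)] unfolding \<Psi>_def by blast
    moreover have "M v z f" using f(2)[OF v(1)] z by blast
    ultimately show "\<exists>y. Rel v f x y" unfolding Rel_def by blast
  next
    fix v x y y' assume v: "w \<preceq> v" "Rel v f x y" "Rel v f x y'"
    obtain z z' where z: "M v z f" "Pair v z x y" "M v z' f" "Pair v z' x y'"
      using v(2,3) unfolding Rel_def by blast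
    have "E v z z'"
      using Fun_unique[OF Fun_up[OF s(1) v(1)] fs[OF v(1) z(1,2)] fs[OF v(1) z(3,4)]] .
    then have "Pair v z' x y" using z(2) Pair_congP by blast
    with z(4) show "E v y y'" using Pair_inj by blast
  qed
  moreover have "\<Phi> v x y" if v: "w \<preceq> v" "Rel v f x y" for v x y
    using v fZ[OF v(1)] Z(3)[OF v(1)] unfolding Rel_def by blast
  ultimately show ?thesis by blast
qed

subsection \<open>The base map of a rule set\<close>

text \<open>Tagging the elements by \<open>r\<close> makes the fibres of the later base map disjoint.\<close>

lemma tagged_base:
  assumes K: "Base w K" "Surj w g K a" and r: "D w r"
  shows "\<exists>k q. Base w k \<and> Surj w q k a \<and> (\<forall>v p. w \<preceq> v \<longrightarrow> M v p k \<longrightarrow> (\<exists>z. Pair v p r z))"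
proof -
  have DK: "D w K" using K(1) by (rule Base_D)
  define \<Phi> where "\<Phi> = (\<lambda>v z p. Pair v p r z)"
  have d: "class_rel w \<Phi>" unfolding \<Phi>_def
    by (rule class_relI[of r "[]" w _ "is_pair 1 0 2"]) (use r in auto)
  have t: "total w K \<Phi>"
    unfolding \<Phi>_def by (rule totalI) (metis pair_exists Pair_D(1) D_up[OF r] M_D1)
  obtain k where k: "D w k"
    "\<And>v z. w \<preceq> v \<Longrightarrow> M v z K \<Longrightarrow> \<exists>p. M v p k \<and> Pair v p r z"
    "\<And>v p. w \<preceq> v \<Longrightarrow> M v p k \<Longrightarrow> \<exists>z. M v z K \<and> Pair v p r z"
    using collection[OF DK d t] unfolding \<Phi>_def by blast
  have kI: "M v p k" if "w \<preceq> v" "M v z K" "Pair v p r z" for v z p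
    using k(2)[OF that(1,2)] that(3) Pair_unique M_congL by blast
  have zK: "M v z K" if "w \<preceq> v" "M v p k" "Pair v p r z" for v z p
    using k(3)[OF that(1,2)] that(3) Pair_inj M_congL by blast
  \<comment> \<open>Any surjection from \<open>K\<close> becomes one from \<open>k\<close> by first
    removing the tag.\<close>
  have untag: "\<exists>q. Surj v q k b" if v: "w \<preceq> v" and g: "Surj v g K b" for v g b
  proof -
    define \<Psi> where "\<Psi> = (\<lambda>v p y. \<exists>z. Pair v p r z \<and> Rel v g z y)"
    note D = D_up[OF r v] D_up[OF k(1) v] Surj_D[OF g]
    have d: "class_rel v \<Psi>" unfolding \<Psi>_def
      by (rule class_relI[of r "[g]" v _ "ex (\<lambda>z. conj (is_pair 3 0 z) (related 1 z 2))"])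
        (use D in \<open>auto simp: sat_ex' ok_Cons ok_const numeral_eq_Suc dest: Pair_D\<close>)
    have t: "total v k \<Psi>"
    proof (rule totalI)
      fix u p assume u: "v \<preceq> u" "M u p k"
      obtain z where z: "M u z K" "Pair u p r z" using k(3)[OF le_trans[OF v u(1)] u(2)] by blast
      then show "\<exists>y. D u y \<and> \<Psi> u p y"
        using Fun_total[OF Fun_up[OF Surj_Fun[OF g] u(1)] z(1)] Rel_D(3) unfolding \<Psi>_def by blast
    qed
    have u0: "E u y y'" if pre: "v \<preceq> u" "\<Psi> u p y" "\<Psi> u p y'" for u p y y'
    proof -
      obtain z z' where z: "Pair u p r z" "Rel u g z y" "Pair u p r z'" "Rel u g z' y'"
        using pre(2,3) unfolding \<Psi>_def by blast
      then have "Rel u g z' y" using Pair_inj Rel_congL by blast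
      with z(4) show ?thesis using Fun_unique[OF Fun_up[OF Surj_Fun[OF g] pre(1)]] by blast
    qed
    have u: "functional v \<Psi>" by (rule functionalI, rule u0)
    obtain q where q: "FunC v q k (\<lambda>u y. \<exists>p. M u p k \<and> \<Psi> u p y)"
      "\<And>u p y. v \<preceq> u \<Longrightarrow> M u p k \<Longrightarrow> D u y \<Longrightarrow> Rel u q p y \<longleftrightarrow> \<Psi> u p y"
      using function_exists[OF D(2) d t u] by blast
    have "Surj v q k b"
      unfolding Surj_def Fun_def
    proof (intro conjI allI impI)
      show "D v b" using Surj_D(3)[OF g] .
      show "FunC v q k (\<lambda>u y. M u y b)"
      proof (rule FunC_mono[OF q(1)])
        fix u y assume u: "v \<preceq> u" and "\<exists>p. M u p k \<and> \<Psi> u p y"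
        then show "M u y b" unfolding \<Psi>_def using Fun_ran[OF Fun_up[OF Surj_Fun[OF g] u]] by blast
      qed
      fix u y assume u: "v \<preceq> u" "M u y b"
      obtain z where z: "M u z K" "Rel u g z y" using Surj_onto[OF Surj_up[OF g u(1)] u(2)] by blast
      obtain p where p: "M u p k" "Pair u p r z" using k(2)[OF le_trans[OF v u(1)] z(1)] by blast
      have "Rel u q p y" using q(2)[OF u(1) p(1) M_D1[OF u(2)]] p(2) z(2) unfolding \<Psi>_def by blast
      with p(1) show "\<exists>p. D u p \<and> M u p k \<and> Rel u q p y" using M_D1 by blast
    qed
    then show ?thesis by blast
  qed
  have "Base w k"
  proof (rule BaseI[OF k(1)])
    fix v c g assume v: "w \<preceq> v" and g: "Surj v g c k"
    note D = D_up[OF r v] D_up[OF k(1) v] Surj_D[OF g]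
    \<comment> \<open>\<open>k\<close> is a copy of \<open>K\<close>, so a surjection
      \<open>g\<close> onto \<open>k\<close> is treated over \<open>K\<close>: for each
      \<open>z\<close> choose a preimage of its tagged version.\<close>
    define \<Psi> where "\<Psi> = (\<lambda>v z x. \<exists>p. Pair v p r z \<and> Rel v g x p)"
    have d: "class_rel v \<Psi>" unfolding \<Psi>_def
      by (rule class_relI[of r "[g]" v _ "ex (\<lambda>p. conj (is_pair p 0 3) (related 1 2 p))"])
        (use D in \<open>auto simp: sat_ex' ok_Cons ok_const numeral_eq_Suc dest: Pair_D\<close>)
    have t: "total v K \<Psi>"
    proof (rule totalI)
      fix u z assume u: "v \<preceq> u" "M u z K"
      obtain p where p: "M u p k" "Pair u p r z" using k(2)[OF le_trans[OF v u(1)] u(2)] by blast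
      with Surj_onto[OF Surj_up[OF g u(1)] p(1)] show "\<exists>x. D u x \<and> \<Psi> u z x"
        unfolding \<Psi>_def using Rel_D by blast
    qed
    obtain e where e: "FunC v e K D" "\<And>u z x. v \<preceq> u \<Longrightarrow> Rel u e z x \<Longrightarrow> \<Psi> u z x"
      using base_choice[OF Base_up[OF K(1) v] d t] by blast
    have De: "D v e" using e(1) by (simp add: FunC_def)
    \<comment> \<open>Transports the choice function back to \<open>k\<close> along the removal of
      tags; the result is a section of \<open>g\<close>.\<close>
    define \<Theta> where "\<Theta> = (\<lambda>v p x. \<exists>z. Pair v p r z \<and> Rel v e z x)"
    have d: "class_rel v \<Theta>" unfolding \<Theta>_def
      by (rule class_relI[of r "[e]" v _ "ex (\<lambda>z. conj (is_pair 3 0 z) (related 1 z 2))"])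
        (use D De in \<open>auto simp: sat_ex' ok_Cons ok_const numeral_eq_Suc dest: Pair_D\<close>)
    have t: "total v k \<Theta>"
    proof (rule totalI)
      fix u p assume u: "v \<preceq> u" "M u p k"
      obtain z where z: "M u z K" "Pair u p r z" using k(3)[OF le_trans[OF v u(1)] u(2)] by blast
      then show "\<exists>x. D u x \<and> \<Theta> u p x"
        using FunC_total[OF FunC_up[OF e(1) u(1)] z(1)] Rel_D(3) unfolding \<Theta>_def by blast
    qed
    have u0: "E u x x'" if pre: "v \<preceq> u" "\<Theta> u p x" "\<Theta> u p x'" for u p x x'
    proof -
      obtain z z' where z: "Pair u p r z" "Rel u e z x" "Pair u p r z'" "Rel u e z' x'"
        using pre(2,3) unfolding \<Theta>_def by blast
      then have "Rel u e z' x" using Pair_inj Rel_congL by blast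
      with z(4) show ?thesis using FunC_unique[OF FunC_up[OF e(1) pre(1)]] by blast
    qed
    have u: "functional v \<Theta>" by (rule functionalI, rule u0)
    obtain s where s: "FunC v s k (\<lambda>u x. \<exists>p. M u p k \<and> \<Theta> u p x)"
      "\<And>u p x. v \<preceq> u \<Longrightarrow> M u p k \<Longrightarrow> D u x \<Longrightarrow> Rel u s p x \<longleftrightarrow> \<Theta> u p x"
      using function_exists[OF D(2) d t u] by blast
    have \<Theta>g: "Rel u g x p" if u: "v \<preceq> u" and "\<Theta> u p x" for u p x
    proof -
      obtain z where z: "Pair u p r z" "Rel u e z x" using \<open>\<Theta> u p x\<close> unfolding \<Theta>_def by blast
      then obtain p' where "Pair u p' r z" "Rel u g x p'" using e(2)[OF u] unfolding \<Psi>_def by blast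
      then show ?thesis using z(1) Pair_unique Rel_congR by blast
    qed
    have "Fun v s k c"
      unfolding Fun_def
    proof
      show "D v c" using D by simp
      show "FunC v s k (\<lambda>u x. M u x c)"
        by (rule FunC_mono[OF s(1)]) (use \<Theta>g Fun_dom[OF Fun_up[OF Surj_Fun[OF g]]] in blast)
    qed
    moreover have "Rel u g x p" if u: "v \<preceq> u" "Rel u s p x" for u p x
      using \<Theta>g[OF u(1)] s(2)[OF u(1) FunC_dom[OF FunC_up[OF s(1) u(1)] u(2)] Rel_D(3)[OF u(2)]] u(2)
        by blast
    ultimately show "\<exists>s. Fun v s k c \<and> (\<forall>u x y. v \<preceq> u \<longrightarrow> Rel u s x y \<longrightarrow> Rel u g y x)" by blast
  qed
  moreover obtain q where "Surj w q k a" using untag[OF le_refl K(2)] by blast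
  ultimately show ?thesis using k(3) by blast
qed

end

definition is_rule :: "var \<Rightarrow> var \<Rightarrow> var \<Rightarrow> var \<Rightarrow> form" where
  "is_rule r i a b = ex (\<lambda>p. conj (related r i p) (is_pair p a b))"

text \<open>Requiring the tag \<open>i\<close> here keeps the covers chosen for different indices
  apart.\<close>

definition is_cover :: "var \<Rightarrow> var \<Rightarrow> var \<Rightarrow> form" where
  "is_cover r i k = (ex (\<lambda>a. ex (\<lambda>b. ex (\<lambda>g. conj (is_rule r i a b) (conj (is_surj g k a)
    (conj (is_base k) (all (\<lambda>p. imp (mem p k) (ex (\<lambda>z. is_pair p i z))))))))))"

context kripke
begin

definition Rule where
  "Rule w r i a b \<longleftrightarrow> (\<exists>p. D w p \<and> Rel w r i p \<and> Pair w p a b)"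

definition Cover where
  "Cover w r i k \<longleftrightarrow> (\<exists>a. D w a \<and> (\<exists>b. D w b \<and> (\<exists>g. D w g \<and> Rule w r i a b \<and> Surj w g k a \<and> Base w k \<and>
    (\<forall>v p. w \<preceq> v \<longrightarrow> D v p \<longrightarrow> M v p k \<longrightarrow> (\<exists>z. D v z \<and> Pair v p i z)))))"

lemma sat_rule [simp]:
  assumes "i < length xs" "j < length xs" "k < length xs" "l < length xs"
  shows "sat w e xs (is_rule i j k l) \<longleftrightarrow>
    ok w e xs \<and> Rule w (xs ! i) (xs ! j) (xs ! k) (xs ! l)"
  by (rule sat_okI)
    (use assms in \<open>simp (no_asm_simp) add: is_rule_def Rule_def sem cong: conj_cong\<close>)

lemma sat_cover [simp]:
  assumes "i < length xs" "j < length xs" "k < length xs"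
  shows "sat w e xs (is_cover i j k) \<longleftrightarrow> ok w e xs \<and> Cover w (xs ! i) (xs ! j) (xs ! k)"
  by (rule sat_okI)
    (use assms in \<open>simp (no_asm_simp) add: is_cover_def Cover_def sem cong: conj_cong\<close>)

lemma Rule_up: "Rule w r i a b \<Longrightarrow> w \<preceq> v \<Longrightarrow> Rule v r i a b"
  unfolding Rule_def using D_up Rel_up Pair_up by meson

end

context czf
begin

text \<open>Since \<open>A\<close> is a base, one tagged cover \<open>\<kappa> i\<close> can be
  chosen for every index. \<open>B\<close> is the union of these covers and \<open>f\<close> reads
  off the tag, so the fibre over \<open>i\<close> is exactly \<open>\<kappa> i\<close>.\<close>

lemma base_map_exists:
  assumes R: "RuleSet w R X"
  shows "\<exists>A r B f. Surj w r A R \<and> BaseMap w f B A \<and>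
    (\<forall>v i a b. w \<preceq> v \<longrightarrow> Rule v r i a b \<longrightarrow>
      (\<exists>k g. Fibre v k f i \<and> Base v k \<and> Surj v g k a))"
proof -
  have RD: "D w R" using R by (simp add: RuleSet_def)
  obtain A r where A: "Base w A" and r: "Surj w r A R" using presentation[OF RD] by blast
  note D = Surj_D[OF r]
  have pairR: "\<exists>a b. Pair v p a b" if "w \<preceq> v" "M v p R" for v p
    using R that M_D1 unfolding RuleSet_def by blast
  define \<Phi> where "\<Phi> = (\<lambda>v i k. Cover v r i k)"
  have d: "class_rel w \<Phi>" unfolding \<Phi>_def
    by (rule class_relI[of r "[]" w _ "is_cover 0 2 1"]) (use D in auto)
  have "total w A \<Phi>"
  proof (rule totalI)
    fix v i assume v: "w \<preceq> v" "M v i A"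
    obtain p where p: "Rel v r i p" using Fun_total[OF Fun_up[OF Surj_Fun[OF r] v(1)] v(2)] by blast
    have "M v p R" using Fun_ran[OF Fun_up[OF Surj_Fun[OF r] v(1)] p] .
    then obtain a b where ab: "Pair v p a b" using pairR[OF v(1)] by blast
    obtain K g where "Base v K" "Surj v g K a" using presentation[OF Pair_D(2)[OF ab]] by blast
    from tagged_base[OF this M_D1[OF v(2)]] obtain k q where k: "Base v k" "Surj v q k a"
      "\<forall>u p. v \<preceq> u \<longrightarrow> M u p k \<longrightarrow> (\<exists>z. Pair u p i z)" by blast
    moreover have "Rule v r i a b" unfolding Rule_def using p ab Pair_D by blast
    ultimately have "Cover v r i k" unfolding Cover_def
      using Pair_D[OF ab] Surj_D(1)[OF k(2)] Pair_D(3) by blast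
    then show "\<exists>k. D v k \<and> \<Phi> v i k" unfolding \<Phi>_def using Base_D[OF k(1)] by blast
  qed
  from base_choice[OF A d this] obtain \<kappa> where \<kappa>: "FunC w \<kappa> A D" "\<And>v i k. w \<preceq> v \<Longrightarrow> Rel v \<kappa> i k \<Longrightarrow>
    Cover v r i k"
    unfolding \<Phi>_def by blast
  obtain U where U: "D w U" "\<And>v k. w \<preceq> v \<Longrightarrow> M v k U \<longleftrightarrow> (\<exists>i. Rel v \<kappa> i k)"
    using range_exists[OF \<kappa>(1)] by blast
  obtain B where B: "D w B" "\<And>v b. w \<preceq> v \<Longrightarrow> M v b B \<longleftrightarrow> (\<exists>k. M v k U \<and> M v b k)"
    using union[OF U(1)] by blast
  have tag: "\<exists>z. Pair v b i z" if v: "w \<preceq> v" and "Rel v \<kappa> i k" "M v b k" for v i k b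
    using \<kappa>(2)[OF that(1,2)] that(3) M_D1 unfolding Cover_def using le_refl by blast
  define \<Psi> where "\<Psi> = (\<lambda>v b i. \<exists>z. Pair v b i z)"
  have d: "class_rel w \<Psi>" unfolding \<Psi>_def
    by (rule class_relI[of r "[]" w _ "ex (\<lambda>z. is_pair 2 1 z)"])
      (use D in \<open>auto simp: sat_ex' ok_Cons ok_const numeral_eq_Suc dest: Pair_D\<close>)
  have t: "total w B \<Psi>"
  proof (rule totalI)
    fix v b assume v: "w \<preceq> v" "M v b B"
    then show "\<exists>i. D v i \<and> \<Psi> v b i"
      using B(2)[OF v(1)] U(2)[OF v(1)] tag[OF v(1)] Pair_D(2) unfolding \<Psi>_def by blast
  qed
  have u0: "E v i i'" if "w \<preceq> v" "\<Psi> v b i" "\<Psi> v b i'" for v b i i'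
    using that Pair_inj unfolding \<Psi>_def by blast
  have u: "functional w \<Psi>" by (rule functionalI, rule u0)
  obtain f where f: "FunC w f B (\<lambda>v i. \<exists>b. M v b B \<and> \<Psi> v b i)"
    "\<And>v b i. w \<preceq> v \<Longrightarrow> M v b B \<Longrightarrow> D v i \<Longrightarrow> Rel v f b i \<longleftrightarrow> \<Psi> v b i"
    using function_exists[OF B(1) d t u] by blast
  have Df: "D w f" using f(1) by (simp add: FunC_def)
  have fib: "Fibre v k f i" if v: "w \<preceq> v" and k: "Rel v \<kappa> i k" for v i k
    unfolding Fibre_def
  proof (intro conjI allI impI)
    show "D v k" "D v i" using Rel_D k by blast+
    show "D v f" using D_up[OF Df v] .
    fix u b assume u: "v \<preceq> u"
    note wu = le_trans[OF v u]
    show "M u b k \<longleftrightarrow> Rel u f b i"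
    proof
      assume b: "M u b k"
      then have "M u b B" using B(2)[OF wu] U(2)[OF wu] Rel_up[OF k u] by blast
      moreover have "\<Psi> u b i" using tag[OF wu Rel_up[OF k u] b] unfolding \<Psi>_def .
      ultimately show "Rel u f b i" using f(2)[OF wu] D_up[OF Rel_D(2)[OF k] u] by blast
    next
      \<comment> \<open>An element of the fibre lies in some \<open>\<kappa> i'\<close>; its tag is
        both \<open>i'\<close> and \<open>i\<close>, so that cover is
        \<open>\<kappa> i\<close>.\<close>
      assume b: "Rel u f b i"
      have bB: "M u b B" using FunC_dom[OF FunC_up[OF f(1) wu] b] .
      then have "\<Psi> u b i" using f(2)[OF wu] b Rel_D(3) by blast
      then obtain z where z: "Pair u b i z" unfolding \<Psi>_def by blast
      obtain k' i' where k': "M u b k'" "Rel u \<kappa> i' k'" using bB B(2)[OF wu] U(2)[OF wu] by blast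
      then have "E u i' i" using tag[OF wu] z Pair_inj by blast
      then have "Rel u \<kappa> i k'" using k'(2) Rel_congL by blast
      then have "E u k' k" using FunC_unique[OF FunC_up[OF \<kappa>(1) wu] _ Rel_up[OF k u]] by blast
      with k'(1) show "M u b k" by (rule M_congR)
    qed
  qed
  have funf: "Fun w f B A"
    unfolding Fun_def
  proof
    show "D w A" using A by (rule Base_D)
    show "FunC w f B (\<lambda>v i. M v i A)"
    proof (rule FunC_mono[OF f(1)])
      fix v i assume v: "w \<preceq> v" and "\<exists>b. M v b B \<and> \<Psi> v b i"
      then obtain b k i' z where b: "Pair v b i z" "M v b k" "Rel v \<kappa> i' k"
        using B(2)[OF v] U(2)[OF v] unfolding \<Psi>_def by blast
      have "M v i' A" using FunC_dom[OF FunC_up[OF \<kappa>(1) v] b(3)] .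
      then show "M v i A" using tag[OF v b(3,2)] b(1) Pair_inj M_congL by blast
    qed
  qed
  have "BaseMap w f B A"
    unfolding BaseMap_def
  proof (intro conjI allI impI)
    fix v i u k assume v: "w \<preceq> v" "M v i A" "v \<preceq> u" "Fibre u k f i"
    note wu = le_trans[OF v(1,3)]
    obtain k' where k': "Rel u \<kappa> i k'" using FunC_total[OF FunC_up[OF \<kappa>(1) wu] M_up[OF v(2,3)]]
      by blast
    \<comment> \<open>A base map speaks of every set that is a fibre; such a set equals the chosen
      cover, and being a base is invariant under equality.\<close>
    have "Base u k'" using \<kappa>(2)[OF wu k'] unfolding Cover_def by blast
    moreover have "E u k' k"
      by (rule extensionality) (use fib[OF wu k'] v(4) M_D1 Rel_D in \<open>unfold Fibre_def, blast+\<close>)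
    ultimately show "Base u k" by (rule Base_cong)
  qed (use funf A in auto)
  moreover have "\<exists>k g. Fibre v k f i \<and> Base v k \<and> Surj v g k a"
    if v: "w \<preceq> v" and ab: "Rule v r i a b" for v i a b
  proof -
    obtain p where p: "Rel v r i p" "Pair v p a b" using ab unfolding Rule_def by blast
    have "M v i A" using Fun_dom[OF Fun_up[OF Surj_Fun[OF r] v] p(1)] .
    then obtain k where k: "Rel v \<kappa> i k" using FunC_total[OF FunC_up[OF \<kappa>(1) v]] by blast
    \<comment> \<open>\<open>Cover\<close> only names some premise of rule \<open>i\<close>; as
      \<open>r\<close> is a function, it is the given \<open>a\<close>.\<close>
    obtain a' b' g p' where g: "Rel v r i p'" "Pair v p' a' b'" "Surj v g k a'" "Base v k"
      using \<kappa>(2)[OF v k] unfolding Cover_def Rule_def by blast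
    have "E v p' p" using Fun_unique[OF Fun_up[OF Surj_Fun[OF r] v] g(1) p(1)] .
    then have "E v a' a" using g(2) p(2) Pair_inj Pair_congP by blast
    then have "Surj v g k a" using g(3) Surj_cong E_refl Surj_D(2) by blast
    with g(4) fib[OF v k] show ?thesis by blast
  qed
  ultimately show ?thesis using r by blast
qed

end

subsection \<open>Sets of labels\<close>

text \<open>The formula \<open>y = y\<close> stands for the universal class.\<close>

definition is_fun_on :: "var \<Rightarrow> var \<Rightarrow> form" where
  "is_fun_on t k = is_fun_class t k (\<lambda>y. eq y y)"

definition is_cov :: "var \<Rightarrow> var \<Rightarrow> form" where
  "is_cov t a = all (\<lambda>y. imp (mem y a) (ex (\<lambda>z. ex (\<lambda>x. conj (related t z x) (mem y x)))))"

text \<open>The form of \<open>is_cov\<close> that sees only the range of the family of labels.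
  Ranges, unlike the families themselves, are what subset collection bounds.\<close>

definition is_ucov :: "var \<Rightarrow> var \<Rightarrow> form" where
  "is_ucov d a = all (\<lambda>y. imp (mem y a) (ex (\<lambda>x. conj (mem x d) (mem y x))))"

definition is_sel :: "var \<Rightarrow> var \<Rightarrow> form" where
  "is_sel t s = all (\<lambda>z. all (\<lambda>y. imp (related t z y) (ex (\<lambda>x. conj (related s z x) (mem y x)))))"

definition is_meet :: "var \<Rightarrow> var \<Rightarrow> form" where
  "is_meet a b = ex (\<lambda>y. conj (mem y a) (mem y b))"

text \<open>\<open>x\<close> contains for every \<open>Y\<close> a subset of \<open>Y\<close> that meets \<open>b\<close> as soon as \<open>a\<close> is covered, provided
  \<open>Y\<close> meets \<open>b\<close> as soon as \<open>a\<close> is covered.\<close>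

definition is_usplit :: "var \<Rightarrow> var \<Rightarrow> var \<Rightarrow> var \<Rightarrow> form" where
  "is_usplit d a b x = all (\<lambda>Y. imp (imp (is_ucov d a) (is_meet b Y))
    (ex (\<lambda>c. conj (mem c x) (conj (is_subset c Y) (imp (is_ucov d a) (is_meet c b))))))"

definition is_split :: "var \<Rightarrow> var \<Rightarrow> var \<Rightarrow> var \<Rightarrow> form" where
  "is_split t a b x = all (\<lambda>Y. imp (imp (is_cov t a) (is_meet b Y))
    (ex (\<lambda>c. conj (mem c x) (conj (is_subset c Y) (imp (is_cov t a) (is_meet c b))))))"

text \<open>\<open>s\<close> holds the label sets of the subtrees, \<open>t\<close> a choice of one
  label from each, and \<open>x\<close> has to be adequate for all such choices simultaneously. The
  clauses on \<open>k\<close> make related arguments functions on the fibre, which dependent choice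
  demands of its relation.\<close>

definition is_step :: "var \<Rightarrow> var \<Rightarrow> var \<Rightarrow> var \<Rightarrow> var \<Rightarrow> form" where
  "is_step f r i s x = ex (\<lambda>k. conj (is_fibre k f i) (conj (is_fun_on s k)
    (all (\<lambda>t. imp (conj (is_fun_on t k) (is_sel t s))
      (all (\<lambda>a. all (\<lambda>b. imp (is_rule r i a b) (is_split t a b x))))))))"

context kripke
begin

definition Cov where
  "Cov w t a \<longleftrightarrow> (\<forall>v y. w \<preceq> v \<longrightarrow> D v y \<longrightarrow> M v y a \<longrightarrow>
    (\<exists>z. D v z \<and> (\<exists>x. D v x \<and> Rel v t z x \<and> M v y x)))"

definition UCov where
  "UCov w d a \<longleftrightarrow> (\<forall>v y. w \<preceq> v \<longrightarrow> D v y \<longrightarrow> M v y a \<longrightarrow> (\<exists>x. D v x \<and> M v x d \<and> M v y x))"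

definition Sel where
  "Sel w t s \<longleftrightarrow> (\<forall>v z y. w \<preceq> v \<longrightarrow> D v z \<longrightarrow> D v y \<longrightarrow> Rel v t z y \<longrightarrow>
    (\<exists>x. D v x \<and> Rel v s z x \<and> M v y x))"

definition Meet where
  "Meet w a b \<longleftrightarrow> (\<exists>y. D w y \<and> M w y a \<and> M w y b)"

definition USplit where
  "USplit w d a b x \<longleftrightarrow> (\<forall>v Y. w \<preceq> v \<longrightarrow> D v Y \<longrightarrow> (\<forall>u. v \<preceq> u \<longrightarrow> UCov u d a \<longrightarrow> Meet u b Y) \<longrightarrow>
    (\<exists>c. D v c \<and> M v c x \<and> Sub v c Y \<and> (\<forall>u. v \<preceq> u \<longrightarrow> UCov u d a \<longrightarrow> Meet u c b)))"

definition Split where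
  "Split w t a b x \<longleftrightarrow> (\<forall>v Y. w \<preceq> v \<longrightarrow> D v Y \<longrightarrow> (\<forall>u. v \<preceq> u \<longrightarrow> Cov u t a \<longrightarrow> Meet u b Y) \<longrightarrow>
    (\<exists>c. D v c \<and> M v c x \<and> Sub v c Y \<and> (\<forall>u. v \<preceq> u \<longrightarrow> Cov u t a \<longrightarrow> Meet u c b)))"

definition Step where
  "Step w f r i s x \<longleftrightarrow> (\<exists>k. D w k \<and> Fibre w k f i \<and> FunC w s k D \<and>
    (\<forall>v t. w \<preceq> v \<longrightarrow> D v t \<longrightarrow> FunC v t k D \<and> Sel v t s \<longrightarrow>
      (\<forall>u a b. v \<preceq> u \<longrightarrow> D u a \<longrightarrow> D u b \<longrightarrow> D u k \<and> Rule u r i a b \<longrightarrow> Split u t a b x)))"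

lemma sat_fun_on [simp]:
  assumes "i < length xs" "j < length xs"
  shows "sat w e xs (is_fun_on i j) \<longleftrightarrow> ok w e xs \<and> FunC w (xs ! i) (xs ! j) D"
  unfolding is_fun_on_def using assms
  by (subst sat_fun_class[where K = D]) (auto simp: nth_append ok_Cons intro: E_refl)

lemma sat_cov [simp]:
  assumes "i < length xs" "j < length xs"
  shows "sat w e xs (is_cov i j) \<longleftrightarrow>
    ok w e xs \<and> Cov w (xs ! i) (xs ! j)"
  by (rule sat_okI)
    (use assms in \<open>simp (no_asm_simp) add: is_cov_def Cov_def sem cong: conj_cong\<close>)

lemma sat_ucov [simp]:
  assumes "i < length xs" "j < length xs"
  shows "sat w e xs (is_ucov i j) \<longleftrightarrow>
    ok w e xs \<and> UCov w (xs ! i) (xs ! j)"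
  by (rule sat_okI)
    (use assms in \<open>simp (no_asm_simp) add: is_ucov_def UCov_def sem cong: conj_cong\<close>)

lemma sat_sel [simp]:
  assumes "i < length xs" "j < length xs"
  shows "sat w e xs (is_sel i j) \<longleftrightarrow>
    ok w e xs \<and> Sel w (xs ! i) (xs ! j)"
  by (rule sat_okI)
    (use assms in \<open>simp (no_asm_simp) add: is_sel_def Sel_def sem cong: conj_cong\<close>)

lemma sat_meet [simp]:
  assumes "i < length xs" "j < length xs"
  shows "sat w e xs (is_meet i j) \<longleftrightarrow>
    ok w e xs \<and> Meet w (xs ! i) (xs ! j)"
  by (rule sat_okI)
    (use assms in \<open>simp (no_asm_simp) add: is_meet_def Meet_def sem cong: conj_cong\<close>)

lemma sat_usplit [simp]:
  assumes "i < length xs" "j < length xs" "k < length xs" "l < length xs"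
  shows "sat w e xs (is_usplit i j k l) \<longleftrightarrow>
    ok w e xs \<and> USplit w (xs ! i) (xs ! j) (xs ! k) (xs ! l)"
  by (rule sat_okI)
    (use assms in \<open>simp (no_asm_simp) add: is_usplit_def USplit_def sem cong: conj_cong\<close>)

lemma sat_split [simp]:
  assumes "i < length xs" "j < length xs" "k < length xs" "l < length xs"
  shows "sat w e xs (is_split i j k l) \<longleftrightarrow>
    ok w e xs \<and> Split w (xs ! i) (xs ! j) (xs ! k) (xs ! l)"
  by (rule sat_okI)
    (use assms in \<open>simp (no_asm_simp) add: is_split_def Split_def sem cong: conj_cong\<close>)

lemma sat_step [simp]:
  assumes "i < length xs" "j < length xs" "k < length xs" "l < length xs" "m < length xs"
  shows "sat w e xs (is_step i j k l m) \<longleftrightarrow>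
    ok w e xs \<and> Step w (xs ! i) (xs ! j) (xs ! k) (xs ! l) (xs ! m)"
  by (rule sat_okI)
    (use assms in \<open>simp (no_asm_simp) add: is_step_def Step_def sem cong: conj_cong\<close>)

lemma Cov_up: "Cov w t a \<Longrightarrow> w \<preceq> v \<Longrightarrow> Cov v t a"
  unfolding Cov_def by (meson le_trans)

lemma CovI: "(\<And>v y. w \<preceq> v \<Longrightarrow> M v y a \<Longrightarrow> \<exists>z x. Rel v t z x \<and> M v y x) \<Longrightarrow> Cov w t a"
  unfolding Cov_def using Rel_D by blast

lemma CovD: "Cov w t a \<Longrightarrow> M w y a \<Longrightarrow> \<exists>z x. Rel w t z x \<and> M w y x"
  unfolding Cov_def using M_D1 le_refl by blast

lemma UCovI: "(\<And>v y. w \<preceq> v \<Longrightarrow> M v y a \<Longrightarrow> \<exists>x. M v x d \<and> M v y x) \<Longrightarrow> UCov w d a"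
  unfolding UCov_def using M_D1 by blast

lemma UCovD: "UCov w d a \<Longrightarrow> M w y a \<Longrightarrow> \<exists>x. M w x d \<and> M w y x"
  unfolding UCov_def using M_D1 le_refl by blast

lemma UCov_up: "UCov w d a \<Longrightarrow> w \<preceq> v \<Longrightarrow> UCov v d a"
  unfolding UCov_def by (meson le_trans)

lemma Meet_iff: "Meet w a b \<longleftrightarrow> (\<exists>y. M w y a \<and> M w y b)"
  unfolding Meet_def using M_D1 by blast

lemma SplitI:
  assumes "\<And>v Y. w \<preceq> v \<Longrightarrow> D v Y \<Longrightarrow> (\<And>u. v \<preceq> u \<Longrightarrow> Cov u t a \<Longrightarrow> Meet u b Y) \<Longrightarrow>
    \<exists>c. M v c x \<and> Sub v c Y \<and> (\<forall>u. v \<preceq> u \<longrightarrow> Cov u t a \<longrightarrow> Meet u c b)"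
  shows "Split w t a b x"
  unfolding Split_def
proof (intro allI impI)
  fix v Y assume "w \<preceq> v" "D v Y" "\<forall>u. v \<preceq> u \<longrightarrow> Cov u t a \<longrightarrow> Meet u b Y"
  then have "\<exists>c. M v c x \<and> Sub v c Y \<and> (\<forall>u. v \<preceq> u \<longrightarrow> Cov u t a \<longrightarrow> Meet u c b)"
    by (intro assms) simp_all
  then show "\<exists>c. D v c \<and> M v c x \<and> Sub v c Y \<and> (\<forall>u. v \<preceq> u \<longrightarrow> Cov u t a \<longrightarrow> Meet u c b)"
    using M_D1 by blast
qed

end

section \<open>The labels needed at one node\<close>

context czf
begin

lemma Rule_unique:
  assumes "Fun w r A R" "Rule w r i a b" "Rule w r i a' b'"
  shows "E w a a'" "E w b b'"
proof -
  obtain p p' where p: "Rel w r i p" "Pair w p a b" "Rel w r i p'" "Pair w p' a' b'"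
    using assms(2,3) unfolding Rule_def by blast
  then have "Pair w p' a b" using Fun_unique[OF assms(1)] Pair_congP by blast
  with p(4) show "E w a a'" "E w b b'" using Pair_inj by blast+
qed

lemma Rule_exists:
  assumes "Fun w r A R" "RuleSet w R X" "M w i A"
  shows "\<exists>a b. Rule w r i a b"
proof -
  obtain p where p: "Rel w r i p" using Fun_total[OF assms(1,3)] by blast
  with Fun_ran[OF assms(1)] have "M w p R" by blast
  then obtain a b where "Pair w p a b" using assms(2) M_D1 le_refl unfolding RuleSet_def by blast
  with p show ?thesis unfolding Rule_def using Pair_D by blast
qed

lemma Rule_Rel: "Fun w r A R \<Longrightarrow> Rule w r i a b \<Longrightarrow> M w i A \<and> Rel w R a b"
  unfolding Rule_def Rel_def[of w R] using Fun_dom Fun_ran by blast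

lemma Fibre_unique: "Fibre w k f i \<Longrightarrow> Fibre w k' f i \<Longrightarrow> E w k k'"
  by (rule extensionality) (use M_D1 Rel_D in \<open>unfold Fibre_def, blast+\<close>)

lemma FunC_cong_dom:
  assumes "FunC w t k C" "E w k k'"
  shows "FunC w t k' C"
proof -
  have "M v x k' \<longleftrightarrow> M v x k" if "w \<preceq> v" for v x
    using M_congR E_sym E_up[OF assms(2) that] by blast
  with assms E_D2 show ?thesis unfolding FunC_def by simp
qed

lemma FunC_restrict:
  assumes "FunC w f a C" "\<And>v x y. w \<preceq> v \<Longrightarrow> Rel v f x y \<Longrightarrow> C' v y"
  shows "FunC w f a C'"
proof (rule FunCI)
  fix v p assume v: "w \<preceq> v" "M v p f"
  from FunC_mem[OF FunC_up[OF assms(1) v(1)] v(2)] obtain x y where "M v x a" "Pair v p x y"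
    by blast
  with assms(2)[OF v(1)] v(2) show "\<exists>x y. M v x a \<and> C' v y \<and> Pair v p x y" unfolding Rel_def
    by blast
next
  show "D w f" "D w a" using assms(1) by (auto simp: FunC_def)
next
  fix v x assume "w \<preceq> v" "M v x a"
  then show "\<exists>y. Rel v f x y" using FunC_total FunC_up[OF assms(1)] by blast
next
  fix v x y z assume "w \<preceq> v" "Rel v f x y" "Rel v f x z"
  then show "E v y z" using FunC_unique FunC_up[OF assms(1)] by blast
qed

lemma Comp_Rel:
  assumes "Comp w u h t" "Rel w t x y" "Rel w h y z"
  shows "Rel w u x z"
proof -
  note D = Rel_D[OF assms(2)] Rel_D[OF assms(3)]
  obtain p where p: "Pair w p x z" using D(2,6) by (rule pair_exists)
  have "M w p u" using assms D Pair_D(1)[OF p] p le_refl unfolding Comp_def by blast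
  with p show ?thesis unfolding Rel_def by blast
qed

text \<open>The set \<open>u\<close> of those members of {a} that are covered by \<open>d\<close>
  represents the truth value of the covering. A conditional choice of a point of \<open>b\<close> is
  a relation from \<open>u\<close> to \<open>b\<close>, and subset collection, with \<open>Y\<close>
  as parameter, bounds the image sets that are needed; these images are the labels.\<close>

lemma usplit_exists:
  assumes D: "D w d" "D w a" "D w b"
  shows "\<exists>x. D w x \<and> USplit w d a b x"
proof -
  obtain o1 where o1: "UPair w o1 a a" using D(2,2) by (rule pairing)
  have "bounded (is_ucov (Suc 0) 0 (Suc (Suc (Suc 0))))"
    by (auto simp: is_ucov_def all_def ex_def mem_def conj_def imp_def intro!: bounded.intros)
  then have d1: "bounded_class w (\<lambda>v x. UCov v d a)"
    by (intro bounded_classI[of a "[d]" w "is_ucov 1 0"]) (use D in auto)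
  obtain u where u: "D w u" "\<And>v x. w \<preceq> v \<Longrightarrow> M v x u \<longleftrightarrow> M v x o1 \<and> UCov v d a"
    using separation[OF UPair_D(1)[OF o1] d1] by blast
  have d3: "class_rel3 w (\<lambda>v x y Y. M v y Y)"
    by (rule class_rel3I[of a "[]" w _ "mem 2 1"]) (use D in auto)
  from subset_collection[OF u(1) D(3) d3] obtain c where c: "D w c"
    "\<And>v Y. w \<preceq> v \<Longrightarrow> D v Y \<Longrightarrow> (\<And>v' x. v \<preceq> v' \<Longrightarrow> M v' x u \<Longrightarrow> \<exists>y. M v' y b \<and> M v' y Y) \<Longrightarrow>
      \<exists>d. M v d c \<and> (\<forall>v' x. v \<preceq> v' \<longrightarrow> M v' x u \<longrightarrow> (\<exists>y. M v' y d \<and> M v' y Y)) \<and>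
        (\<forall>v' y. v \<preceq> v' \<longrightarrow> M v' y d \<longrightarrow> (\<exists>x. M v' x u \<and> M v' y Y))"
    by blast
  have "USplit w d a b c"
    unfolding USplit_def
  proof (intro allI impI)
    fix v Y assume v: "w \<preceq> v" "D v Y" and Y: "\<forall>v'. v \<preceq> v' \<longrightarrow> UCov v' d a \<longrightarrow> Meet v' b Y"
    have d1: "bounded_class v (\<lambda>v' y. M v' y b)"
      proof (rule bounded_classI[of b "[]" v "mem 1 0"])
      show "bounded (mem 1 0 (Suc (Suc (length []))))" by (simp add: mem_def bounded.intros)
    qed (use D_up[OF D(3) v(1)] in auto)
    \<comment> \<open>Subset collection as stated does not promise images inside \<open>b\<close>.
      With the part of \<open>Y\<close> in \<open>b\<close> as parameter they lie there anyway, so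
      that the label meets \<open>b\<close> and not just \<open>Y\<close>.\<close>
    obtain Z where Z: "D v Z" "\<And>v' y. v \<preceq> v' \<Longrightarrow> M v' y Z \<longleftrightarrow> M v' y Y \<and> M v' y b"
      using separation[OF v(2) d1] by blast
    have tot: "\<exists>y. M v' y b \<and> M v' y Z" if v': "v \<preceq> v'" "M v' x u" for v' x
      using Y v' u(2)[OF le_trans[OF v(1) v'(1)]] Z(2)[OF v'(1)] unfolding Meet_iff by blast
    obtain q where q: "M v q c"
      "\<And>v' x. v \<preceq> v' \<Longrightarrow> M v' x u \<Longrightarrow> \<exists>y. M v' y q \<and> M v' y Z"
      "\<And>v' y. v \<preceq> v' \<Longrightarrow> M v' y q \<Longrightarrow> M v' y Z"
      using c(2)[OF v(1) Z(1)] tot by blast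
    have "Sub v q Y" unfolding Sub_def using q(1,3) Z(2) v(2) M_D1 by blast
    moreover have "Meet v' q b" if v': "v \<preceq> v'" "UCov v' d a" for v'
    proof -
      have "M v' a o1"
        using UPair_iff[OF UPair_up[OF o1 le_trans[OF v(1) v'(1)]]] E_refl D_up[OF D(2) le_trans[OF
          v(1) v'(1)]] by blast
      with v' have "M v' a u" using u(2)[OF le_trans[OF v(1) v'(1)]] by blast
      from q(2)[OF v'(1) this] show ?thesis using Z(2)[OF v'(1)] unfolding Meet_iff by blast
    qed
    ultimately show "\<exists>c'. D v c' \<and> M v c' c \<and> Sub v c' Y \<and> (\<forall>u. v \<preceq> u \<longrightarrow> UCov u d a \<longrightarrow> Meet u c' b)"
      using q(1) M_D1 by blast
  qed
  with c(1) show ?thesis by blast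
qed

text \<open>Every selection \<open>t\<close> from \<open>s\<close> takes its values in the union
  \<open>U\<close> of the label sets. Subset collection from \<open>k\<close> to \<open>U\<close>
  gives a set \<open>c\<close> containing the range of each selection, and only the range enters the
  covering condition. So the sets of \<open>usplit_exists\<close> for all members of
  \<open>c\<close> are collected and united.\<close>

lemma step_exists:
  assumes r: "Fun w r A R" and R: "RuleSet w R X" and i: "M w i A" and k: "Fibre w k f i" and s:
    "FunC w s k D"
  shows "\<exists>x. D w x \<and> Step w f r i s x"
proof -
  note Dk = Fibre_D(1)[OF k]
  obtain U0 where U0: "D w U0" "\<And>v y. w \<preceq> v \<Longrightarrow> M v y U0 \<longleftrightarrow> (\<exists>x. Rel v s x y)"
    using range_exists[OF s] by blast
  obtain U where U: "D w U" "\<And>v x. w \<preceq> v \<Longrightarrow> M v x U \<longleftrightarrow> (\<exists>y. M v y U0 \<and> M v x y)"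
    using union[OF U0(1)] by blast
  have d3: "class_rel3 w (\<lambda>v z y t. Rel v t z y)"
    by (rule class_rel3I[of k "[]" w _ "related 1 3 2"]) (use Dk in auto)
  from subset_collection[OF Dk U(1) d3] obtain c where c: "D w c"
    "\<And>v t. w \<preceq> v \<Longrightarrow> D v t \<Longrightarrow> (\<And>v' z. v \<preceq> v' \<Longrightarrow> M v' z k \<Longrightarrow> \<exists>y. M v' y U \<and> Rel v' t z y) \<Longrightarrow>
      \<exists>d. M v d c \<and> (\<forall>v' z. v \<preceq> v' \<longrightarrow> M v' z k \<longrightarrow> (\<exists>y. M v' y d \<and> Rel v' t z y)) \<and>
        (\<forall>v' y. v \<preceq> v' \<longrightarrow> M v' y d \<longrightarrow> (\<exists>z. M v' z k \<and> Rel v' t z y))"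
    by blast
  obtain a b where ab: "Rule w r i a b" using Rule_exists[OF r R i] by blast
  have Dab: "D w a" "D w b" using ab Pair_D unfolding Rule_def by blast+
  have d2: "class_rel w (\<lambda>v d x. USplit v d a b x)"
    by (rule class_relI[of a "[b]" w _ "is_usplit 3 0 1 2"])
      (use Dab in \<open>auto simp: numeral_eq_Suc ok_Cons\<close>)
  have t: "total w c (\<lambda>v d x. USplit v d a b x)"
    by (rule totalI) (use usplit_exists M_D1 D_up Dab in blast)
  obtain C where C: "D w C" "\<And>v d. w \<preceq> v \<Longrightarrow> M v d c \<Longrightarrow> \<exists>x. M v x C \<and> USplit v d a b x"
    using collection[OF c(1) d2 t] by blast
  obtain x where x: "D w x" "\<And>v y. w \<preceq> v \<Longrightarrow> M v y x \<longleftrightarrow> (\<exists>z. M v z C \<and> M v y z)"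
    using union[OF C(1)] by blast
  have "Step w f r i s x"
    unfolding Step_def
  proof (intro exI conjI allI impI)
    fix v t u a' b' assume v: "w \<preceq> v" "v \<preceq> u" and Dt: "D v t" and t: "FunC v t k D \<and> Sel v t s" and
      "D u k \<and> Rule u r i a' b'"
    then have ab': "Rule u r i a' b'" by simp
    note tf = conjunct1[OF t] and ts = conjunct2[OF t]
    have tot: "\<exists>y. M v' y U \<and> Rel v' t z y" if v': "v \<preceq> v'" "M v' z k" for v' z
    proof -
      obtain y where y: "Rel v' t z y" using FunC_total[OF FunC_up[OF tf v'(1)] v'(2)] by blast
      then obtain y' where "Rel v' s z y'" "M v' y y'" using ts v'(1) Rel_D unfolding Sel_def
        by blast
      then have "M v' y U" using U(2) U0(2) le_trans[OF v(1) v'(1)] by blast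
      with y show ?thesis by blast
    qed
    obtain d where d: "M v d c"
      "\<And>v' z. v \<preceq> v' \<Longrightarrow> M v' z k \<Longrightarrow> \<exists>y. M v' y d \<and> Rel v' t z y"
      "\<And>v' y. v \<preceq> v' \<Longrightarrow> M v' y d \<Longrightarrow> \<exists>z. M v' z k \<and> Rel v' t z y"
      using c(2)[OF v(1) Dt tot] by blast
    obtain x0 where x0: "M v x0 C" "USplit v d a b x0" using C(2)[OF v(1) d(1)] by blast
    \<comment> \<open>The rule was read off at \<open>w\<close>, but \<open>Step\<close> asks about
      the one named at the later world \<open>u\<close>; they agree up to \<open>E\<close>.\<close>
    have E: "E u a a'" "E u b b'"
      using Rule_unique[OF Fun_up[OF r le_trans[OF v]] Rule_up[OF ab le_trans[OF v]] ab'] by blast+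
    show "Split u t a' b' x"
    proof (rule SplitI)
      fix u' Y assume u': "u \<preceq> u'" "D u' Y" and Y: "\<And>v'. u' \<preceq> v' \<Longrightarrow> Cov v' t a' \<Longrightarrow> Meet v' b' Y"
      have vu': "v \<preceq> u'" using le_trans[OF v(2) u'(1)] .
      \<comment> \<open>\<open>d\<close> is the range of \<open>t\<close>, so covering by the set
        and covering by the family agree.\<close>
      have iff: "UCov v' d a \<longleftrightarrow> Cov v' t a'" if v': "u' \<preceq> v'" for v'
      proof
        assume *: "UCov v' d a"
        show "Cov v' t a'"
        proof (rule CovI)
          fix v'' y assume v'': "v' \<preceq> v''" "M v'' y a'"
          have le: "v \<preceq> v''" "u \<preceq> v''" using le_trans vu' v' v''(1) u'(1) by blast+
          have "M v'' y a" using M_congR[OF v''(2) E_sym[OF E_up[OF E(1) le(2)]]] .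
          from UCovD[OF UCov_up[OF * v''(1)] this] d(3)[OF le(1)]
          show "\<exists>z x. Rel v'' t z x \<and> M v'' y x" by blast
        qed
      next
        assume *: "Cov v' t a'"
        show "UCov v' d a"
        proof (rule UCovI)
          fix v'' y assume v'': "v' \<preceq> v''" "M v'' y a"
          have le: "v \<preceq> v''" "u \<preceq> v''" using le_trans vu' v' v''(1) u'(1) by blast+
          have "M v'' y a'" using M_congR[OF v''(2) E_up[OF E(1) le(2)]] .
          from CovD[OF Cov_up[OF * v''(1)] this] obtain z y' where z: "Rel v'' t z y'" "M v'' y y'"
            by blast
          note tf' = FunC_up[OF tf le(1)]
          from d(2)[OF le(1) FunC_dom[OF tf' z(1)]] obtain y'' where "M v'' y'' d" "Rel v'' t z y''"
            by blast
          then have "M v'' y' d" using FunC_unique[OF tf' _ z(1)] M_congL by blast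
          with z(2) show "\<exists>x. M v'' x d \<and> M v'' y x" by blast
        qed
      qed
      have bb: "M v' y b \<longleftrightarrow> M v' y b'" if "u' \<preceq> v'" for v' y
        using M_congR E_sym E_up[OF E(2) le_trans[OF u'(1) that]] by blast
      have "\<forall>v'. u' \<preceq> v' \<longrightarrow> UCov v' d a \<longrightarrow> Meet v' b Y"
        using iff Y bb unfolding Meet_iff by blast
      with x0(2) vu' u'(2) obtain q where q: "M u' q x0" "Sub u' q Y" "\<forall>v'. u' \<preceq> v' \<longrightarrow> UCov v' d a \<longrightarrow>
        Meet v' q b"
        unfolding USplit_def by blast
      have "M u' q x" using x(2)[OF le_trans[OF v(1) vu']] M_up[OF x0(1) vu'] q(1) by blast
      with q(2,3) iff bb show "\<exists>c. M u' c x \<and> Sub u' c Y \<and> (\<forall>v'. u' \<preceq> v' \<longrightarrow> Cov v' t a' \<longrightarrow>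
        Meet v' c b')"
        unfolding Meet_iff by blast
    qed
  qed (use k s Dk in auto)
  with x(1) show ?thesis by blast
qed

end

text \<open>The quantifiers in \<open>is_upair\<close> and \<open>is_pair\<close> are not bounded, so separation needs these
  equivalents of \<open>is_upair\<close>, \<open>is_pair\<close> and \<open>related\<close>.\<close>

definition is_upair0 :: "var \<Rightarrow> var \<Rightarrow> var \<Rightarrow> form" where
  "is_upair0 u x y = conj (mem x u) (conj (mem y u) (all (\<lambda>z. imp (mem z u) (disj (eq z x) (eq z
    y)))))"

definition is_pair0 :: "var \<Rightarrow> var \<Rightarrow> var \<Rightarrow> form" where
  "is_pair0 p x y = conj (ex (\<lambda>u. conj (mem u p) (is_upair0 u x x))) (conj (ex (\<lambda>u. conj (mem u p)
    (is_upair0 u x y)))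
    (all (\<lambda>u. imp (mem u p) (disj (is_upair0 u x x) (is_upair0 u x y)))))"

definition related0 :: "var \<Rightarrow> var \<Rightarrow> var \<Rightarrow> form" where
  "related0 r x y = ex (\<lambda>p. conj (mem p r) (is_pair0 p x y))"

text \<open>The members of \<open>d\<close> are subsets of \<open>X\<close> and their union is
  closed under \<open>R\<close>. Unlike \<open>is_closed\<close>, this is a bounded formula:
  premises and conclusions range over the set \<open>T\<close>, and the union is not formed but
  expressed through \<open>d\<close>.\<close>

definition is_good :: "var \<Rightarrow> var \<Rightarrow> var \<Rightarrow> var \<Rightarrow> form" where
  "is_good d X R T = conj (all (\<lambda>x. imp (mem x d) (all (\<lambda>y. imp (mem y x) (mem y X)))))
    (all (\<lambda>a. imp (mem a T) (all (\<lambda>b. imp (mem b T) (imp (conj (related0 R a b) (is_ucov d a))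
      (ex (\<lambda>x. conj (mem x b) (ex (\<lambda>z. conj (mem z d) (mem x z))))))))))"

text \<open>The relation for the second dependent choice, over the class of labels from
  \<open>S\<close> that are included in \<open>Y\<close>. As in \<open>is_step\<close>, the clause
  on \<open>k\<close> meets the domain condition of the scheme.\<close>

definition is_step2 :: "var \<Rightarrow> var \<Rightarrow> var \<Rightarrow> var \<Rightarrow> var \<Rightarrow> var \<Rightarrow> var \<Rightarrow> form" where
  "is_step2 f r S Y i t x = conj (mem x S) (conj (is_subset x Y) (conj
    (ex (\<lambda>k. conj (is_fibre k f i) (is_fun_class t k (\<lambda>y. conj (mem y S) (is_subset y Y)))))
    (all (\<lambda>a. all (\<lambda>b. imp (is_rule r i a b) (imp (is_cov t a) (is_meet x b)))))))"

definition is_union :: "var \<Rightarrow> var \<Rightarrow> form" where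
  "is_union c d = all (\<lambda>y. iff (mem y c) (ex (\<lambda>x. conj (mem x d) (mem y x))))"

text \<open>The generating condition for a single point \<open>y\<close>, as a formula, so that
  strong collection can gather sets \<open>G\<close> over all \<open>y \<in> X\<close>.\<close>

definition is_generated :: "var \<Rightarrow> var \<Rightarrow> var \<Rightarrow> var \<Rightarrow> form" where
  "is_generated X R y G = conj
    (all (\<lambda>c. imp (mem c G) (conj (is_subset c X) (is_closed c R))))
    (all (\<lambda>Y. imp (conj (is_subset Y X) (conj (is_closed Y R) (mem y Y)))
      (ex (\<lambda>c. conj (mem c G) (conj (mem y c) (is_subset c Y))))))"

context kripke
begin

definition Good where
  "Good w d X R T \<longleftrightarrow> (\<forall>v x. w \<preceq> v \<longrightarrow> D v x \<longrightarrow> M v x d \<longrightarrow> (\<forall>u y. v \<preceq> u \<longrightarrow> D u y \<longrightarrow> M u y x \<longrightarrow> M u y X)) \<and>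
    (\<forall>v a. w \<preceq> v \<longrightarrow> D v a \<longrightarrow> M v a T \<longrightarrow> (\<forall>u b. v \<preceq> u \<longrightarrow> D u b \<longrightarrow> M u b T \<longrightarrow>
      (\<forall>u1. u \<preceq> u1 \<longrightarrow> D u1 a \<and> Rel u1 R a b \<and> UCov u1 d a \<longrightarrow>
        (\<exists>x. D u1 x \<and> M u1 x b \<and> (\<exists>z. D u1 z \<and> M u1 z d \<and> M u1 x z)))))"

definition Step2 where
  "Step2 w f r S Y i t x \<longleftrightarrow> M w x S \<and> Sub w x Y \<and>
    (\<exists>k. D w k \<and> Fibre w k f i \<and> FunC w t k (\<lambda>v y. M v y S \<and> Sub v y Y)) \<and>
    (\<forall>v a b. w \<preceq> v \<longrightarrow> D v a \<longrightarrow> D v b \<longrightarrow> Rule v r i a b \<longrightarrow> (\<forall>u. v \<preceq> u \<longrightarrow> Cov u t a \<longrightarrow> Meet u x b))"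

definition IsUnion where
  "IsUnion w c d \<longleftrightarrow> (\<forall>v y. w \<preceq> v \<longrightarrow> D v y \<longrightarrow> (M v y c \<longleftrightarrow> (\<exists>x. D v x \<and> M v x d \<and> M v y x)))"

definition Generated where
  "Generated w X R y G \<longleftrightarrow>
    (\<forall>v c. w \<preceq> v \<longrightarrow> D v c \<longrightarrow> M v c G \<longrightarrow> Sub v c X \<and> Closed v c R) \<and>
    (\<forall>v Y. w \<preceq> v \<longrightarrow> D v Y \<longrightarrow> Sub v Y X \<and> Closed v Y R \<and> M v y Y \<longrightarrow>
      (\<exists>c. D v c \<and> M v c G \<and> M v y c \<and> Sub v c Y))"

end

context czf
begin

lemma UPair_bounded:
  "UPair w u x y \<longleftrightarrow> M w x u \<and> M w y u \<and>
    (\<forall>v z. w \<preceq> v \<longrightarrow> D v z \<longrightarrow> M v z u \<longrightarrow> E v z x \<or> E v z y)" (is "_ \<longleftrightarrow> ?R")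
proof
  assume u: "UPair w u x y"
  then show ?R using UPair_iff[OF u] E_refl UPair_D[OF u] UPair_iff[OF UPair_up[OF u]] by blast
next
  assume R: ?R
  then have "M v z u \<longleftrightarrow> E v z x \<or> E v z y" if "w \<preceq> v" for v z
    using that M_up M_congL E_sym M_D1 by blast
  with R show "UPair w u x y" unfolding UPair_def using M_D1 M_D2 by blast
qed

lemma Pair_bounded:
  "Pair w p x y \<longleftrightarrow> (\<exists>u. D w u \<and> M w u p \<and> UPair w u x x) \<and> (\<exists>u. D w u \<and> M w u p \<and> UPair w u x y) \<and>
    (\<forall>v u. w \<preceq> v \<longrightarrow> D v u \<longrightarrow> M v u p \<longrightarrow> UPair v u x x \<or> UPair v u x y)" (is "_ \<longleftrightarrow> ?R")
proof
  assume p: "Pair w p x y"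
  \<comment> \<open>The bounded form claims that {x} and {x, y} are members of \<open>p\<close>, so
    they first have to exist.\<close>
  obtain u1 where u1: "UPair w u1 x x" using Pair_D(2)[OF p] Pair_D(2)[OF p] by (rule pairing)
  obtain u2 where u2: "UPair w u2 x y" using Pair_D(2,3)[OF p] by (rule pairing)
  show ?R using u1 u2 Pair_iff[OF p] Pair_iff[OF Pair_up[OF p]] UPair_D by blast
next
  assume R: ?R
  then obtain u1 u2 where u: "M w u1 p" "UPair w u1 x x" "M w u2 p" "UPair w u2 x y" by blast
  have "M v u p \<longleftrightarrow> UPair v u x x \<or> UPair v u x y" if v: "w \<preceq> v" for v u
    using R v M_D1 M_up[OF u(1) v] M_up[OF u(3) v] M_congL
      UPair_unique[OF UPair_up[OF u(2) v]] UPair_unique[OF UPair_up[OF u(4) v]] by blast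
  then show "Pair w p x y" unfolding Pair_def using u M_D2 UPair_D by blast
qed

lemma sat_upair0 [simp]:
  assumes "i < length xs" "j < length xs" "k < length xs"
  shows "sat w e xs (is_upair0 i j k) \<longleftrightarrow> ok w e xs \<and> UPair w (xs ! i) (xs ! j) (xs ! k)"
  by (rule sat_okI)
    (use assms in \<open>simp (no_asm_simp) add: is_upair0_def UPair_bounded sem cong: conj_cong\<close>)

lemma sat_pair0 [simp]:
  assumes "i < length xs" "j < length xs" "k < length xs"
  shows "sat w e xs (is_pair0 i j k) \<longleftrightarrow> ok w e xs \<and> Pair w (xs ! i) (xs ! j) (xs ! k)"
  by (rule sat_okI)
    (use assms in \<open>simp (no_asm_simp) add: is_pair0_def Pair_bounded sem cong: conj_cong\<close>)

lemma sat_related0 [simp]: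
  assumes "i < length xs" "j < length xs" "k < length xs"
  shows "sat w e xs (related0 i j k) \<longleftrightarrow> ok w e xs \<and> Rel w (xs ! i) (xs ! j) (xs ! k)"
  using assms by (auto simp: related0_def Rel_def sem dest: M_D1 sat_ok)

lemma sat_good [simp]:
  assumes "i < length xs" "j < length xs" "k < length xs" "l < length xs"
  shows "sat w e xs (is_good i j k l) \<longleftrightarrow>
    ok w e xs \<and> Good w (xs ! i) (xs ! j) (xs ! k) (xs ! l)"
  by (rule sat_okI)
    (use assms in \<open>simp (no_asm_simp) add: is_good_def Good_def sem cong: conj_cong\<close>)

lemma sat_step2 [simp]:
  assumes "i < length xs" "j < length xs" "k < length xs" "l < length xs" "m < length xs"
    "n < length xs" "p < length xs"
  shows "sat w e xs (is_step2 i j k l m n p) \<longleftrightarrow>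
    ok w e xs \<and> Step2 w (xs ! i) (xs ! j) (xs ! k) (xs ! l) (xs ! m) (xs ! n) (xs ! p)"
proof (cases "ok w e xs")
  case True
  have ok: "ok v e xs" if "w \<preceq> v" for v using True that by (rule ok_up)
  have ok2: "ok u e xs" if "w \<preceq> v" "v \<preceq> u" for v u using True that by (blast intro: ok_up)
  have fc: "sat v e (xs @ [z]) (is_fun_class n (length xs) (\<lambda>y. conj (mem y k) (is_subset y l))) \<longleftrightarrow>
      ok v e (xs @ [z]) \<and> FunC v (xs ! n) z (\<lambda>v y. M v y (xs ! k) \<and> Sub v y (xs ! l))" for v z
    using assms by (subst sat_fun_class[where K = "\<lambda>v y. M v y (xs ! k) \<and>
      Sub v y (xs ! l)"]) (auto simp: nth_append ok_Cons)
  show ?thesis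
    using assms True by (simp add: is_step2_def Step2_def sem ok ok2 fc D_up cong: conj_cong)
qed (auto dest: sat_ok)

lemma sat_union [simp]:
  assumes "i < length xs" "j < length xs"
  shows "sat w e xs (is_union i j) \<longleftrightarrow>
    ok w e xs \<and> IsUnion w (xs ! i) (xs ! j)"
  by (rule sat_okI)
    (use assms in \<open>simp (no_asm_simp) add: is_union_def IsUnion_def sem cong: conj_cong\<close>)

lemma sat_generated [simp]:
  assumes "i < length xs" "j < length xs" "k < length xs" "l < length xs"
  shows "sat w e xs (is_generated i j k l) \<longleftrightarrow>
    ok w e xs \<and> Generated w (xs ! i) (xs ! j) (xs ! k) (xs ! l)"
  by (rule sat_okI)
    (use assms in \<open>simp (no_asm_simp) add: is_generated_def Generated_def sem cong: conj_cong\<close>)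

section \<open>Lifting families to trees, and the common set of labels\<close>

lemma sup_exists:
  assumes "WType w f A W s" "M w i A" "Fibre w k f i" "Fun w t k W"
  obtains y where "AlgVal w s i t y"
proof -
  obtain P where P: "Poly w P f A W" "Fun w s P W"
    using assms(1) unfolding WType_def Alg_def by blast
  obtain p where p: "Pair w p i t" using M_D1[OF assms(2)] Fun_D(1)[OF assms(4)]
    by (rule pair_exists)
  have "M w p P"
    using P(1) assms(2-4) p Pair_D[OF p] Fibre_D(1)[OF assms(3)] le_refl unfolding Poly_def by blast
  then obtain y where "Rel w s p y" using Fun_total[OF P(2)] by blast
  with p have "AlgVal w s i t y" unfolding AlgVal_def using Pair_D by blast
  then show thesis by (rule that)
qed

lemma Split_mono: "Split w t a b x \<Longrightarrow> Sub w x y \<Longrightarrow> Split w t a b y"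
  unfolding Split_def Sub_def[of w x y] by blast

text \<open>For each position of the base choose a tree whose label contains the value of
  \<open>g\<close>; then \<open>g\<close> selects from the labels along these trees. It is applied
  once with \<open>g\<close> a family of labels and \<open>h\<close> a labelling by sets of labels,
  and once with \<open>g\<close> a cover of a premise and \<open>h\<close> a labelling by subsets of
  \<open>Y\<close>.\<close>

lemma base_lift:
  assumes k: "Base v k" and g: "FunC v g k C" and h: "FunC v h W C'"
    and tot: "\<And>u z y. v \<preceq> u \<Longrightarrow> Rel u g z y \<Longrightarrow> \<exists>\<omega> x. Rel u h \<omega> x \<and> M u y x"
  shows "\<exists>t. Fun v t k W \<and> (\<forall>q. Comp v q h t \<longrightarrow> Sel v g q)"
proof -
  define \<Phi> where "\<Phi> = (\<lambda>v z \<omega>. \<exists>y x. Rel v g z y \<and> Rel v h \<omega> x \<and> M v y x)"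
  have Dgh: "D v g" "D v h" using g h by (auto simp: FunC_def)
  have d: "class_rel v \<Phi>" unfolding \<Phi>_def
    by (rule class_relI[of g "[h]" v _ "ex (\<lambda>u. ex (\<lambda>x. conj (related 0 3 u) (conj (related 1 2 x)
      (mem u x))))"])
      (use Dgh in \<open>auto simp: sat_ex' ok_Cons ok_const numeral_eq_Suc dest: Rel_D\<close>)
  have "total v k \<Phi>"
  proof (rule totalI)
    fix u z assume u: "v \<preceq> u" "M u z k"
    obtain y where "Rel u g z y" using FunC_total[OF FunC_up[OF g u(1)] u(2)] by blast
    with tot[OF u(1)] show "\<exists>\<omega>. D u \<omega> \<and> \<Phi> u z \<omega>" unfolding \<Phi>_def using Rel_D(2) by blast
  qed
  from base_choice[OF k d this] obtain t where t: "FunC v t k D"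
    "\<And>u z \<omega>. v \<preceq> u \<Longrightarrow> Rel u t z \<omega> \<Longrightarrow> \<Phi> u z \<omega>"
    by blast
  have "Fun v t k W"
    unfolding Fun_def
  proof
    show "D v W" using h by (simp add: FunC_def)
    show "FunC v t k (\<lambda>v y. M v y W)"
    proof (rule FunC_restrict[OF t(1)])
      fix u z y assume u: "v \<preceq> u" "Rel u t z y"
      from t(2)[OF u] obtain x where "Rel u h y x" unfolding \<Phi>_def by blast
      then show "M u y W" by (rule FunC_dom[OF FunC_up[OF h u(1)]])
    qed
  qed
  moreover have "Sel v g q" if q: "Comp v q h t" for q
    unfolding Sel_def
  proof (intro allI impI)
    fix u z y assume u: "v \<preceq> u" and y: "Rel u g z y"
    note gu = FunC_up[OF g u]
    obtain \<omega> where \<omega>: "Rel u t z \<omega>" using FunC_total[OF FunC_up[OF t(1) u] FunC_dom[OF gu y]]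
      by blast
    from t(2)[OF u \<omega>] obtain y' x where x: "Rel u g z y'" "Rel u h \<omega> x" "M u y' x"
      unfolding \<Phi>_def by blast
    have "M u y x" using x(3) FunC_unique[OF gu x(1) y] by (rule M_congL)
    moreover have "Rel u q z x" using Comp_Rel[OF Comp_up[OF q u] \<omega> x(2)] .
    ultimately show "\<exists>x. D u x \<and> Rel u q z x \<and> M u y x" using Rel_D(3) by blast
  qed
  ultimately show ?thesis by blast
qed

text \<open>One set of labels that suffices at every node: the new labels are found in the set from
  which the labels at the subtrees come.\<close>

definition Dense where
  "Dense w f r S \<longleftrightarrow> (\<forall>v i k t a b. w \<preceq> v \<longrightarrow> Fibre v k f i \<longrightarrow> Base v k \<longrightarrow> Fun v t k S \<longrightarrow>
    Rule v r i a b \<longrightarrow> Split v t a b S)"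

lemma dense_family:
  assumes r: "Fun w r A R" and R: "RuleSet w R X" and f: "BaseMap w f B A" and W: "WType w f A W s"
  shows "\<exists>S. D w S \<and> Dense w f r S"
proof -
  have D: "D w f" "D w r" using f r by (auto simp: BaseMap_def dest: Fun_D)
  have "\<exists>h. FunC w h W D \<and> (\<forall>v i t y. w \<preceq> v \<longrightarrow> AlgVal v s i t y \<longrightarrow>
    (\<exists>u x. Comp v u h t \<and> Rel v h y x \<and> D v x \<and> Step v f r i u x))"
  \<comment> \<open>The values of the first choice are unrestricted, so their class is given by
    \<open>x = x\<close>. Levels 0 and 1 are the parameters \<open>f\<close> and \<open>r\<close>;
    levels 2, 3, 4 are \<open>x\<close>, \<open>t\<close>, \<open>i\<close>.\<close>
  proof (rule W_choice[OF f W, of "\<lambda>_. f" "[f, r]" D "eq 2 2" "\<lambda>v i t x. D v x \<and> Step v f r i t x"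
    "is_step 0 1 4 3 2"])
    show "ok w (\<lambda>_. f) [f, r]" using D by (simp add: ok_def)
    show "D v x \<longleftrightarrow> sat v (\<lambda>_. f) ([f, r] @ [x]) (eq 2 2)" if "w \<preceq> v" "D v x" for v x
      using that D_up[OF _ that(1)] D by (simp add: ok_def E_refl)
    show "D v x \<and> Step v f r i t x \<longleftrightarrow> sat v (\<lambda>_. f) ([f, r] @ [x, t, i]) (is_step 0 1 4 3 2)"
      if "w \<preceq> v" "D v i" "D v t" "D v x" for v i t x
      using that D_up[OF _ that(1)] D by (simp add: ok_def numeral_eq_Suc)
  next
    fix v i k t x assume v: "w \<preceq> v" "Fibre v k f i" "D v x \<and> Step v f r i t x" and "M v i A"
    then obtain k' where k': "Fibre v k' f i" "FunC v t k' D" unfolding Step_def by blast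
    have "FunC v t k D" using FunC_cong_dom[OF k'(2) Fibre_unique[OF k'(1) v(2)]] .
    with v(3) show "FunC v t k D \<and> D v x" by blast
  next
    fix v i k t assume "w \<preceq> v" "M v i A" "Fibre v k f i" "FunC v t k D"
    then show "\<exists>x. D v x \<and> D v x \<and> Step v f r i t x"
      using step_exists[OF Fun_up[OF r] RuleSet_up[OF R]] by blast
  qed
  then obtain h where h: "FunC w h W D"
    "\<And>v i t y. w \<preceq> v \<Longrightarrow> AlgVal v s i t y \<Longrightarrow> \<exists>u x. Comp v u h t \<and> Rel v h y x \<and> Step v f r i u x"
    by blast
  obtain S0 where S0: "D w S0" "\<And>v y. w \<preceq> v \<Longrightarrow> M v y S0 \<longleftrightarrow> (\<exists>x. Rel v h x y)"
    using range_exists[OF h(1)] by blast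
  obtain S where S: "D w S" "\<And>v x. w \<preceq> v \<Longrightarrow> M v x S \<longleftrightarrow> (\<exists>y. M v y S0 \<and> M v x y)"
    using union[OF S0(1)] by blast
  have "Dense w f r S"
    unfolding Dense_def
  proof (intro allI impI)
    fix v i k t a b assume v: "w \<preceq> v" and k: "Fibre v k f i" "Base v k" and t: "Fun v t k S" and ab:
      "Rule v r i a b"
    note hv = FunC_up[OF h(1) v]
    have "\<exists>\<omega> x. Rel u h \<omega> x \<and> M u y x" if u: "v \<preceq> u" "Rel u t z y" for u z y
      using Fun_ran[OF Fun_up[OF t u(1)] u(2)] S(2)[OF le_trans[OF v u(1)]] S0(2)[OF le_trans[OF v
        u(1)]]
      by blast
    \<comment> \<open>Each value of \<open>t\<close> lies in the label set of some tree, so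
      \<open>t\<close> is a selection from the label sets along \<open>t0\<close>, and the label set
      at the supremum of \<open>t0\<close> is adequate for \<open>t\<close>.\<close>
    then obtain t0 where t0: "Fun v t0 k W" and sel: "\<And>q. Comp v q h t0 \<Longrightarrow> Sel v t q"
      using base_lift[OF k(2) Fun_FunC[OF t] hv] by blast
    have "M v i A" using Rule_Rel[OF Fun_up[OF r v] ab] by blast
    then obtain y where "AlgVal v s i t0 y"
      using sup_exists[OF WType_up[OF W v]] k(1) t0 by blast
    from h(2)[OF v this] obtain u x where ux: "Comp v u h t0" "Rel v h y x" "Step v f r i u x"
      by blast
    obtain k' where k': "Fibre v k' f i" and
      step: "\<And>t a b. D v t \<Longrightarrow> FunC v t k' D \<Longrightarrow> Sel v t u \<Longrightarrow> D v a \<Longrightarrow> D v b \<Longrightarrow> Rule v r i a b \<Longrightarrow>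
        Split v t a b x"
      using ux(3) le_refl Fibre_D(1) unfolding Step_def by blast
    have tk': "FunC v t k' D"
    proof (rule FunC_cong_dom[OF _ Fibre_unique[OF k(1) k']])
      show "FunC v t k D" by (rule FunC_mono[OF Fun_FunC[OF t]]) blast
    qed
    from step[OF Fun_D(1)[OF t] tk' sel[OF ux(1)] _ _ ab] have "Split v t a b x"
      using ab Pair_D unfolding Rule_def by blast
    moreover have "Sub v x S"
      unfolding Sub_def
    proof (intro conjI allI impI)
      show "D v x" using Rel_D(3)[OF ux(2)] .
      show "D v S" using D_up[OF S(1) v] .
      fix v' c assume "v \<preceq> v'" "M v' c x"
      then show "M v' c S" using S(2) S0(2) le_trans[OF v] Rel_up[OF ux(2)] by blast
    qed
    ultimately show "Split v t a b S" by (rule Split_mono)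
  qed
  with S(1) show ?thesis by blast
qed

text \<open>With Kuratowski pairs, \<open>a\<close> and \<open>b\<close> are members of a member of
  the pair, hence lie in the double union of \<open>R\<close>.\<close>

lemma Rel_union:
  assumes "D w R"
  obtains T where "D w T" "\<And>v a b. w \<preceq> v \<Longrightarrow> Rel v R a b \<Longrightarrow> M v a T \<and> M v b T"
proof -
  obtain T1 where T1: "D w T1" "\<And>v x. w \<preceq> v \<Longrightarrow> M v x T1 \<longleftrightarrow> (\<exists>y. M v y R \<and> M v x y)"
    using union[OF assms] by blast
  obtain T where T: "D w T" "\<And>v x. w \<preceq> v \<Longrightarrow> M v x T \<longleftrightarrow> (\<exists>y. M v y T1 \<and> M v x y)"
    using union[OF T1(1)] by blast
  have "M v a T \<and> M v b T" if v: "w \<preceq> v" and ab: "Rel v R a b" for v a b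
  proof -
    obtain p where p: "M v p R" "Pair v p a b" using ab unfolding Rel_def by blast
    obtain u where u: "UPair v u a b" using Pair_D(2,3)[OF p(2)] by (rule pairing)
    have "M v u T1" using T1(2)[OF v] p(1) u Pair_iff[OF p(2)] by blast
    then show ?thesis using T(2)[OF v] UPair_iff[OF u] E_refl Pair_D[OF p(2)] by blast
  qed
  with T(1) show thesis by (rule that)
qed

subsection \<open>Generating sets\<close>

text \<open>Levels 0 to 3 are \<open>X\<close>, \<open>R\<close>, \<open>T\<close>,
  \<open>d\<close>; the last argument is the resulting depth.\<close>

lemma bounded_is_good: "bounded (is_good (Suc (Suc (Suc 0))) 0 (Suc 0) (Suc (Suc 0)) (Suc (Suc (Suc
  (Suc 0)))))"
  by (auto simp: is_good_def is_ucov_def related0_def is_pair0_def is_upair0_def all_def ex_def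
    mem_def
      eq_def conj_def disj_def imp_def numeral_eq_Suc intro!: bounded.intros)

lemma generating_family:
  assumes R: "RuleSet w R X"
  shows "\<exists>G. D w G \<and> (\<forall>v c. w \<preceq> v \<longrightarrow> M v c G \<longrightarrow> Sub v c X \<and> Closed v c R) \<and>
    (\<forall>v Y. w \<preceq> v \<longrightarrow> Sub v Y X \<longrightarrow> Closed v Y R \<longrightarrow> (\<exists>c. M v c G \<and> Sub v c Y))"
proof -
  have RX: "D w R" "D w X" using R by (auto simp: RuleSet_def)
  obtain A r B f where r: "Surj w r A R" and f: "BaseMap w f B A"
    and cover: "\<And>v i a b. w \<preceq> v \<Longrightarrow> Rule v r i a b \<Longrightarrow> \<exists>k g. Fibre v k f i \<and> Base v k \<and> Surj v g k a"
    using base_map_exists[OF R] by blast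
  note rf = Surj_Fun[OF r]
  obtain W s where W: "WType w f A W s" using W_type[OF f] by blast
  have DW: "D w W" using W Alg_D unfolding WType_def by blast
  have Dfr: "D w f" "D w r" using f r by (auto simp: BaseMap_def dest: Fun_D Surj_D)
  obtain S where S: "D w S" "Dense w f r S" using dense_family[OF rf R f W] by blast
  obtain T where T: "D w T" "\<And>v a b. w \<preceq> v \<Longrightarrow> Rel v R a b \<Longrightarrow> M v a T \<and> M v b T"
    using Rel_union[OF RX(1)] by blast
  have d3: "class_rel3 w (\<lambda>v x y h. Rel v h x y)"
    by (rule class_rel3I[of W "[]" w _ "related 1 3 2"]) (use DW in auto)
  from subset_collection[OF DW S(1) d3] obtain c where c: "D w c"
    "\<And>v h. w \<preceq> v \<Longrightarrow> D v h \<Longrightarrow> (\<And>v' x. v \<preceq> v' \<Longrightarrow> M v' x W \<Longrightarrow> \<exists>y. M v' y S \<and> Rel v' h x y) \<Longrightarrow>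
      \<exists>d. M v d c \<and> (\<forall>v' x. v \<preceq> v' \<longrightarrow> M v' x W \<longrightarrow> (\<exists>y. M v' y d \<and> Rel v' h x y)) \<and>
        (\<forall>v' y. v \<preceq> v' \<longrightarrow> M v' y d \<longrightarrow> (\<exists>x. M v' x W \<and> Rel v' h x y))"
    by blast
  have d1: "bounded_class w (\<lambda>v d. Good v d X R T)"
    by (rule bounded_classI[of X "[R, T]" w "is_good 3 0 1 2"])
      (use RX T(1) bounded_is_good in \<open>auto simp: numeral_eq_Suc\<close>)
  \<comment> \<open>Subset collection says nothing about the other members of \<open>c\<close>, so
    those whose union is a closed subset of \<open>X\<close> are separated.\<close>
  obtain c2 where c2: "D w c2" "\<And>v d. w \<preceq> v \<Longrightarrow> M v d c2 \<longleftrightarrow> M v d c \<and> Good v d X R T"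
    using separation[OF c(1) d1] by blast
  have d2: "class_rel w (\<lambda>v d g. IsUnion v g d)"
    by (rule class_relI[of X "[]" w _ "is_union 1 2"]) (use RX in \<open>auto simp: numeral_eq_Suc\<close>)
  have union': "\<exists>g. D v g \<and> IsUnion v g d" if "D v d" for v d
    using union[OF that] M_D1 unfolding IsUnion_def by metis
  have IsU: "M v y g \<longleftrightarrow> (\<exists>x. M v x d \<and> M v y x)" if "IsUnion v0 g d" "v0 \<preceq> v" for v0 v y g d
    using that M_D1 unfolding IsUnion_def by blast
  have t: "total w c2 (\<lambda>v d g. IsUnion v g d)"
    by (rule totalI) (use union' M_D1 in blast)
  obtain G where G: "D w G"
    "\<And>v d. w \<preceq> v \<Longrightarrow> M v d c2 \<Longrightarrow> \<exists>g. M v g G \<and> IsUnion v g d"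
    "\<And>v g. w \<preceq> v \<Longrightarrow> M v g G \<Longrightarrow> \<exists>d. M v d c2 \<and> IsUnion v g d"
    using collection[OF c2(1) d2 t] by blast
  have "Sub v g X \<and> Closed v g R" if v: "w \<preceq> v" and g: "M v g G" for v g
  proof -
    obtain d where d: "M v d c2" "IsUnion v g d" using G(3)[OF v g] by blast
    have good: "Good v d X R T" using c2(2)[OF v] d(1) by blast
    have "Sub v g X"
      unfolding Sub_def
    proof (intro conjI allI impI)
      show "D v g" "D v X" using M_D1[OF g] D_up[OF RX(2) v] by auto
      fix u y assume u: "v \<preceq> u" "M u y g"
      then obtain x where "M u x d" "M u y x" using IsU[OF d(2) u(1)] by blast
      then show "M u y X" using conjunct1[OF good[unfolded Good_def]] u(1) M_D1 le_refl by blast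
    qed
    moreover have "Closed v g R"
      unfolding Closed_def
    proof (intro conjI allI impI)
      show "D v g" "D v R" using M_D1[OF g] D_up[OF RX(1) v] by auto
      fix u a b u' assume u: "v \<preceq> u" "Rel u R a b" "u \<preceq> u'" "Sub u' a g"
      note vu' = le_trans[OF u(1,3)]
      have R': "Rel u' R a b" using Rel_up[OF u(2,3)] .
      have ab: "M u' a T" "M u' b T" using T(2)[OF le_trans[OF v vu'] R'] by auto
      have "UCov u' d a"
        by (rule UCovI) (use u(4) IsU[OF d(2) le_trans[OF vu']] in \<open>unfold Sub_def, blast\<close>)
      then obtain x z where "M u' x b" "M u' z d" "M u' x z"
        using conjunct2[OF good[unfolded Good_def]] vu' ab R' M_D1 le_refl by meson
      then show "\<exists>x. D u' x \<and> M u' x b \<and> M u' x g"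
        using IsU[OF d(2) vu'] M_D1 by blast
    qed
    ultimately show ?thesis ..
  qed
  moreover have "\<exists>g. M v g G \<and> Sub v g Y" if v: "w \<preceq> v" and Y: "Sub v Y X" "Closed v Y R" for v Y
  proof -
    \<comment> \<open>Labels come from \<open>S\<close>, so that subset collection reaches their
      ranges, and are included in \<open>Y\<close>, so that their union is.\<close>
    let ?C = "\<lambda>v x. M v x S \<and> Sub v x Y"
    note D = D_up[OF Dfr(1) v] D_up[OF Dfr(2) v] D_up[OF S(1) v] Sub_D(1)[OF Y(1)]
    have "\<exists>h. FunC v h W ?C \<and> (\<forall>v' i t y. v \<preceq> v' \<longrightarrow> AlgVal v' s i t y \<longrightarrow>
      (\<exists>u x. Comp v' u h t \<and> Rel v' h y x \<and> Step2 v' f r S Y i u x))"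
    proof (rule W_choice[OF BaseMap_up[OF f v] WType_up[OF W v], of "\<lambda>_. f" "[f, r, S, Y]" ?C
      "conj (mem 4 2) (is_subset 4 3)"
          "\<lambda>v' i t x. Step2 v' f r S Y i t x" "is_step2 0 1 2 3 6 5 4"])
      show "ok v (\<lambda>_. f) [f, r, S, Y]" using D by (simp add: ok_def)
      show "?C u x \<longleftrightarrow> sat u (\<lambda>_. f) ([f, r, S, Y] @ [x]) (conj (mem 4 2) (is_subset 4 3))"
        if "v \<preceq> u" "D u x" for u x
        using that D_up[OF _ that(1)] D by (simp add: ok_def numeral_eq_Suc)
      show "Step2 u f r S Y i t x \<longleftrightarrow> sat u (\<lambda>_. f) ([f, r, S, Y] @ [x, t, i]) (is_step2 0 1 2 3 6 5
        4)"
        if "v \<preceq> u" "D u i" "D u t" "D u x" for u i t x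
        using that D_up[OF _ that(1)] D by (simp add: ok_def numeral_eq_Suc)
    next
      fix u i k t x assume u: "v \<preceq> u" "Fibre u k f i" "Step2 u f r S Y i t x"
      then obtain k' where k': "Fibre u k' f i" "FunC u t k' ?C" unfolding Step2_def by blast
      have "FunC u t k ?C" using FunC_cong_dom[OF k'(2) Fibre_unique[OF k'(1) u(2)]] .
      with u(3) show "FunC u t k ?C \<and> ?C u x" unfolding Step2_def by blast
    next
      fix u i k t assume u: "v \<preceq> u" and i: "M u i A" and k: "Fibre u k f i" and t: "FunC u t k ?C"
      note wu = le_trans[OF v u]
      obtain a b where ab: "Rule u r i a b" using Rule_exists[OF Fun_up[OF rf wu] RuleSet_up[OF R
        wu] i] by blast
      have "Base u k"
        using BaseMap_up[OF f wu] i k M_D1 Fibre_D(1) le_refl unfolding BaseMap_def by blast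
      moreover have "Fun u t k S"
        unfolding Fun_def using FunC_mono[OF t, of "\<lambda>v y. M v y S"] D_up[OF D(3) u] by blast
      ultimately have split: "Split u t a b S" using S(2) wu k ab unfolding Dense_def by blast
      \<comment> \<open>If the labels along \<open>t\<close> cover \<open>a\<close>, then
        \<open>a \<subseteq> Y\<close>, as labels are subsets of \<open>Y\<close>; so
        \<open>Y\<close>, being closed, meets \<open>b\<close>. This is just what
        \<open>Split\<close> asks of \<open>Y\<close>.\<close>
      have "Meet u' b Y" if u': "u \<preceq> u'" and cov: "Cov u' t a" for u'
      proof -
        have "Sub u' a Y"
          unfolding Sub_def
        proof (intro conjI allI impI)
          show "D u' a" using Rule_up[OF ab u'] Pair_D unfolding Rule_def by blast
          show "D u' Y" using D_up[OF D(4) le_trans[OF u u']] .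
          fix v' y assume v': "u' \<preceq> v'" "M v' y a"
          obtain z x where zx: "Rel v' t z x" "M v' y x" using CovD[OF Cov_up[OF cov v'(1)] v'(2)]
            by blast
          obtain p where p: "M v' p t" "Pair v' p z x" using zx(1) unfolding Rel_def by blast
          obtain z' x' where "Sub v' x' Y" "Pair v' p z' x'"
            using FunC_mem[OF FunC_up[OF t le_trans[OF u' v'(1)]] p(1)] by blast
          then show "M v' y Y" using Pair_inj[OF p(2)] M_congR[OF zx(2)] le_refl unfolding Sub_def
            by blast
        qed
        moreover have "Rel u' R a b" using Rule_Rel[OF Fun_up[OF rf le_trans[OF wu u']] Rule_up[OF
          ab u']] by blast
        ultimately show ?thesis
          using Closed_up[OF Y(2) le_trans[OF u u']] Rel_D le_refl unfolding Closed_def Meet_def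
            by blast
      qed
      then obtain x where x: "M u x S" "Sub u x Y" "\<forall>u'. u \<preceq> u' \<longrightarrow> Cov u' t a \<longrightarrow> Meet u' x b"
        using split D_up[OF D(4) u] le_refl unfolding Split_def by blast
      have "Step2 u f r S Y i t x"
        unfolding Step2_def
      proof (intro conjI allI impI)
        fix v' a' b' v'' assume v': "u \<preceq> v'" "Rule v' r i a' b'" "v' \<preceq> v''" "Cov v'' t a'"
        have E: "E v' a a'" "E v' b b'"
          using Rule_unique[OF Fun_up[OF rf le_trans[OF wu v'(1)]] Rule_up[OF ab v'(1)] v'(2)]
            by blast+
        have "Cov v'' t a"
        proof (rule CovI)
          fix u' y assume u': "v'' \<preceq> u'" "M u' y a"
          have "M u' y a'" using M_congR[OF u'(2) E_up[OF E(1) le_trans[OF v'(3) u'(1)]]] .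
          then show "\<exists>z x. Rel u' t z x \<and> M u' y x" using CovD[OF Cov_up[OF v'(4) u'(1)]] by blast
        qed
        then have "Meet v'' x b" using x(3) le_trans[OF v'(1,3)] by blast
        then show "Meet v'' x b'" unfolding Meet_iff using M_congR E_up[OF E(2) v'(3)] by blast
      next
        show "\<exists>k. D u k \<and> Fibre u k f i \<and> FunC u t k ?C" using k t Fibre_D(1)[OF k] by blast
      qed (use x in blast)+
      then show "\<exists>x. D u x \<and> Step2 u f r S Y i t x" using M_D1[OF x(1)] by blast
    qed
    then obtain h where h: "FunC v h W ?C"
      "\<And>v' i t y. v \<preceq> v' \<Longrightarrow> AlgVal v' s i t y \<Longrightarrow> \<exists>u x. Comp v' u h t \<and> Rel v' h y x \<and>
        Step2 v' f r S Y i u x"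
      by blast
    have hC: "?C u x" if u: "v \<preceq> u" and x: "Rel u h y x" for u y x
    proof (rule FunC_ran[OF FunC_up[OF h(1) u] x])
      fix y y' assume *: "?C u y" "E u y y'"
      have "M v' z y'" if v': "u \<preceq> v'" and "M v' z y" for v' z using that E_up[OF *(2) v'] M_congR
        by blast
      moreover have "Sub u y' Y"
        unfolding Sub_def
      proof (intro conjI allI impI)
        show "D u y'" "D u Y" using * E_D2 Sub_D by blast+
        fix v' z assume v': "u \<preceq> v'" "M v' z y'"
        then have "M v' z y" using M_congR E_sym E_up[OF *(2) v'(1)] by blast
        then show "M v' z Y" using *(1) v'(1) unfolding Sub_def by blast
      qed
      ultimately show "?C u y'" using * M_congL by blast
    qed
    have Dh: "D v h" using h(1) by (simp add: FunC_def)
    have tot: "\<exists>y. M v' y S \<and> Rel v' h x y" if v': "v \<preceq> v'" "M v' x W" for v' x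
      using FunC_total[OF FunC_up[OF h(1) v'(1)] v'(2)] hC[OF v'(1)] by blast
    obtain d where d: "M v d c"
      "\<And>v' x. v \<preceq> v' \<Longrightarrow> M v' x W \<Longrightarrow> \<exists>y. M v' y d \<and> Rel v' h x y"
      "\<And>v' y. v \<preceq> v' \<Longrightarrow> M v' y d \<Longrightarrow> \<exists>x. Rel v' h x y"
      using c(2)[OF v Dh] tot by blast
    have dran: "M v' y d" if v': "v \<preceq> v'" and y: "Rel v' h x y" for v' x y
    proof -
      note h' = FunC_up[OF h(1) v']
      obtain y' where "M v' y' d" "Rel v' h x y'" using d(2)[OF v' FunC_dom[OF h' y]] by blast
      then show ?thesis using FunC_unique[OF h' _ y] M_congL by blast
    qed
    have dY: "M u y Y" if u: "v \<preceq> u" and x: "M u x d" "M u y x" for u x y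
      using d(3)[OF u x(1)] hC[OF u] x(2) le_refl unfolding Sub_def by blast
    \<comment> \<open>If the labels cover \<open>a\<close>, every value of the base cover
      \<open>g\<close> lies in some label. Lifting \<open>g\<close> gives a family of trees whose
      labels cover \<open>a\<close>, so the label at its supremum has to meet
      \<open>b\<close>.\<close>
    have step: "\<exists>x z. M u x b \<and> M u z d \<and> M u x z" if u: "v \<preceq> u" and ab: "Rel u R a b" and cov:
      "UCov u d a" for u a b
    proof -
      note wu = le_trans[OF v u]
      obtain p where p: "M u p R" "Pair u p a b" using ab unfolding Rel_def by blast
      obtain i where i: "M u i A" "Rel u r i p" using Surj_onto[OF Surj_up[OF r wu] p(1)] by blast
      have rule: "Rule u r i a b" unfolding Rule_def using i(2) p(2) Pair_D by blast
      obtain k g where k: "Fibre u k f i" "Base u k" "Surj u g k a" using cover[OF wu rule] by blast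
      note gf = Surj_Fun[OF k(3)]
      have "\<exists>\<omega> x. Rel v' h \<omega> x \<and> M v' y x" if v': "u \<preceq> v'" "Rel v' g z y" for v' z y
        using UCovD[OF UCov_up[OF cov v'(1)] Fun_ran[OF Fun_up[OF gf v'(1)] v'(2)]]
          d(3)[OF le_trans[OF u v'(1)]] by blast
      then obtain t0 where t0: "Fun u t0 k W" and sel: "\<And>q. Comp u q h t0 \<Longrightarrow> Sel u g q"
        using base_lift[OF k(2) Fun_FunC[OF gf] FunC_up[OF h(1) u]] by blast
      obtain y0 where y0: "AlgVal u s i t0 y0" using sup_exists[OF WType_up[OF W wu] i(1) k(1) t0]
        by blast
      obtain q x where q: "Comp u q h t0" "Rel u h y0 x" "Step2 u f r S Y i q x" using h(2)[OF u y0]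
        by blast
      have "Cov u q a"
      proof (rule CovI)
        fix v' y assume v': "u \<preceq> v'" "M v' y a"
        obtain z where z: "M v' z k" "Rel v' g z y" using Surj_onto[OF Surj_up[OF k(3) v'(1)] v'(2)]
          by blast
        then show "\<exists>z x. Rel v' q z x \<and> M v' y x"
          using sel[OF q(1)] v'(1) Rel_D unfolding Sel_def by blast
      qed
      then have "Meet u x b" using q(3) rule Pair_D[OF p(2)] le_refl unfolding Step2_def by blast
      then show ?thesis using dran[OF u q(2)] unfolding Meet_iff by blast
    qed
    have "Good v d X R T"
      unfolding Good_def
    proof (intro conjI allI impI)
      fix u x u' y assume u: "v \<preceq> u" "M u x d" "u \<preceq> u'" "M u' y x"
      have "M u' y Y" using dY[OF le_trans[OF u(1,3)] M_up[OF u(2,3)] u(4)] .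
      then show "M u' y X" using Y(1) le_trans[OF u(1,3)] unfolding Sub_def by blast
    next
      fix u a u' b u'' assume u: "v \<preceq> u" "u \<preceq> u'" "u' \<preceq> u''" and *: "D u'' a \<and> Rel u'' R a b \<and>
        UCov u'' d a"
      have "v \<preceq> u''" using u le_trans by blast
      from step[OF this] * show "\<exists>x. D u'' x \<and> M u'' x b \<and> (\<exists>z. D u'' z \<and> M u'' z d \<and> M u'' x z)"
        using M_D1 by blast
    qed
    then have "M v d c2" using c2(2)[OF v] d(1) by blast
    then obtain g where g: "M v g G" "IsUnion v g d" using G(2)[OF v] by blast
    have "Sub v g Y"
      unfolding Sub_def using M_D1[OF g(1)] D(4) IsU[OF g(2)] dY by blast
    with g(1) show ?thesis by blast
  qed
  ultimately show ?thesis using G(1) by blast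
qed

section \<open>Closed sets through a given point\<close>

lemma generated_exists:
  assumes R: "RuleSet w R X" and y: "M w y X"
  shows "\<exists>G. D w G \<and> Generated w X R y G"
proof -
  have RX: "D w R" "D w X" using R by (auto simp: RuleSet_def)
  have d1: "bounded_class w (\<lambda>_ _. False)"
  proof (rule bounded_classI[of X "[]" w bot])
    show "bounded (bot (Suc (Suc (length []))))" by (simp add: bot_def bounded.intros)
  qed (use RX in auto)
  obtain e0 where e0: "D w e0" "\<And>v x. w \<preceq> v \<Longrightarrow> \<not> M v x e0"
    by (rule separation[OF RX(2) d1]) simp
  obtain y1 where y1: "UPair w y1 y y" using M_D1[OF y] M_D1[OF y] by (rule pairing)
  obtain p0 where p0: "Pair w p0 e0 y1" using e0(1) UPair_D(1)[OF y1] by (rule pair_exists)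
  \<comment> \<open>\<open>R'\<close> will be \<open>R\<close> with the rule \<open>p0\<close>
    added, formed as the union of the pair consisting of \<open>R\<close> and {p0}.\<close>
  obtain s where s: "UPair w s p0 p0" using Pair_D(1)[OF p0] Pair_D(1)[OF p0] by (rule pairing)
  obtain q where q: "UPair w q R s" using RX(1) UPair_D(1)[OF s] by (rule pairing)
  obtain R' where R': "D w R'" "\<And>v x. w \<preceq> v \<Longrightarrow> M v x R' \<longleftrightarrow> (\<exists>z. M v z q \<and> M v x z)"
    using union[OF UPair_D(1)[OF q]] by blast
  have R'_iff: "M v p R' \<longleftrightarrow> M v p R \<or> E v p p0" if v: "w \<preceq> v" for v p
  proof -
    note qv = UPair_up[OF q v] and sv = UPair_up[OF s v]
    have "M v R q" "M v s q" using UPair_iff[OF qv] E_refl UPair_D[OF qv] by blast+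
    then show ?thesis
      using R'(2)[OF v] UPair_iff[OF qv] UPair_iff[OF sv] M_congR by blast
  qed
  have "RuleSet w R' X"
    unfolding RuleSet_def
  proof (intro conjI allI impI)
    fix v p assume v: "w \<preceq> v" and "M v p R'"
    then consider "M v p R" | "E v p p0" using R'_iff by blast
    then show "\<exists>a. D v a \<and> (\<exists>b. D v b \<and> Sub v a X \<and> Sub v b X \<and> Pair v p a b)"
    proof cases
      case 1
      then show ?thesis using R v M_D1 unfolding RuleSet_def by blast
    next
      case 2
      have "Pair v p e0 y1" using Pair_congP[OF Pair_up[OF p0 v] E_sym[OF 2]] .
      moreover have "Sub v e0 X"
        unfolding Sub_def using e0(2) le_trans[OF v] D_up[OF e0(1) v] D_up[OF RX(2) v] by blast
      moreover have "Sub v y1 X"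
        unfolding Sub_def
      proof (intro conjI allI impI)
        fix u z assume u: "v \<preceq> u" "M u z y1"
        note wu = le_trans[OF v u(1)]
        have "E u z y" using UPair_iff[OF UPair_up[OF y1 wu]] u(2) by blast
        then show "M u z X" using M_congL[OF M_up[OF y wu]] E_sym by blast
      qed (use D_up[OF RX(2) v] D_up[OF UPair_D(1)[OF y1] v] in auto)
      ultimately show ?thesis using Pair_D by blast
    qed
  qed (use R'(1) RX in auto)
  from generating_family[OF this] obtain G where G: "D w G"
    "\<And>v c. w \<preceq> v \<Longrightarrow> M v c G \<Longrightarrow> Sub v c X \<and> Closed v c R'"
    "\<And>v Y. w \<preceq> v \<Longrightarrow> Sub v Y X \<Longrightarrow> Closed v Y R' \<Longrightarrow> \<exists>c. M v c G \<and> Sub v c Y"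
    by blast
  have Rel': "Rel v R' a b \<longleftrightarrow> Rel v R a b \<or> E v a e0 \<and> E v b y1" if v: "w \<preceq> v" for v a b
  proof
    assume "Rel v R' a b"
    then obtain p where p: "M v p R'" "Pair v p a b" unfolding Rel_def by blast
    from p(1) consider "M v p R" | "E v p p0" using R'_iff[OF v] by blast
    then show "Rel v R a b \<or> E v a e0 \<and> E v b y1"
    proof cases
      case 1
      then show ?thesis using p(2) unfolding Rel_def by blast
    next
      case 2
      have "Pair v p0 a b" using p(2) 2 by (rule Pair_congP)
      then show ?thesis using Pair_inj Pair_up[OF p0 v] by blast
    qed
  next
    assume "Rel v R a b \<or> E v a e0 \<and> E v b y1"
    then show "Rel v R' a b"
    proof
      assume "Rel v R a b"
      then show ?thesis using R'_iff[OF v] unfolding Rel_def by blast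
    next
      assume E: "E v a e0 \<and> E v b y1"
      have "Pair v p0 a b"
        using Pair_cong[OF Pair_up[OF p0 v]] E E_sym E_refl D_up[OF Pair_D(1)[OF p0] v] by blast
      then show ?thesis using R'_iff[OF v] E_refl D_up[OF Pair_D(1)[OF p0] v] unfolding Rel_def
        by blast
    qed
  qed
  \<comment> \<open>Together with \<open>closedI\<close>: the sets closed under \<open>R'\<close>
    are the \<open>R\<close>-closed sets that contain \<open>y\<close>, since the premise of the
    added rule is empty and \<open>y\<close> is the only element of its conclusion.\<close>
  have closedD: "Closed v c R \<and> M v y c" if v: "w \<preceq> v" and c: "Closed v c R'" for v c
  proof
    have Dc: "D v c" using c unfolding Closed_def by blast
    show "Closed v c R"
      unfolding Closed_def
    proof (intro conjI allI impI)
      fix u a b u' assume u: "v \<preceq> u" "D u a" "D u b" "Rel u R a b" "u \<preceq> u'" "Sub u' a c"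
      have "Rel u R' a b" using Rel'[OF le_trans[OF v u(1)]] u(4) by blast
      then show "\<exists>x. D u' x \<and> M u' x b \<and> M u' x c" using c u unfolding Closed_def by blast
    qed (use Dc D_up[OF RX(1) v] in auto)
    have D: "D v e0" "D v y1" using D_up[OF e0(1) v] D_up[OF UPair_D(1)[OF y1] v] by auto
    have "Rel v R' e0 y1" using Rel'[OF v] E_refl D by blast
    moreover have "Sub v e0 c" unfolding Sub_def using D Dc e0(2) le_trans[OF v] by blast
    ultimately obtain x where "M v x y1" "M v x c" using c D le_refl unfolding Closed_def by blast
    then show "M v y c" using UPair_iff[OF UPair_up[OF y1 v]] M_congL by blast
  qed
  have closedI: "Closed v Y R'" if v: "w \<preceq> v" and Y: "Closed v Y R" "M v y Y" for v Y
    unfolding Closed_def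
  proof (intro conjI allI impI)
    fix u a b u' assume u: "v \<preceq> u" "D u a" "D u b" "Rel u R' a b" "u \<preceq> u'" "Sub u' a Y"
    from u(4) Rel'[OF le_trans[OF v u(1)]] consider "Rel u R a b" | "E u b y1" by blast
    then show "\<exists>x. D u' x \<and> M u' x b \<and> M u' x Y"
    proof cases
      case 1
      then show ?thesis using Y(1) u unfolding Closed_def by blast
    next
      case 2
      note vu' = le_trans[OF u(1,5)]
      have yY: "M u' y Y" using M_up[OF Y(2) vu'] .
      have "M u' y y1" using UPair_iff[OF UPair_up[OF y1 le_trans[OF v vu']]] E_refl M_D1[OF yY]
        by blast
      then have "M u' y b" using M_congR E_sym E_up[OF 2 u(5)] by blast
      then show ?thesis using yY M_D1 by blast
    qed
  qed (use M_D2[OF Y(2)] D_up[OF R'(1) v] in auto)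
  have "Generated w X R y G"
    unfolding Generated_def
  proof (intro conjI allI impI)
    fix v c assume "w \<preceq> v" "M v c G"
    then show "Sub v c X" "Closed v c R" using G(2) closedD by blast+
  next
    fix v Y assume v: "w \<preceq> v" and Y: "Sub v Y X \<and> Closed v Y R \<and> M v y Y"
    then obtain c where c: "M v c G" "Sub v c Y" using G(3)[OF v] closedI[OF v] by blast
    then show "\<exists>c. D v c \<and> M v c G \<and> M v y c \<and> Sub v c Y"
      using G(2)[OF v] closedD[OF v] M_D1 by blast
  qed
  with G(1) show ?thesis by blast
qed

text \<open>No particular generating set is singled out for a point \<open>y\<close>, so strong
  collection gathers some for each \<open>y \<in> X\<close>; the union of the collected sets serves
  all points.\<close>

lemma set_generated:
  assumes R: "RuleSet w R X"
  shows "\<exists>G. D w G \<and> (\<forall>v c. w \<preceq> v \<longrightarrow> M v c G \<longrightarrow> Sub v c X \<and> Closed v c R) \<and>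
    (\<forall>v Y y. w \<preceq> v \<longrightarrow> Sub v Y X \<longrightarrow> Closed v Y R \<longrightarrow> M v y Y \<longrightarrow> (\<exists>c. M v c G \<and> M v y c \<and> Sub v c Y))"
proof -
  have RX: "D w R" "D w X" using R by (auto simp: RuleSet_def)
  have d2: "class_rel w (\<lambda>v y G. Generated v X R y G)"
    by (rule class_relI[of X "[R]" w _ "is_generated 0 1 3 2"])
      (use RX in \<open>auto simp: numeral_eq_Suc ok_Cons\<close>)
  have t: "total w X (\<lambda>v y G. Generated v X R y G)"
    by (rule totalI) (use generated_exists RuleSet_up[OF R] in blast)
  obtain C where C: "D w C"
    "\<And>v y. w \<preceq> v \<Longrightarrow> M v y X \<Longrightarrow> \<exists>G. M v G C \<and> Generated v X R y G"
    "\<And>v G. w \<preceq> v \<Longrightarrow> M v G C \<Longrightarrow> \<exists>y. M v y X \<and> Generated v X R y G"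
    using collection[OF RX(2) d2 t] by blast
  obtain G where G: "D w G" "\<And>v x. w \<preceq> v \<Longrightarrow> M v x G \<longleftrightarrow> (\<exists>y. M v y C \<and> M v x y)"
    using union[OF C(1)] by blast
  show ?thesis
  proof (rule exI[of _ G], intro conjI allI impI)
    fix v c assume v: "w \<preceq> v" "M v c G"
    then obtain H y where "M v c H" "Generated v X R y H" using G(2) C(3) by blast
    then show "Sub v c X" "Closed v c R" using M_D1 le_refl unfolding Generated_def by blast+
  next
    fix v Y y assume v: "w \<preceq> v" and Y: "Sub v Y X" "Closed v Y R" "M v y Y"
    have "M v y X" using Y(1,3) le_refl unfolding Sub_def by blast
    then obtain H where H: "M v H C" "Generated v X R y H" using C(2)[OF v] by blast
    then obtain c where "M v c H" "M v y c" "Sub v c Y"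
      using Y Sub_D(1)[OF Y(1)] le_refl unfolding Generated_def by blast
    then show "\<exists>c. M v c G \<and> M v y c \<and> Sub v c Y" using G(2)[OF v] H(1) by blast
  qed (rule G(1))
qed

section \<open>From the semantic statement to the formula\<close>

lemma full_NID: "ok w e [] \<Longrightarrow> sat w e [] Full_NID"
  unfolding Full_NID_def sat_all_imp2
proof (intro conjI allI impI)
  fix v X R assume "ok w e []" and v: "w \<preceq> v"
    and "sat v e ([] @ [X, R]) (is_rule_set (Suc (length [])) (length []))"
  then have R: "RuleSet v R X" and ok: "ok v e [X, R]" by (auto dest: sat_ok)
  have ok': "ok u e [X, R]" if "v \<preceq> u" for u using ok that by (rule ok_up)
  obtain G where G: "D v G"
    "\<And>u c. v \<preceq> u \<Longrightarrow> M u c G \<Longrightarrow> Sub u c X \<and> Closed u c R"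
    "\<And>u Y y. v \<preceq> u \<Longrightarrow> Sub u Y X \<Longrightarrow> Closed u Y R \<Longrightarrow> M u y Y \<Longrightarrow> \<exists>c. M u c G \<and> M u y c \<and> Sub u c Y"
    using set_generated[OF R] by blast
  have okG: "ok u e [X, R, G]" if "v \<preceq> u" for u
    using ok'[OF that] D_up[OF G(1) that] by (simp add: ok_Cons)
  have "sat v e [X, R, G] (all (\<lambda>c. imp (mem c 2) (conj (is_subset c 0) (is_closed c (Suc 0)))))"
    unfolding sat_all_imp
  proof (intro conjI allI impI)
    fix u c assume u: "v \<preceq> u" and c: "sat u e ([X, R, G] @ [c]) (mem (length [X, R, G]) 2)"
    have "M u c G" using c by (simp add: numeral_2_eq_2)
    then show "sat u e ([X, R, G] @ [c]) (conj (is_subset (length [X, R, G]) 0) (is_closed (length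
      [X, R, G]) (Suc 0)))"
      using G(2)[OF u] sat_ok[OF c] by simp
  qed (use okG in auto)
  moreover have "sat v e [X, R, G] (all (\<lambda>Y. imp (conj (is_subset Y 0) (is_closed Y (Suc 0)))
      (all (\<lambda>y. imp (mem y Y) (ex (\<lambda>c. conj (mem c 2) (conj (mem y c) (is_subset c Y))))))))"
    unfolding sat_all_imp
  proof (intro conjI allI impI)
    fix u Y u' y assume u: "v \<preceq> u" "u \<preceq> u'"
      and Y: "sat u e ([X, R, G] @ [Y]) (conj (is_subset (length [X, R, G]) 0) (is_closed (length
        [X, R, G]) (Suc 0)))"
      and y: "sat u' e (([X, R, G] @ [Y]) @ [y]) (mem (length ([X, R, G] @ [Y])) (length [X, R,
        G]))"
    have "Sub u Y X" "Closed u Y R" "M u' y Y" using Y y by simp_all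
    then obtain c where "M u' c G" "M u' y c" "Sub u' c Y"
      using G(3)[OF le_trans[OF u]] Sub_up[OF _ u(2)] Closed_up[OF _ u(2)] by blast
    then show "sat u' e (([X, R, G] @ [Y]) @ [y])
        (ex (\<lambda>c. conj (mem c 2) (conj (mem (length ([X, R, G] @ [Y])) c) (is_subset c (length [X, R,
          G])))))"
      using sat_ok[OF y] M_D1 by (auto simp: sat_ex' ok_Cons numeral_2_eq_2 intro!: exI[of _ c])
  qed (use okG in \<open>auto dest: sat_ok\<close>)
  ultimately show "sat v e ([] @ [X, R]) (ex (\<lambda>G.
      conj (all (\<lambda>c. imp (mem c G) (conj (is_subset c (length [])) (is_closed c (Suc (length
        []))))))
        (all (\<lambda>Y. imp (conj (is_subset Y (length [])) (is_closed Y (Suc (length []))))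
          (all (\<lambda>y. imp (mem y Y) (ex (\<lambda>c. conj (mem c G) (conj (mem y c) (is_subset c Y))))))))))"
    unfolding sat_ex by (intro exI[of _ G]) (simp add: numeral_2_eq_2)
qed

end

theorem theorem6p13:
  "CZF \<union> {PA 0} \<union> RDC_W \<turnstile> Full_NID 0"
proof (rule kripke_completeness)
  fix le :: "nat \<times> fm set \<Rightarrow> nat \<times> fm set \<Rightarrow> bool" and D :: "nat \<times> fm set \<Rightarrow> nat \<Rightarrow> bool" and M E w
    and e :: "nat \<Rightarrow> nat"
  assume m: "kripke_model le D M E (CZF \<union> {PA 0} \<union> RDC_W)" and D: "\<And>i. D w (e i)"
  interpret czf le D M E using m by (simp add: czf_def)
  have "sat w e [] Full_NID" using D by (intro full_NID) (simp add: ok_def)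
  then show "forces w e (Full_NID 0)" by (simp add: sat_def env_def[abs_def])
qed

end
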